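(* Let $G<PSL(2,\mathbb{C})$ be a subgroup isomorphic to the dihedral group $\mathbb{D}_n$ (of order $2n$) with $n\geq 3$. Let $\eta$ be a rational 1-form on $\widehat{\mathbb{C}}$ with simple poles and simple zeros. Then the 1-form $\eta$, with $k$ poles and $k-2$ zeros, is $G$-invariant if and only if there is an $n$-gonal dihedron $\mathcal{A}$ with isotropy group $G$ such that one of the following cases is true: A) $V(\mathcal{A})\cup F(\mathcal{A})\subset\mathcal{P}_\eta$, and either a) $E(\mathcal{A})\subset\mathcal{Z}_\eta$, in which case there are $\ell$ poles and $\ell$ zeros in the quasi-fundamental region $\widehat{\mathcal{R}}_{\mathcal{A}}$, for some non-negative integer $\ell$ satisfying $k=\ell\cdot\mathrm{Card}(G)+v+f$; or b) $E(\mathcal{A})\subset\mathcal{P}_\eta$, in which case there are $\ell$ poles and $\ell+1$ zeros in the quasi-fundamental region $\widehat{\mathcal{R}}_{\mathcal{A}}$, for some non-negative integer $\ell$ satisfying $k=\ell\cdot\mathrm{Card}(G)+v+f+e$. B) $V(\mathcal{A})\cup E(\mathcal{A})\subset\mathcal{Z}_\eta$ and $F(\mathcal{A})\subset\mathcal{P}_\eta$, and there are $\ell$ poles and $\ell-1$ zeros in the quasi-fundamental region $\widehat{\mathcal{R}}_{\mathcal{A}}$, for some non-negative integer $\ell$ satisfying $k=\ell\cdot\mathrm{Card}(G)+f$. Moreover, $G$ is the maximal group, as a subgroup of $PSL(2,\mathbb{C})$, satisfying either (A) or (B) if and only if $\eta$ has isotropy group $G$.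
   Context: $\mathcal{P}_\eta,\mathcal{Z}_\eta$ are the sets of poles and zeros of $\eta$ in $\widehat{\mathbb{C}}$. $T_*\eta=(T^{-1})^*\eta$; $\eta$ is $G$-invariant if $g_*\eta=\eta$ for all $g\in G$; the isotropy group of $\eta$ is $\{T\in PSL(2,\mathbb{C}):T_*\eta=\eta\}$. Identify $\widehat{\mathbb{C}}$ with the round unit sphere by stereographic projection. The standard $n$-gonal dihedron $\mathcal{A}_0$ has as vertices the $n$-th roots of unity, as edges the $n$ arcs of the unit circle between consecutive vertices (with centers the midpoints of these arcs), and as faces the two complementary discs (with centers $0$ and $\infty$). An $n$-gonal dihedron is an image $\mathcal{A}=T(\mathcal{A}_0)$ with $T\in PSL(2,\mathbb{C})$; its vertices, edges, faces and centers are the images under $T$ of those of $\mathcal{A}_0$. $V(\mathcal{A})$, $E(\mathcal{A})$, $F(\mathcal{A})$ are the sets of vertices, of centers of edges, and of centers of faces, with cardinalities $v=n$, $e=n$, $f=2$. The isotropy group of $\mathcal{A}$ is the group of all $TRT^{-1}$, where $R$ runs over the rotations of the sphere preserving $\mathcal{A}_0$. The fundamental region $\mathcal{R}_{\mathcal{A}}$ (the image under $T$ of the corresponding region for $\mathcal{A}_0$) consists of: the interior of the triangle formed by the center of a face and the two vertices of an edge of that face; half of the interior of that edge; the segment joining one of the two vertices of the edge to the center of the face; one of the two vertices of the edge; and the center of the face. The quasi-fundamental region is $\widehat{\mathcal{R}}_{\mathcal{A}}=\mathcal{R}_{\mathcal{A}}\setminus(V(\mathcal{A})\cup E(\mathcal{A})\cup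 F(\mathcal{A}))$.
   Formalization: Cases (A) and (B) additionally require the sets of poles and of zeros to be G-invariant (otherwise points outside the region are unconstrained and "if" fails), and "the maximal group" means the largest under inclusion among dihedral subgroups (order at least 6) satisfying (A) or (B). *)

theory Defs
  imports
    "HOL-Analysis.Analysis"
    "HOL-Computational_Algebra.Computational_Algebra"
    "HOL-Computational_Algebra.Field_as_Ring"
    "HOL-Algebra.Group"
begin

section \<open>The Riemann sphere and its Moebius group\<close>

text \<open>\<^const>\<open>None\<close> is the point at infinity.\<close>

type_synonym csphere = "complex option"

definition moebius :: "complex \<Rightarrow> complex \<Rightarrow> complex \<Rightarrow> complex \<Rightarrow> csphere \<Rightarrow> csphere" where
  "moebius a b c d x = (case x of
      None \<Rightarrow> if c = 0 then None else Some (a / c)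
    | Some z \<Rightarrow> if c * z + d = 0 then None else Some ((a * z + b) / (c * z + d)))"

text \<open>An element of PSL(2,C) is identified with its (faithful) action on the sphere; the two
  matrices M and -M give the same map.\<close>

definition PSL2C :: "(csphere \<Rightarrow> csphere) monoid" where
  "PSL2C = \<lparr>carrier = {moebius a b c d |a b c d. a * d - b * c = 1},
            monoid.mult = (\<circ>), one = id\<rparr>"

text \<open>The pair \<open>(i, s)\<close> stands for \<open>\<rho>\<^sup>i \<sigma>\<^sup>s\<close>, where \<open>\<rho>\<close> has order \<open>n\<close>, \<open>\<sigma>\<close> has order 2 and
  \<open>\<sigma> \<rho> = \<rho>\<^sup>-\<^sup>1 \<sigma>\<close>.\<close>

definition dihedral_group :: "nat \<Rightarrow> (int \<times> bool) monoid" where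
  "dihedral_group n = \<lparr>carrier = {0..<int n} \<times> UNIV,
     monoid.mult = (\<lambda>(i, s) (j, t). ((if s then i - j else i + j) mod int n, s \<noteq> t)),
     one = (0, False)\<rparr>"

section \<open>Rational 1-forms\<close>

text \<open>The rational function \<open>f\<close> represents the 1-form \<open>f dz\<close> on the sphere.\<close>

type_synonym rational_form = "complex poly fract"

definition fract_eval :: "complex poly fract \<Rightarrow> complex \<Rightarrow> complex" where
  "fract_eval f z = poly (fst (quot_of_fract f)) z / poly (snd (quot_of_fract f)) z"

text \<open>Order of vanishing of a nonzero form at a point. In the coordinate \<open>w = 1/z\<close> the form \<open>f dz\<close>
  reads \<open>- f(1/w) / w\<^sup>2 dw\<close>, whence the order at infinity.\<close>

definition form_order :: "rational_form \<Rightarrow> csphere \<Rightarrow> int" where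
  "form_order \<eta> x = (let p = fst (quot_of_fract \<eta>); q = snd (quot_of_fract \<eta>) in
     case x of
       Some z \<Rightarrow> int (Polynomial.order z p) - int (Polynomial.order z q)
     | None \<Rightarrow> int (degree q) - int (degree p) - 2)"

definition form_poles :: "rational_form \<Rightarrow> csphere set" where
  "form_poles \<eta> = {x. form_order \<eta> x < 0}"

definition form_zeros :: "rational_form \<Rightarrow> csphere set" where
  "form_zeros \<eta> = {x. form_order \<eta> x > 0}"

definition simple_poles_and_zeros :: "rational_form \<Rightarrow> bool" where
  "simple_poles_and_zeros \<eta> \<longleftrightarrow>
     (\<forall>x\<in>form_poles \<eta>. form_order \<eta> x = -1) \<and> (\<forall>x\<in>form_zeros \<eta>. form_order \<eta> x = 1)"

text \<open>\<open>S\<^sup>*(f dz) = (f \<circ> S) S' dz\<close>. A rational function is determined by its values outside a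
  finite set, so poles and the points sent to infinity can be ignored.\<close>

definition pullback :: "(csphere \<Rightarrow> csphere) \<Rightarrow> rational_form \<Rightarrow> rational_form" where
  "pullback S \<eta> = (let s = (\<lambda>z. the (S (Some z))) in
     THE \<omega>. finite {z. fract_eval \<omega> z \<noteq> fract_eval \<eta> (s z) * deriv s z})"

definition pushforward :: "(csphere \<Rightarrow> csphere) \<Rightarrow> rational_form \<Rightarrow> rational_form" where
  "pushforward T \<eta> = pullback (inv_into UNIV T) \<eta>"

definition form_invariant :: "(csphere \<Rightarrow> csphere) set \<Rightarrow> rational_form \<Rightarrow> bool" where
  "form_invariant G \<eta> \<longleftrightarrow> (\<forall>g\<in>G. pushforward g \<eta> = \<eta>)"

definition form_isotropy :: "rational_form \<Rightarrow> (csphere \<Rightarrow> csphere) set" where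
  "form_isotropy \<eta> = {T \<in> carrier PSL2C. pushforward T \<eta> = \<eta>}"

definition set_invariant :: "(csphere \<Rightarrow> csphere) set \<Rightarrow> csphere set \<Rightarrow> bool" where
  "set_invariant G S \<longleftrightarrow> (\<forall>g\<in>G. g ` S = S)"

section \<open>Rotations of the sphere\<close>

definition stereo :: "csphere \<Rightarrow> real^3" where
  "stereo x = (case x of
      None \<Rightarrow> vector [0, 0, 1]
    | Some z \<Rightarrow> vector [2 * Re z / (1 + (cmod z)\<^sup>2), 2 * Im z / (1 + (cmod z)\<^sup>2),
                       ((cmod z)\<^sup>2 - 1) / ((cmod z)\<^sup>2 + 1)])"

definition sphere_rotation :: "(csphere \<Rightarrow> csphere) \<Rightarrow> bool" where
  "sphere_rotation R \<longleftrightarrow>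
     (\<exists>Q::real^3^3. rotation_matrix Q \<and> (\<forall>x. stereo (R x) = Q *v stereo x))"

section \<open>Dihedra\<close>

datatype dihedron = Dihedron
  (vertices: "csphere set") (edges: "csphere set set") (faces: "csphere set set")
  (edge_centers: "csphere set") (face_centers: "csphere set")

definition std_dihedron :: "nat \<Rightarrow> dihedron" where
  "std_dihedron n = Dihedron
     {Some z |z. z ^ n = 1}
     {{Some (cis t) |t. 2 * pi * real j / real n \<le> t \<and> t \<le> 2 * pi * real (j + 1) / real n} |j. j < n}
     {{Some z |z. cmod z < 1}, insert None {Some z |z. cmod z > 1}}
     {Some (cis (pi * real (2 * j + 1) / real n)) |j. j < n}
     {Some 0, None}"

definition map_dihedron :: "(csphere \<Rightarrow> csphere) \<Rightarrow> dihedron \<Rightarrow> dihedron" where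
  "map_dihedron T A = Dihedron (T ` vertices A) ((`) T ` edges A) ((`) T ` faces A)
     (T ` edge_centers A) (T ` face_centers A)"

definition is_dihedron :: "nat \<Rightarrow> dihedron \<Rightarrow> bool" where
  "is_dihedron n A \<longleftrightarrow> (\<exists>T\<in>carrier PSL2C. A = map_dihedron T (std_dihedron n))"

text \<open>All presentations \<open>A = T(std_dihedron n)\<close> are allowed at once; they give the same group.\<close>

definition dihedron_isotropy :: "nat \<Rightarrow> dihedron \<Rightarrow> (csphere \<Rightarrow> csphere) set" where
  "dihedron_isotropy n A = {T \<circ> R \<circ> inv_into UNIV T |T R.
     T \<in> carrier PSL2C \<and> A = map_dihedron T (std_dihedron n) \<and>
     sphere_rotation R \<and> map_dihedron R (std_dihedron n) = std_dihedron n}"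

text \<open>The fundamental region involves choices: a face (\<open>c\<close> is its center and \<open>I\<close> its set of radii
  outside the center), an edge with end points \<open>cis a\<close> and \<open>cis b\<close>, a half \<open>H\<close> of that edge
  (containing the center of the edge, so that every orbit is met), the end point \<open>cis u\<close> that is
  joined to \<open>c\<close>, and the end point \<open>cis w\<close> that belongs to the region.\<close>

definition std_fundamental_region :: "nat \<Rightarrow> csphere set \<Rightarrow> bool" where
  "std_fundamental_region n R \<longleftrightarrow> (\<exists>j<n. \<exists>a b I c H u w.
     a = 2 * pi * real j / real n \<and> b = 2 * pi * real (j + 1) / real n \<and>
     (I, c) \<in> {({0<..<1}, Some 0), ({1<..}, None)} \<and>
     H \<in> {{a<..(a + b) / 2}, {(a + b) / 2..<b}} \<and>
     u \<in> {a, b} \<and> w \<in> {a, b} \<and>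
     R = {Some (rcis r t) |r t. r \<in> I \<and> a < t \<and> t < b}
       \<union> {Some (cis t) |t. t \<in> H}
       \<union> {Some (rcis r u) |r. r \<in> I}
       \<union> {Some (cis w), c})"

definition fundamental_region :: "nat \<Rightarrow> dihedron \<Rightarrow> csphere set \<Rightarrow> bool" where
  "fundamental_region n A R \<longleftrightarrow> (\<exists>T\<in>carrier PSL2C. \<exists>R\<^sub>0.
     A = map_dihedron T (std_dihedron n) \<and> std_fundamental_region n R\<^sub>0 \<and> R = T ` R\<^sub>0)"

definition quasi_fundamental_region :: "nat \<Rightarrow> dihedron \<Rightarrow> csphere set \<Rightarrow> bool" where
  "quasi_fundamental_region n A Q \<longleftrightarrow> (\<exists>R. fundamental_region n A R \<and>
     Q = R - (vertices A \<union> edge_centers A \<union> face_centers A))"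

section \<open>The two cases\<close>

text \<open>In the following definitions \<open>Q\<close> is the quasi-fundamental region of \<open>A\<close>.\<close>

definition case_A ::
  "rational_form \<Rightarrow> nat \<Rightarrow> (csphere \<Rightarrow> csphere) set \<Rightarrow> dihedron \<Rightarrow> csphere set \<Rightarrow> bool" where
  "case_A \<eta> k G A Q \<longleftrightarrow>
     vertices A \<union> face_centers A \<subseteq> form_poles \<eta> \<and>
     ((edge_centers A \<subseteq> form_zeros \<eta> \<and>
       (\<exists>l::nat. card (form_poles \<eta> \<inter> Q) = l \<and> card (form_zeros \<eta> \<inter> Q) = l \<and>
          k = l * card G + card (vertices A) + card (face_centers A))) \<or>
      (edge_centers A \<subseteq> form_poles \<eta> \<and>
       (\<exists>l::nat. card (form_poles \<eta> \<inter> Q) = l \<and> card (form_zeros \<eta> \<inter> Q) = l + 1 \<and>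
          k = l * card G + card (vertices A) + card (face_centers A) + card (edge_centers A))))"

definition case_B ::
  "rational_form \<Rightarrow> nat \<Rightarrow> (csphere \<Rightarrow> csphere) set \<Rightarrow> dihedron \<Rightarrow> csphere set \<Rightarrow> bool" where
  "case_B \<eta> k G A Q \<longleftrightarrow>
     vertices A \<union> edge_centers A \<subseteq> form_zeros \<eta> \<and> face_centers A \<subseteq> form_poles \<eta> \<and>
     (\<exists>l::nat. card (form_poles \<eta> \<inter> Q) = l \<and> int (card (form_zeros \<eta> \<inter> Q)) = int l - 1 \<and>
        k = l * card G + card (face_centers A))"

text \<open>\<open>Q\<close> assigns to each dihedron its quasi-fundamental region. The configuration of poles and
  zeros is the one obtained by replicating the contents of the region by means of the group, i.e.
  the sets of poles and of zeros are invariant. Without this, the numbers of points in the region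
  would leave the points outside of it arbitrary, and the form need not be invariant.\<close>

definition satisfies_A_or_B ::
  "(dihedron \<Rightarrow> csphere set) \<Rightarrow> rational_form \<Rightarrow> nat \<Rightarrow> nat \<Rightarrow> (csphere \<Rightarrow> csphere) set \<Rightarrow> bool" where
  "satisfies_A_or_B Q \<eta> k n G \<longleftrightarrow>
     set_invariant G (form_poles \<eta>) \<and> set_invariant G (form_zeros \<eta>) \<and>
     (\<exists>A. is_dihedron n A \<and> dihedron_isotropy n A = G \<and>
        (case_A \<eta> k G A (Q A) \<or> case_B \<eta> k G A (Q A)))"

end

theory Submission
  imports Defs
begin

text \<open>The group \<open>G\<close> is first made explicit. An element of order \<open>n \<ge> 3\<close> is conjugate to a rotation about
  \<open>0\<close> and \<open>\<infinity>\<close>, and the relations of the dihedral group then make \<open>G\<close> conjugate to the group \<open>Dih n\<close> of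
  the maps \<open>a z\<close> and \<open>a / z\<close> with \<open>a\<^sup>n = 1\<close> (\<open>dihedral_conj_Dih\<close>). The isotropy groups of the \<open>n\<close>-gonal
  dihedra are exactly these conjugates (\<open>dihedron_isotropy_conj\<close>).

  Invariance is a condition on the divisor and on finitely many fixed points. If the sets of simple
  poles and zeros are invariant under \<open>g\<close>, then \<open>g\<^sup>*\<eta>\<close> and \<open>\<eta>\<close> have the same divisor, so \<open>g\<^sup>*\<eta> = k \<eta>\<close> with a
  constant \<open>k\<close>. At a fixed point of \<open>g\<close> with multiplier \<open>\<mu>\<close>, where \<open>\<eta>\<close> has order \<open>m\<close>, comparing leading
  coefficients gives \<open>k = \<mu>\<^sup>m\<^sup>+\<^sup>1\<close> (\<open>fixed_point_character\<close>). Rotations have the face centers as fixed points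
  and there \<open>\<mu>\<close> can be any \<open>n\<close>-th root of unity; half-turns fix vertices or edge centers and there
  \<open>\<mu> = -1\<close>. As \<open>|m| \<le> 1\<close> and \<open>n \<ge> 3\<close>, the form is invariant if and only if its divisor is, the face
  centers are poles, and every vertex and edge center is a pole or a zero
  (\<open>invariant_imp_orders\<close>, \<open>orders_imp_invariant\<close>).

  Vertices and edge centers are single orbits, which leaves four combinations: the three cases of the
  theorem and one in which the vertices are zeros and the edge centers are poles. A rotation of the
  dihedron by half a step exchanges vertices and edge centers without changing the group, so the last
  combination becomes case A(a). Outside the special points the fundamental region meets every orbit
  once (\<open>region_meets_orbit_once\<close>), so an invariant set is counted by its part in the region, and the
  numbers follow from the \<open>k\<close> poles and \<open>k - 2\<close> zeros.

  For the maximality, let \<open>t\<close> be in the isotropy group of \<open>\<eta>\<close>. Then \<open>t G t\<^sup>-\<^sup>1\<close> is a dihedral group leaving \<open>\<eta>\<close>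
  invariant, hence it is contained in \<open>G\<close> if \<open>G\<close> is maximal. The normalizer of \<open>Dih n\<close> is \<open>Dih (2 n)\<close>
  (\<open>normalizer_Dih\<close>), so either \<open>t\<close> is in \<open>G\<close>, or \<open>t\<close> and \<open>G\<close> generate a dihedral group of twice the order;
  that group also leaves \<open>\<eta>\<close> invariant and therefore lies in \<open>G\<close>, with \<open>t\<close> in it.\<close>

section \<open>The Moebius group\<close>

text \<open>The point with homogeneous coordinates \<open>[u : v]\<close>. Moebius maps act linearly on these, so that
  compositions and inverses reduce to matrix products and the point at infinity needs no case
  distinction.\<close>

definition proj :: "complex \<Rightarrow> complex \<Rightarrow> csphere" where
  "proj u v = (if v = 0 then None else Some (u / v))"

lemma sphere_proj_cases:
  obtains u v where "x = proj u v" "u \<noteq> 0 \<or> v \<noteq> 0"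
proof (cases x)
  case None
  then show ?thesis using that[of 1 0] by (simp add: proj_def)
next
  case (Some z)
  then show ?thesis using that[of z 1] by (simp add: proj_def)
qed

lemma moebius_proj:
  assumes "u \<noteq> 0 \<or> v \<noteq> 0"
  shows "moebius a b c d (proj u v) = proj (a * u + b * v) (c * u + d * v)"
proof (cases "v = 0")
  case True
  then have "u \<noteq> 0" using assms by blast
  then show ?thesis unfolding True by (simp add: moebius_def proj_def)
next
  case False
  then have e: "c * (u / v) + d = (c * u + d * v) / v" "a * (u / v) + b = (a * u + b * v) / v"
    by (simp_all add: add_divide_distrib)
  have "moebius a b c d (proj u v) = moebius a b c d (Some (u / v))"
    using False by (simp add: proj_def)
  also have "\<dots> = proj (a * u + b * v) (c * u + d * v)"
    using False unfolding moebius_def option.case e proj_def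
    by (simp only: divide_eq_0_iff divide_divide_eq_left' divide_divide_eq_right
        nonzero_mult_divide_mult_cancel_right simp_thms if_False times_divide_eq_left mult.commute[of v])
  finally show ?thesis .
qed

lemma det_image_nonzero:
  fixes a b c d u v :: complex
  assumes "a * d - b * c \<noteq> 0" "u \<noteq> 0 \<or> v \<noteq> 0"
  shows "a * u + b * v \<noteq> 0 \<or> c * u + d * v \<noteq> 0"
proof (rule ccontr)
  assume "\<not> ?thesis"
  then have h: "a * u + b * v = 0" "c * u + d * v = 0" by auto
  have "(a * d - b * c) * u = d * (a * u + b * v) - b * (c * u + d * v)"
    "(a * d - b * c) * v = a * (c * u + d * v) - c * (a * u + b * v)"
    by (simp_all add: algebra_simps)
  then show False using h assms by simp
qed

lemma moebius_comp:
  assumes "a' * d' - b' * c' \<noteq> 0"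
  shows "moebius a b c d \<circ> moebius a' b' c' d' =
    moebius (a * a' + b * c') (a * b' + b * d') (c * a' + d * c') (c * b' + d * d')"
proof
  fix x
  obtain u v where x: "x = proj u v" "u \<noteq> 0 \<or> v \<noteq> 0" by (rule sphere_proj_cases)
  show "(moebius a b c d \<circ> moebius a' b' c' d') x = moebius (a * a' + b * c') (a * b' + b * d') (c * a' + d * c') (c * b' + d * d') x"
    unfolding x(1) comp_apply moebius_proj[OF x(2)]
      moebius_proj[OF det_image_nonzero[OF assms x(2)]]
    by (rule arg_cong2[of _ _ _ _ proj]) (simp_all only: algebra_simps)
qed

lemma moebius_scale:
  assumes "k \<noteq> 0"
  shows "moebius (k * a) (k * b) (k * c) (k * d) = moebius a b c d"
proof
  fix x
  have "k * c * z + k * d = k * (c * z + d)" "k * a * z + k * b = k * (a * z + b)" for z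
    by (simp_all add: algebra_simps)
  then show "moebius (k * a) (k * b) (k * c) (k * d) x = moebius a b c d x"
    using assms by (cases x) (auto simp: moebius_def)
qed

lemma moebius_id: "k \<noteq> 0 \<Longrightarrow> moebius k 0 0 k = id"
  by (auto simp: moebius_def fun_eq_iff split: option.splits)

lemma moebius_inverse:
  assumes "a * d - b * c \<noteq> 0"
  shows "moebius d (-b) (-c) a \<circ> moebius a b c d = id"
    "moebius a b c d \<circ> moebius d (-b) (-c) a = id"
proof -
  have "d * a + - b * c \<noteq> 0" "a * d + b * - c \<noteq> 0"
    using assms by (simp_all add: algebra_simps)
  then show "moebius d (-b) (-c) a \<circ> moebius a b c d = id"
    "moebius a b c d \<circ> moebius d (-b) (-c) a = id"
    using assms moebius_id[of "a * d - b * c"]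
    by (simp_all add: moebius_comp algebra_simps)
qed

abbreviation Moeb :: "(csphere \<Rightarrow> csphere) set" where
  "Moeb \<equiv> carrier PSL2C"

text \<open>A nonzero complex determinant has a square root, by whose inverse the matrix is rescaled.\<close>

lemma moebius_in_Moeb:
  assumes "a * d - b * c \<noteq> 0"
  shows "moebius a b c d \<in> Moeb"
proof -
  define k where "k = inverse (csqrt (a * d - b * c))"
  have k: "k \<noteq> 0" "k ^ 2 * (a * d - b * c) = 1"
    using assms by (simp_all add: k_def power_inverse)
  have "(k * a) * (k * d) - (k * b) * (k * c) = 1"
    using k(2) by (simp add: power2_eq_square algebra_simps)
  then have "moebius (k * a) (k * b) (k * c) (k * d) \<in> Moeb"
    unfolding PSL2C_def by auto
  then show ?thesis using k(1) by (simp add: moebius_scale)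
qed

lemma MoebE:
  assumes "S \<in> Moeb"
  obtains a b c d where "S = moebius a b c d" "a * d - b * c = 1"
  using assms by (auto simp: PSL2C_def)

lemma Moeb_comp: "S \<in> Moeb \<Longrightarrow> T \<in> Moeb \<Longrightarrow> S \<circ> T \<in> Moeb"
proof -
  assume "S \<in> Moeb" "T \<in> Moeb"
  then obtain a b c d a' b' c' d' where S: "S = moebius a b c d" "a * d - b * c = 1"
    and T: "T = moebius a' b' c' d'" "a' * d' - b' * c' = 1" by (metis MoebE)
  have "(a * a' + b * c') * (c * b' + d * d') - (a * b' + b * d') * (c * a' + d * c')
    = (a * d - b * c) * (a' * d' - b' * c')" by (simp add: algebra_simps)
  then show ?thesis using S T moebius_comp[of a' d' b' c' a b c d]
    by (simp add: moebius_in_Moeb)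
qed

lemma Moeb_id: "id \<in> Moeb"
  using moebius_in_Moeb[of 1 1 0 0] moebius_id[of 1] by simp

lemma Moeb_inverse_exists:
  assumes "S \<in> Moeb"
  obtains S' where "S' \<in> Moeb" "S' \<circ> S = id" "S \<circ> S' = id"
proof -
  obtain a b c d where S: "S = moebius a b c d" "a * d - b * c = 1" using assms by (rule MoebE)
  show ?thesis
    using that[of "moebius d (-b) (-c) a"] moebius_inverse[of a d b c] S
      moebius_in_Moeb[of d a "-b" "-c"] by (simp add: algebra_simps)
qed

lemma Moeb_bij: "S \<in> Moeb \<Longrightarrow> bij S"
  by (metis Moeb_inverse_exists o_bij)

abbreviation minv :: "(csphere \<Rightarrow> csphere) \<Rightarrow> csphere \<Rightarrow> csphere" where
  "minv S \<equiv> inv_into UNIV S"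

lemma Moeb_inv: "S \<in> Moeb \<Longrightarrow> minv S \<in> Moeb"
  by (metis Moeb_inverse_exists inv_unique_comp)

lemma inv_comp_Moeb [simp]:
  assumes "S \<in> Moeb" shows "minv S \<circ> S = id" "S \<circ> minv S = id"
  using Moeb_bij[OF assms] by (auto simp: bij_is_inj bij_is_surj surj_iff[symmetric])

lemma mult_PSL2C [simp]: "x \<otimes>\<^bsub>PSL2C\<^esub> y = x \<circ> y"
  by (simp add: PSL2C_def)

lemma one_PSL2C [simp]: "\<one>\<^bsub>PSL2C\<^esub> = id"
  by (simp add: PSL2C_def)

lemma group_PSL2C: "group PSL2C"
proof (rule groupI)
  fix x assume "x \<in> Moeb"
  then obtain y where "y \<in> Moeb" "y \<circ> x = id" by (rule Moeb_inverse_exists)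
  then show "\<exists>y\<in>Moeb. y \<otimes>\<^bsub>PSL2C\<^esub> x = \<one>\<^bsub>PSL2C\<^esub>" by auto
qed (simp_all add: Moeb_comp Moeb_id comp_assoc)

lemma m_inv_PSL2C: "S \<in> Moeb \<Longrightarrow> inv\<^bsub>PSL2C\<^esub> S = minv S"
  by (rule group.inv_equality[OF group_PSL2C]) (auto simp: Moeb_inv)

lemma conj_cancel:
  assumes T: "T \<in> Moeb" and e: "T \<circ> g \<circ> minv T = T \<circ> h \<circ> minv T"
  shows "g = h"
proof -
  have "minv T \<circ> T \<circ> f \<circ> (minv T \<circ> T) = minv T \<circ> (T \<circ> f \<circ> minv T) \<circ> T" for f
    by (simp only: comp_assoc)
  then have "minv T \<circ> T \<circ> g \<circ> (minv T \<circ> T) = minv T \<circ> T \<circ> h \<circ> (minv T \<circ> T)" using e by simp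
  then show ?thesis using T by simp
qed

definition conj_by :: "(csphere \<Rightarrow> csphere) \<Rightarrow> (csphere \<Rightarrow> csphere) set \<Rightarrow> (csphere \<Rightarrow> csphere) set"
  where "conj_by T H = {T \<circ> h \<circ> minv T |h. h \<in> H}"

lemma conj_by_comp:
  assumes "S \<in> Moeb" "T \<in> Moeb"
  shows "conj_by (S \<circ> T) H = conj_by S (conj_by T H)"
proof -
  have "minv (S \<circ> T) = minv T \<circ> minv S"
    using assms by (intro o_inv_distrib Moeb_bij)
  then have *: "S \<circ> T \<circ> h \<circ> minv (S \<circ> T) = S \<circ> (T \<circ> h \<circ> minv T) \<circ> minv S" for h
    by (simp add: comp_assoc)
  show ?thesis unfolding conj_by_def * by blast
qed

lemma conj_by_id [simp]: "conj_by id H = H"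
  by (auto simp: conj_by_def)

lemma subgroup_conj_by:
  assumes T: "T \<in> Moeb" and H: "subgroup H PSL2C"
  shows "subgroup (conj_by T H) PSL2C"
proof (rule group.subgroupI[OF group_PSL2C])
  have sub: "H \<subseteq> Moeb" using H by (rule subgroup.subset)
  show "conj_by T H \<subseteq> Moeb"
    using sub T by (auto simp: conj_by_def intro!: Moeb_comp Moeb_inv)
  show "conj_by T H \<noteq> {}"
    using subgroup.one_closed[OF H] by (auto simp: conj_by_def)
  fix x assume "x \<in> conj_by T H"
  then obtain h where h: "h \<in> H" "x = T \<circ> h \<circ> minv T" by (auto simp: conj_by_def)
  have hM: "h \<in> Moeb" using h sub by auto
  have xM: "x \<in> Moeb" using h hM T by (auto intro!: Moeb_comp Moeb_inv)
  have "minv h \<in> H" using subgroup.m_inv_closed[OF H h(1)] by (simp add: m_inv_PSL2C hM)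
  moreover have "minv x = T \<circ> minv h \<circ> minv T"
    using T hM Moeb_bij unfolding h(2)
    by (simp add: o_inv_distrib bij_comp Moeb_inv Moeb_bij inv_inv_eq comp_assoc)
  ultimately show "inv\<^bsub>PSL2C\<^esub> x \<in> conj_by T H"
    unfolding m_inv_PSL2C[OF xM] conj_by_def by auto
  fix y assume "y \<in> conj_by T H"
  then obtain g where g: "g \<in> H" "y = T \<circ> g \<circ> minv T" by (auto simp: conj_by_def)
  have "x \<circ> y = T \<circ> h \<circ> (minv T \<circ> T) \<circ> g \<circ> minv T" unfolding h g by (simp only: comp_assoc)
  then have "x \<circ> y = T \<circ> (h \<circ> g) \<circ> minv T" using T by (simp add: comp_assoc)
  moreover have "h \<circ> g \<in> H" using subgroup.m_closed[OF H h(1) g(1)] by simp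
  ultimately show "x \<otimes>\<^bsub>PSL2C\<^esub> y \<in> conj_by T H" by (auto simp: conj_by_def)
qed

section \<open>The standard dihedral group\<close>

definition dil :: "complex \<Rightarrow> csphere \<Rightarrow> csphere" where
  "dil a = moebius a 0 0 1"

definition flip :: "complex \<Rightarrow> csphere \<Rightarrow> csphere" where
  "flip a = moebius 0 a 1 0"

lemma dil_simps [simp]: "dil a None = None" "dil a (Some z) = Some (a * z)"
  by (simp_all add: dil_def moebius_def)

lemma flip_simps [simp]: "flip a None = Some 0"
  "flip a (Some z) = (if z = 0 then None else Some (a / z))"
  by (simp_all add: flip_def moebius_def)

lemma dil_flip_comp:
  assumes "b \<noteq> 0"
  shows "dil a \<circ> dil b = dil (a * b)" "dil a \<circ> flip b = flip (a * b)"
    "flip a \<circ> dil b = flip (a / b)" "flip a \<circ> flip b = dil (a / b)"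
proof -
  have "(dil a \<circ> dil b) x = dil (a * b) x" "(dil a \<circ> flip b) x = flip (a * b) x"
    "(flip a \<circ> dil b) x = flip (a / b) x" "(flip a \<circ> flip b) x = dil (a / b) x" for x
    using assms by (cases x; simp)+
  then show "dil a \<circ> dil b = dil (a * b)" "dil a \<circ> flip b = flip (a * b)"
    "flip a \<circ> dil b = flip (a / b)" "flip a \<circ> flip b = dil (a / b)"
    unfolding fun_eq_iff by blast+
qed

lemma dil_1: "dil 1 = id"
  by (simp add: dil_def moebius_id)

lemma dil_Moeb: "a \<noteq> 0 \<Longrightarrow> dil a \<in> Moeb"
  unfolding dil_def by (rule moebius_in_Moeb) simp

lemma flip_Moeb: "a \<noteq> 0 \<Longrightarrow> flip a \<in> Moeb"
  unfolding flip_def by (rule moebius_in_Moeb) simp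

lemma dil_inj: "dil a = dil b \<longleftrightarrow> a = b"
proof
  assume "dil a = dil b"
  then have "dil a (Some 1) = dil b (Some 1)" by simp
  then show "a = b" by simp
qed simp

lemma flip_inj: "flip a = flip b \<longleftrightarrow> a = b"
proof
  assume "flip a = flip b"
  then have "flip a (Some 1) = flip b (Some 1)" by simp
  then show "a = b" by simp
qed simp

lemma dil_neq_flip: "dil a \<noteq> flip b"
proof
  assume "dil a = flip b"
  then have "dil a None = flip b None" by simp
  then show False by simp
qed

lemma minv_dil: "a \<noteq> 0 \<Longrightarrow> minv (dil a) = dil (1 / a)"
  by (rule inv_unique_comp) (simp_all add: dil_flip_comp dil_1)

lemma minv_flip: "a \<noteq> 0 \<Longrightarrow> minv (flip a) = flip a"
  by (rule inv_unique_comp) (simp_all add: dil_flip_comp dil_1)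

lemma Moeb_fix_two:
  assumes "S \<in> Moeb" "S (Some 0) = Some 0" "S None = None"
  obtains a where "a \<noteq> 0" "S = dil a"
proof -
  obtain a b c d where S: "S = moebius a b c d" "a * d - b * c = 1" using assms(1) by (rule MoebE)
  have c: "c = 0" using assms(3) by (simp add: S(1) moebius_def split: if_splits)
  then have d: "d \<noteq> 0" "a \<noteq> 0" using S(2) by auto
  have b: "b = 0" using assms(2) d by (simp add: S(1) moebius_def c)
  have "S = dil (a / d)"
    unfolding S(1) b c dil_def using moebius_scale[OF d(1), of "a / d" 0 0 1] d by simp
  then show ?thesis using that[of "a / d"] d by simp
qed

text \<open>If the two points are swapped, composing with \<open>z \<mapsto> 1 / z\<close> makes them fixed.\<close>

lemma Moeb_preserves_zero_inf:
  assumes S: "S \<in> Moeb" and im: "S ` {Some 0, None} = {Some 0, None}"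
  obtains a where "a \<noteq> 0" "S = dil a" | a where "a \<noteq> 0" "S = flip a"
proof -
  have ne: "S (Some 0) \<noteq> S None"
    using bij_is_inj[OF Moeb_bij[OF S]] by (metis injD option.distinct(1))
  have "S (Some 0) \<in> {Some 0, None}" "S None \<in> {Some 0, None}" using im by blast+
  then consider "S (Some 0) = Some 0" "S None = None" | "S (Some 0) = None" "S None = Some 0"
    using ne by auto
  then show ?thesis
  proof cases
    case 1
    then show ?thesis using Moeb_fix_two[OF S] that(1) by metis
  next
    case 2
    have "flip 1 \<circ> S \<in> Moeb" using S by (simp add: Moeb_comp flip_Moeb)
    moreover have "(flip 1 \<circ> S) (Some 0) = Some 0" "(flip 1 \<circ> S) None = None"
      using 2 by simp_all
    ultimately obtain a where a: "a \<noteq> 0" "flip 1 \<circ> S = dil a" by (rule Moeb_fix_two)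
    have "S = (flip 1 \<circ> flip 1) \<circ> S" by (simp add: dil_flip_comp dil_1)
    also have "\<dots> = flip 1 \<circ> dil a" using a by (simp add: comp_assoc)
    finally show ?thesis using that(2)[of "1 / a"] a by (simp add: dil_flip_comp)
  qed
qed

text \<open>The rotations by the multiples of \<open>2 \<pi> / n\<close> about the axis through \<open>0\<close> and \<open>\<infinity>\<close>, and half-turns: the
  map \<open>z \<mapsto> a / z\<close> is the half-turn about the two square roots of \<open>a\<close>.\<close>

definition Dih :: "nat \<Rightarrow> (csphere \<Rightarrow> csphere) set" where
  "Dih n = dil ` {a. a ^ n = 1} \<union> flip ` {a. a ^ n = 1}"

lemma root_of_unity_nonzero:
  fixes a :: complex
  assumes "n > 0" "a ^ n = 1"
  shows "a \<noteq> 0"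
  using assms by (auto simp: power_0_left)

lemma Dih_Moeb: "n > 0 \<Longrightarrow> Dih n \<subseteq> Moeb"
  unfolding Dih_def using dil_Moeb flip_Moeb root_of_unity_nonzero by auto

lemma DihE:
  assumes "h \<in> Dih n"
  obtains a where "a ^ n = 1" "h = dil a" | a where "a ^ n = 1" "h = flip a"
  using assms by (auto simp: Dih_def)

lemma Dih_dil_iff [simp]: "dil a \<in> Dih n \<longleftrightarrow> a ^ n = 1"
  by (auto simp: Dih_def dil_inj dil_neq_flip)

lemma Dih_flip_iff [simp]: "flip a \<in> Dih n \<longleftrightarrow> a ^ n = 1"
  by (auto simp: Dih_def flip_inj dil_neq_flip[symmetric])

lemma Dih_minv: "n > 0 \<Longrightarrow> h \<in> Dih n \<Longrightarrow> minv h \<in> Dih n"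
  by (erule DihE) (simp_all add: minv_dil minv_flip root_of_unity_nonzero power_divide)

lemma Dih_comp: "n > 0 \<Longrightarrow> g \<in> Dih n \<Longrightarrow> h \<in> Dih n \<Longrightarrow> g \<circ> h \<in> Dih n"
  by (erule DihE; erule DihE)
    (simp_all add: dil_flip_comp root_of_unity_nonzero power_divide power_mult_distrib)

lemma subgroup_Dih:
  assumes "n > 0"
  shows "subgroup (Dih n) PSL2C"
proof (rule group.subgroupI[OF group_PSL2C Dih_Moeb[OF assms]])
  show "Dih n \<noteq> {}" by (metis Dih_dil_iff empty_iff power_one)
  fix g assume g: "g \<in> Dih n"
  then have "g \<in> Moeb" using Dih_Moeb[OF assms] by blast
  then show "inv\<^bsub>PSL2C\<^esub> g \<in> Dih n" using Dih_minv[OF assms g] by (simp add: m_inv_PSL2C)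
qed (simp add: Dih_comp[OF assms])

lemma card_Dih:
  assumes "n > 0"
  shows "card (Dih n) = 2 * n" "finite (Dih n)"
proof -
  have f: "finite {a::complex. a ^ n = 1}" and c: "card {a::complex. a ^ n = 1} = n"
    using card_roots_unity_eq[of n] finite_roots_unity[of n] assms by auto
  show "finite (Dih n)" unfolding Dih_def using f by simp
  have "card (Dih n) = card (dil ` {a. a ^ n = 1}) + card (flip ` {a. a ^ n = 1})"
    unfolding Dih_def using f dil_neq_flip by (intro card_Un_disjoint) auto
  then show "card (Dih n) = 2 * n"
    using c by (simp add: card_image inj_on_def dil_inj flip_inj)
qed

section \<open>Symmetries of the standard dihedron\<close>

lemma norm_root_of_unity:
  fixes a :: complex
  assumes "n > 0" "a ^ n = 1"
  shows "cmod a = 1"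
proof -
  have "cmod a ^ n = 1" using assms(2) by (metis norm_one norm_power)
  then show ?thesis using assms(1) power_eq_imp_eq_base[of "cmod a" n 1] by simp
qed

lemma std_dihedron_simps [simp]:
  "vertices (std_dihedron n) = {Some z |z. z ^ n = 1}"
  "face_centers (std_dihedron n) = {Some 0, None}"
  "faces (std_dihedron n) = {{Some z |z. cmod z < 1}, insert None {Some z |z. cmod z > 1}}"
  by (simp_all add: std_dihedron_def)

lemma unit_root_cis:
  assumes "n > 0" "z ^ n = (1::complex)"
  obtains j where "j < n" "z = cis (2 * pi * real j / real n)"
  using Complex.bij_betw_roots_unity[OF assms(1)] assms(2)
  unfolding bij_betw_def by auto

lemma cis_power_unit: "n > 0 \<Longrightarrow> cis (2 * pi * real j / real n) ^ n = 1"
  using cis_multiple_2pi[of "real j"] by (simp add: Complex.DeMoivre)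

text \<open>The rotation by half the angle of an edge turns vertices into edge centers.\<close>

lemma edge_centers_std [simp]:
  assumes "n > 0"
  shows "edge_centers (std_dihedron n) = {Some z |z. z ^ n = -1}"
proof -
  have half: "cis (pi / real n) ^ n = -1"
    using assms by (simp add: Complex.DeMoivre)
  have split: "cis (pi * real (2 * j + 1) / real n) = cis (pi / real n) * cis (2 * pi * real j / real n)" for j
    by (simp add: cis_mult add_divide_distrib[symmetric] algebra_simps)
  have "z ^ n = -1 \<longleftrightarrow> (\<exists>j<n. z = cis (pi * real (2 * j + 1) / real n))" for z
  proof
    assume z: "z ^ n = -1"
    then have "(z / cis (pi / real n)) ^ n = 1" using half by (simp add: power_divide)
    then obtain j where j: "j < n" "z / cis (pi / real n) = cis (2 * pi * real j / real n)"
      using assms unit_root_cis by blast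
    have "z = cis (pi / real n) * (z / cis (pi / real n))" by simp
    then show "\<exists>j<n. z = cis (pi * real (2 * j + 1) / real n)"
      using j split by metis
  next
    assume "\<exists>j<n. z = cis (pi * real (2 * j + 1) / real n)"
    then obtain j where "z = cis (pi / real n) * cis (2 * pi * real j / real n)"
      using split by metis
    then show "z ^ n = -1" using half assms by (simp add: power_mult_distrib cis_power_unit)
  qed
  then show ?thesis unfolding std_dihedron_def by auto
qed

text \<open>The edge that starts at \<open>a\<close> in the positive sense.\<close>

definition unit_arc :: "nat \<Rightarrow> complex \<Rightarrow> csphere set" where
  "unit_arc n a = {Some (a * cis t) |t. 0 \<le> t \<and> t \<le> 2 * pi / real n}"

lemma edges_std:
  assumes "n > 0"
  shows "edges (std_dihedron n) = unit_arc n ` {a. a ^ n = 1}"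
proof -
  have arc: "{Some (cis t) |t. 2 * pi * real j / real n \<le> t \<and> t \<le> 2 * pi * real (j + 1) / real n}
      = unit_arc n (cis (2 * pi * real j / real n))" (is "?L = ?R") for j
  proof
    have e: "2 * pi * real (j + 1) / real n = 2 * pi * real j / real n + 2 * pi / real n"
      by (simp add: add_divide_distrib[symmetric] algebra_simps)
    show "?L \<subseteq> ?R"
    proof
      fix x assume "x \<in> ?L"
      then obtain t where t: "x = Some (cis t)" "2 * pi * real j / real n \<le> t" "t \<le> 2 * pi * real (j + 1) / real n" by blast
      show "x \<in> ?R" unfolding unit_arc_def
        by (rule CollectI, rule exI[of _ "t - 2 * pi * real j / real n"])
          (use t e in \<open>simp add: cis_mult\<close>)
    qed
    show "?R \<subseteq> ?L"
    proof
      fix x assume "x \<in> ?R"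
      then obtain t where t: "x = Some (cis (2 * pi * real j / real n) * cis t)" "0 \<le> t" "t \<le> 2 * pi / real n"
        unfolding unit_arc_def by blast
      show "x \<in> ?L"
        by (rule CollectI, rule exI[of _ "t + 2 * pi * real j / real n"])
          (use t e in \<open>simp add: cis_mult algebra_simps\<close>)
    qed
  qed
  have "{a. a ^ n = 1} = (\<lambda>j. cis (2 * pi * real j / real n)) ` {..<n}"
    using Complex.bij_betw_roots_unity[OF assms] unfolding bij_betw_def by auto
  then show ?thesis unfolding std_dihedron_def using arc by auto
qed

lemma map_dihedron_comp: "map_dihedron (S \<circ> T) A = map_dihedron S (map_dihedron T A)"
  by (simp add: map_dihedron_def image_comp[symmetric] image_image)

lemma map_dihedron_id [simp]: "map_dihedron id A = A"
  by (cases A) (simp add: map_dihedron_def)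

lemma map_dihedron_simps [simp]:
  "vertices (map_dihedron T A) = T ` vertices A"
  "edge_centers (map_dihedron T A) = T ` edge_centers A"
  "face_centers (map_dihedron T A) = T ` face_centers A"
  "edges (map_dihedron T A) = (`) T ` edges A"
  "faces (map_dihedron T A) = (`) T ` faces A"
  by (simp_all add: map_dihedron_def)

lemma dil_arc: "dil b ` unit_arc n a = unit_arc n (b * a)"
  unfolding unit_arc_def by (auto simp: image_iff mult.assoc Bex_def) (metis dil_simps(2))

text \<open>A half-turn reverses the sense of the arc, so the image starts at the image of its end point.\<close>

lemma flip_arc:
  assumes "a \<noteq> 0"
  shows "flip b ` unit_arc n a = unit_arc n (b / a * cis (- 2 * pi / real n))"
proof -
  let ?w = "2 * pi / real n"
  have e: "flip b (Some (a * cis t)) = Some (b / a * cis (- 2 * pi / real n) * cis (?w - t))" for t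
  proof -
    have "cis (- 2 * pi / real n) * cis (?w - t) = cis (- t)" by (simp add: cis_mult)
    then have "b / a * cis (- 2 * pi / real n) * cis (?w - t) = b / a * cis (- t)"
      by (simp add: mult.assoc)
    also have "\<dots> = b / (a * cis t)"
    proof -
      have "cis (- t) = inverse (cis t)" by simp
      then show ?thesis by (simp only: divide_inverse inverse_mult_distrib mult.assoc)
    qed
    finally show ?thesis using assms by simp
  qed
  show ?thesis
  proof
    show "flip b ` unit_arc n a \<subseteq> unit_arc n (b / a * cis (- 2 * pi / real n))"
    proof
      fix x assume "x \<in> flip b ` unit_arc n a"
      then obtain t where t: "0 \<le> t" "t \<le> ?w" "x = flip b (Some (a * cis t))" unfolding unit_arc_def by blast
      show "x \<in> unit_arc n (b / a * cis (- 2 * pi / real n))" unfolding unit_arc_def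
        by (rule CollectI, rule exI[of _ "?w - t"]) (use t(1,2) in \<open>simp add: t(3) e del: flip_simps\<close>)
    qed
    show "unit_arc n (b / a * cis (- 2 * pi / real n)) \<subseteq> flip b ` unit_arc n a"
    proof
      fix x assume "x \<in> unit_arc n (b / a * cis (- 2 * pi / real n))"
      then obtain t where t: "0 \<le> t" "t \<le> ?w" "x = Some (b / a * cis (- 2 * pi / real n) * cis t)"
        unfolding unit_arc_def by blast
      have "x = flip b (Some (a * cis (?w - t)))" unfolding e t(3) by simp
      moreover have "Some (a * cis (?w - t)) \<in> unit_arc n a"
        unfolding unit_arc_def using t by auto
      ultimately show "x \<in> flip b ` unit_arc n a" by blast
    qed
  qed
qed

lemma image_eq_preimage: "S \<in> Moeb \<Longrightarrow> S ` X = minv S -` X"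
  by (simp add: Moeb_bij bij_vimage_eq_inv_image[OF Moeb_bij[OF Moeb_inv]] inv_inv_eq)

lemma discs_image:
  assumes "cmod a = 1"
  shows "dil a ` {Some z |z. cmod z < 1} = {Some z |z. cmod z < 1}"
    "dil a ` insert None {Some z |z. cmod z > 1} = insert None {Some z |z. cmod z > 1}"
    "flip a ` {Some z |z. cmod z < 1} = insert None {Some z |z. cmod z > 1}"
    "flip a ` insert None {Some z |z. cmod z > 1} = {Some z |z. cmod z < 1}"
proof -
  let ?D = "{Some z |z. cmod z < 1}"
    and ?O = "insert None {Some z |z. cmod z > 1}"
  have a: "a \<noteq> 0" using assms by auto
  have "dil (1 / a) x \<in> ?D \<longleftrightarrow> x \<in> ?D"
    "dil (1 / a) x \<in> ?O \<longleftrightarrow> x \<in> ?O"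
    "flip a x \<in> ?D \<longleftrightarrow> x \<in> ?O"
    "flip a x \<in> ?O \<longleftrightarrow> x \<in> ?D" for x
    using assms by (cases x; auto simp: norm_divide divide_less_eq_1 less_divide_eq_1)+
  then show "dil a ` ?D = ?D"
    "dil a ` ?O = ?O"
    "flip a ` ?D = ?O"
    "flip a ` ?O = ?D"
    unfolding image_eq_preimage[OF dil_Moeb[OF a]] image_eq_preimage[OF flip_Moeb[OF a]]
      minv_dil[OF a] minv_flip[OF a] vimage_def set_eq_iff mem_Collect_eq by blast+
qed

lemma Dih_maps_parts:
  assumes n: "n > 0" and h: "h \<in> Dih n"
  shows "h ` vertices (std_dihedron n) \<subseteq> vertices (std_dihedron n)"
    "h ` edge_centers (std_dihedron n) \<subseteq> edge_centers (std_dihedron n)"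
    "h ` face_centers (std_dihedron n) \<subseteq> face_centers (std_dihedron n)"
    "(`) h ` edges (std_dihedron n) \<subseteq> edges (std_dihedron n)"
    "(`) h ` faces (std_dihedron n) \<subseteq> faces (std_dihedron n)"
proof -
  have c: "cis (- 2 * pi / real n) ^ n = 1"
    using n cis_multiple_2pi[of "-1"] by (simp add: Complex.DeMoivre)
  show "h ` vertices (std_dihedron n) \<subseteq> vertices (std_dihedron n)"
    using h by (rule DihE) (use n in \<open>auto simp: power_mult_distrib power_divide power_0_left\<close>)
  show "h ` edge_centers (std_dihedron n) \<subseteq> edge_centers (std_dihedron n)"
    using h by (rule DihE) (use n in \<open>auto simp: power_mult_distrib power_divide power_0_left\<close>)
  show "h ` face_centers (std_dihedron n) \<subseteq> face_centers (std_dihedron n)"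
    using h by (rule DihE) auto
  show "(`) h ` edges (std_dihedron n) \<subseteq> edges (std_dihedron n)"
  proof -
    have "h ` unit_arc n a \<in> unit_arc n ` {a. a ^ n = 1}" if a: "a ^ n = 1" for a
      using h
    proof (rule DihE)
      fix b assume b: "b ^ n = 1" "h = dil b"
      then show ?thesis using a by (simp add: dil_arc power_mult_distrib)
    next
      fix b assume b: "b ^ n = 1" "h = flip b"
      have "(b / a * cis (- 2 * pi / real n)) ^ n = 1"
        unfolding power_mult_distrib power_divide using a b c by simp
      then show ?thesis unfolding b(2) flip_arc[OF root_of_unity_nonzero[OF n a]] by blast
    qed
    then show ?thesis unfolding edges_std[OF n] by auto
  qed
  show "(`) h ` faces (std_dihedron n) \<subseteq> faces (std_dihedron n)"
    using h
  proof (rule DihE)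
    fix a assume "a ^ n = 1" "h = dil a"
    then show ?thesis using discs_image[of a] norm_root_of_unity[OF n, of a] by (simp del: image_insert add: image_subset_iff)
  next
    fix a assume "a ^ n = 1" "h = flip a"
    then show ?thesis using discs_image[of a] norm_root_of_unity[OF n, of a] by (simp del: image_insert add: image_subset_iff)
  qed
qed

text \<open>Inclusions suffice, because they also hold for the inverse of \<open>h\<close>.\<close>

lemma Dih_preserves_std:
  assumes n: "n > 0" and h: "h \<in> Dih n"
  shows "map_dihedron h (std_dihedron n) = std_dihedron n"
proof -
  have hM: "h \<in> Moeb" using Dih_Moeb[OF n] h by blast
  have eq: "f ` X = X" if "f ` X \<subseteq> X" "g ` X \<subseteq> X" "f \<circ> g = id" for f g :: "'b \<Rightarrow> 'b" and X
  proof
    show "X \<subseteq> f ` X"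
    proof
      fix x assume "x \<in> X"
      then have "g x \<in> X" "f (g x) = x" using that by (auto dest: fun_cong)
      then show "x \<in> f ` X" by (metis imageI)
    qed
  qed (fact that(1))
  have inv: "h \<circ> minv h = id" "(`) h \<circ> (`) (minv h) = id"
    using hM by (auto simp: fun_eq_iff image_comp)
  note p = Dih_maps_parts[OF n h] and q = Dih_maps_parts[OF n Dih_minv[OF n h]]
  show ?thesis
    using eq[OF p(1) q(1) inv(1)] eq[OF p(2) q(2) inv(1)] eq[OF p(3) q(3) inv(1)]
      eq[OF p(4) q(4) inv(2)] eq[OF p(5) q(5) inv(2)]
    unfolding map_dihedron_def by (metis dihedron.collapse)
qed

text \<open>The face centers make \<open>S\<close> of the form \<open>a z\<close> or \<open>a / z\<close>, and then \<open>a\<close> is the image of the vertex \<open>1\<close>.\<close>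

lemma preserves_std_imp_Dih:
  assumes n: "n > 0" and S: "S \<in> Moeb" and p: "map_dihedron S (std_dihedron n) = std_dihedron n"
  shows "S \<in> Dih n"
proof -
  have f: "S ` {Some 0, None} = {Some 0, None}" and v: "S ` {Some z |z. z ^ n = 1} = {Some z |z. z ^ n = 1}"
    using arg_cong[OF p, of face_centers] arg_cong[OF p, of vertices] by auto
  have "Some 1 \<in> {Some z |z::complex. z ^ n = 1}" by simp
  then have S1: "S (Some 1) \<in> {Some z |z. z ^ n = 1}" using v by blast
  show ?thesis
  proof (rule Moeb_preserves_zero_inf[OF S f])
    fix a assume "a \<noteq> 0" "S = dil a"
    then show ?thesis using S1 by simp
  next
    fix a assume "a \<noteq> 0" "S = flip a"
    then show ?thesis using S1 by simp
  qed
qed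

section \<open>Rotations of the sphere and isotropy groups of dihedra\<close>

unbundle no Formal_Power_Series.fps_syntax

lemma stereo_components:
  "stereo None $ 1 = 0" "stereo None $ 2 = 0" "stereo None $ 3 = 1"
  "stereo (Some z) $ 1 = 2 * Re z / (1 + (cmod z)\<^sup>2)"
  "stereo (Some z) $ 2 = 2 * Im z / (1 + (cmod z)\<^sup>2)"
  "stereo (Some z) $ 3 = ((cmod z)\<^sup>2 - 1) / ((cmod z)\<^sup>2 + 1)"
  by (simp_all add: stereo_def)

text \<open>The third coordinate determines the modulus of the point.\<close>

lemma stereo_inj: "stereo x = stereo y \<Longrightarrow> x = y"
proof -
  assume e: "stereo x = stereo y"
  have third: "stereo (Some z) $ 3 = 1 - 2 / (1 + (cmod z)\<^sup>2)" for z
  proof -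
    have "1 + (cmod z)\<^sup>2 \<noteq> 0" by (metis add_nonneg_pos less_numeral_extra(1) add.commute zero_le_power2 order_less_irrefl)
    then show ?thesis by (simp add: stereo_components field_simps)
  qed
  have pos: "1 + (cmod z)\<^sup>2 > 0" for z by (simp add: add_pos_nonneg)
  have neq: "stereo (Some z) $ 3 \<noteq> 1" for z
    using pos[of z] by (simp add: third)
  show "x = y"
  proof (cases x)
    case None
    then have "stereo y $ 3 = 1" using e stereo_components(3) by metis
    then show ?thesis using None neq by (cases y) auto
  next
    case (Some z)
    then have "y \<noteq> None" using e neq stereo_components(3) by metis
    then obtain w where w: "y = Some w" by auto
    have "2 / (1 + (cmod z)\<^sup>2) = 2 / (1 + (cmod w)\<^sup>2)"
      using e third[of z] third[of w] unfolding Some w by simp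
    then have n: "1 + (cmod z)\<^sup>2 = 1 + (cmod w)\<^sup>2"
      using pos[of z] pos[of w] by (simp add: field_simps)
    have "2 * Re z / (1 + (cmod z)\<^sup>2) = 2 * Re w / (1 + (cmod z)\<^sup>2)"
      "2 * Im z / (1 + (cmod z)\<^sup>2) = 2 * Im w / (1 + (cmod z)\<^sup>2)"
      using e stereo_components(4,5)[of z] stereo_components(4,5)[of w] n unfolding Some w by metis+
    then have "Re z = Re w" "Im z = Im w" using pos[of z] by simp_all
    then show ?thesis unfolding Some w by (simp add: complex_eqI)
  qed
qed

text \<open>For \<open>|a| = 1\<close> these are the rotations preserving the axis through \<open>0\<close> and \<open>\<infinity>\<close>: the matrix with
  \<open>e = 1\<close> fixes both points and corresponds to \<open>a z\<close>, the one with \<open>e = -1\<close> swaps them and corresponds to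
  \<open>a / z\<close>.\<close>

definition axis_matrix :: "complex \<Rightarrow> real \<Rightarrow> real^3^3" where
  "axis_matrix a e = vector [vector [Re a, - e * Im a, 0], vector [Im a, e * Re a, 0], vector [0, 0, e]]"

lemma axis_matrix_mult:
  "(axis_matrix a e *v v) $ 1 = Re a * v $ 1 - e * Im a * v $ 2"
  "(axis_matrix a e *v v) $ 2 = Im a * v $ 1 + e * Re a * v $ 2"
  "(axis_matrix a e *v v) $ 3 = e * v $ 3"
  by (simp_all add: axis_matrix_def matrix_vector_mult_def sum_3)

lemma stereo_dil:
  assumes "cmod a = 1"
  shows "stereo (dil a x) = axis_matrix a 1 *v stereo x"
proof (cases x)
  case None
  then show ?thesis by (simp add: vec_eq_iff forall_3 axis_matrix_mult stereo_components)
next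
  case (Some z)
  have "cmod (a * z) = cmod z" using assms by (simp add: norm_mult)
  then show ?thesis
    by (simp add: Some vec_eq_iff forall_3 axis_matrix_mult stereo_components diff_divide_distrib
        add_divide_distrib algebra_simps)
qed

lemma stereo_flip:
  assumes a: "cmod a = 1"
  shows "stereo (flip a x) = axis_matrix a (-1) *v stereo x"
proof (cases x)
  case None
  then show ?thesis by (simp add: vec_eq_iff forall_3 axis_matrix_mult stereo_components)
next
  case (Some z)
  show ?thesis
  proof (cases "z = 0")
    case True
    then show ?thesis
      by (simp add: Some vec_eq_iff forall_3 axis_matrix_mult stereo_components)
  next
    case False
    define r where "r = (cmod z)\<^sup>2"
    have r: "r > 0" using False by (simp add: r_def)
    have n: "(cmod (a / z))\<^sup>2 = 1 / r" using a by (simp add: norm_divide power_divide r_def)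
    have "a / z = a * cnj z / of_real r"
      using False unfolding r_def complex_norm_square by simp
    then have re: "Re (a / z) = (Re a * Re z + Im a * Im z) / r" "Im (a / z) = (Im a * Re z - Re a * Im z) / r"
      by (simp_all del: of_real_power)
    have d: "1 + 1 / r = (1 + r) / r" "1 / r - 1 = (1 - r) / r" "1 / r + 1 = (1 + r) / r"
      using r by (simp_all add: field_simps)
    have c: "2 * (p / r) / ((1 + r) / r) = 2 * p / (1 + r)" "(p / r) / ((1 + r) / r) = p / (1 + r)" for p
      using r by simp_all
    have g1: "2 * (A * x + B * y) / (1 + r) = A * (2 * x / (1 + r)) - (- 1) * B * (2 * y / (1 + r))"
      and g2: "2 * (B * x - A * y) / (1 + r) = B * (2 * x / (1 + r)) + (- 1) * A * (2 * y / (1 + r))"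
      for A B x y :: real
      by (simp_all add: add_divide_distrib diff_divide_distrib distrib_left right_diff_distrib mult.left_commute)
    have "1 - r = - 1 * (r - 1)" by simp
    then have g3: "(1 - r) / (1 + r) = - 1 * ((r - 1) / (r + 1))"
      by (metis add.commute times_divide_eq_right)
    show ?thesis
      unfolding Some flip_simps vec_eq_iff forall_3 axis_matrix_mult stereo_components
        r_def[symmetric] if_not_P[OF False] n re d c
      using g1 g2 g3 by blast
  qed
qed

lemma axis_matrix_rotation:
  assumes a: "cmod a = 1" and e: "e\<^sup>2 = 1"
  shows "rotation_matrix (axis_matrix a e)"
proof -
  have n: "Re a * Re a + Im a * Im a = 1" using a cmod_power2[of a] by (simp add: power2_eq_square)
  then have n': "Im a * Im a + Re a * Re a = 1" by simp
  have e1: "e * e = 1" using e by (simp add: power2_eq_square)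
  have e2: "e * (e * x) = x" for x using e1 by (simp add: mult.assoc[symmetric])
  have "orthogonal_matrix (axis_matrix a e)"
    unfolding orthogonal_matrix
    by (simp add: vec_eq_iff forall_3 matrix_matrix_mult_def transpose_def axis_matrix_def sum_3 mat_def
        e1 e2 n n' algebra_simps)
  moreover have "det (axis_matrix a e) = e * e * (Re a * Re a + Im a * Im a)"
    by (simp add: det_3 axis_matrix_def algebra_simps)
  ultimately show ?thesis by (simp add: rotation_matrix_def e1 n)
qed

text \<open>The third row has norm 1, so it vanishes outside the diagonal; orthogonality to the first column
  and the sign of the determinant leave one choice for the second column.\<close>

lemma rotation_fixing_axis:
  fixes M :: "real^3^3"
  assumes M: "rotation_matrix M"
    and col3: "M $ 1 $ 3 = 0" "M $ 2 $ 3 = 0" "M $ 3 $ 3 = e" "e\<^sup>2 = 1"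
    and col1: "M $ 1 $ 1 = Re a" "M $ 2 $ 1 = Im a"
  shows "cmod a = 1" "M = axis_matrix a e"
proof -
  have o: "transpose M ** M = mat 1" "M ** transpose M = mat 1" and d: "det M = 1"
    using M by (auto simp: rotation_matrix_def orthogonal_matrix_def)
  have row: "M $ 3 $ 1 * M $ 3 $ 1 + M $ 3 $ 2 * M $ 3 $ 2 + M $ 3 $ 3 * M $ 3 $ 3 = 1"
    using arg_cong[OF o(2), of "\<lambda>X. X $ 3 $ 3"]
    by (simp add: matrix_matrix_mult_def transpose_def sum_3 mat_def)
  have "(M $ 3 $ 1)\<^sup>2 + (M $ 3 $ 2)\<^sup>2 = 0"
    using row col3 by (simp add: power2_eq_square)
  then have z: "M $ 3 $ 1 = 0" "M $ 3 $ 2 = 0" by (simp_all add: sum_power2_eq_zero_iff)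
  have n: "Re a * Re a + Im a * Im a = 1"
    using arg_cong[OF o(1), of "\<lambda>X. X $ 1 $ 1"] z col1
    by (simp add: matrix_matrix_mult_def transpose_def sum_3 mat_def)
  then show "cmod a = 1" by (simp add: cmod_def power2_eq_square)
  have p: "Re a * M $ 1 $ 2 + Im a * M $ 2 $ 2 = 0"
    using arg_cong[OF o(1), of "\<lambda>X. X $ 1 $ 2"] z col1
    by (simp add: matrix_matrix_mult_def transpose_def sum_3 mat_def)
  have q: "e * (Re a * M $ 2 $ 2 - Im a * M $ 1 $ 2) = 1"
    using d z col1 col3 by (simp add: det_3 algebra_simps)
  define y where "y = Re a * M $ 2 $ 2 - Im a * M $ 1 $ 2"
  have "y = (e * e) * y" using col3(4) by (simp add: power2_eq_square)
  also have "\<dots> = e * (e * y)" by (simp only: mult.assoc)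
  also have "\<dots> = e" using q by (simp add: y_def)
  finally have q': "Re a * M $ 2 $ 2 - Im a * M $ 1 $ 2 = e" by (simp add: y_def)
  have "M $ 2 $ 2 = (Re a * Re a + Im a * Im a) * M $ 2 $ 2" using n by simp
  also have "\<dots> = Re a * (Re a * M $ 2 $ 2 - Im a * M $ 1 $ 2)
      + Im a * (Re a * M $ 1 $ 2 + Im a * M $ 2 $ 2)"
    by (simp add: algebra_simps)
  finally have m22: "M $ 2 $ 2 = e * Re a" unfolding p q' by simp
  have "M $ 1 $ 2 = (Re a * Re a + Im a * Im a) * M $ 1 $ 2" using n by simp
  also have "\<dots> = - Im a * (Re a * M $ 2 $ 2 - Im a * M $ 1 $ 2)
      + Re a * (Re a * M $ 1 $ 2 + Im a * M $ 2 $ 2)"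
    by (simp add: algebra_simps)
  finally have m12: "M $ 1 $ 2 = - e * Im a" unfolding p q' by simp
  show "M = axis_matrix a e"
    using z col1 col3 m22 m12 by (simp add: vec_eq_iff forall_3 axis_matrix_def)
qed

text \<open>Here \<open>R\<close> is any map of the sphere induced by a rotation matrix, so it has to be recognised as a
  Moebius map. The face centers give the third column of the matrix, the image of the vertex \<open>1\<close> gives
  the first one.\<close>

lemma sphere_rotation_preserves_std_iff:
  assumes n: "n > 0"
  shows "sphere_rotation R \<and> map_dihedron R (std_dihedron n) = std_dihedron n \<longleftrightarrow> R \<in> Dih n"
proof
  assume R: "R \<in> Dih n"
  from R have "sphere_rotation R"
  proof (rule DihE)
    fix a assume "a ^ n = 1" "R = dil a"
    then show ?thesis
      unfolding sphere_rotation_def using n norm_root_of_unity stereo_dil axis_matrix_rotation[of a 1] by auto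
  next
    fix a assume "a ^ n = 1" "R = flip a"
    then show ?thesis
      unfolding sphere_rotation_def using n norm_root_of_unity stereo_flip axis_matrix_rotation[of a "-1"] by auto
  qed
  then show "sphere_rotation R \<and> map_dihedron R (std_dihedron n) = std_dihedron n"
    using Dih_preserves_std[OF n R] by simp
next
  assume "sphere_rotation R \<and> map_dihedron R (std_dihedron n) = std_dihedron n"
  then obtain M where M: "rotation_matrix M" "\<And>x. stereo (R x) = M *v stereo x"
    and p: "map_dihedron R (std_dihedron n) = std_dihedron n" by (auto simp: sphere_rotation_def)
  have f: "R ` {Some 0, None} = {Some 0, None}" and v: "R ` {Some z |z. z ^ n = 1} = {Some z |z. z ^ n = 1}"
    using arg_cong[OF p, of face_centers] arg_cong[OF p, of vertices] by auto
  have "Some 1 \<in> {Some z |z::complex. z ^ n = 1}" by simp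
  then have "R (Some 1) \<in> {Some z |z. z ^ n = 1}" using v by blast
  then obtain a where a: "a ^ n = 1" "R (Some 1) = Some a" by auto
  have na: "cmod a = 1" using norm_root_of_unity[OF n a(1)] .
  have "R None \<in> {Some 0, None}" using f by blast
  then have "(stereo (R None) $ 3)\<^sup>2 = 1 \<and> stereo (R None) $ 1 = 0 \<and> stereo (R None) $ 2 = 0"
    by (auto simp: stereo_components)
  then obtain e where e: "e\<^sup>2 = 1" "stereo (R None) $ 1 = 0" "stereo (R None) $ 2 = 0" "stereo (R None) $ 3 = e"
    by blast
  have col3: "M $ i $ 3 = stereo (R None) $ i" for i
    unfolding M(2) by (simp add: matrix_vector_mult_def sum_3 stereo_components)
  have col1: "M $ i $ 1 = stereo (R (Some 1)) $ i" for i
    unfolding M(2) by (simp add: matrix_vector_mult_def sum_3 stereo_components)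
  have "M = axis_matrix a e"
    by (rule rotation_fixing_axis(2)[OF M(1)]) (simp_all add: col3 col1 e a stereo_components na)
  moreover have "e = 1 \<or> e = -1" using e(1) by (simp add: power2_eq_1_iff)
  ultimately consider "\<And>x. stereo (R x) = stereo (dil a x)" | "\<And>x. stereo (R x) = stereo (flip a x)"
    using M(2) stereo_dil[OF na] stereo_flip[OF na] by auto
  then have "R = dil a \<or> R = flip a" by cases (auto intro: stereo_inj)
  then show "R \<in> Dih n" using a(1) by auto
qed

text \<open>Two presentations of the same dihedron differ by a symmetry of the standard one, which lies in
  \<open>Dih n\<close> and does not change the conjugate of \<open>Dih n\<close>.\<close>

lemma dihedron_isotropy_conj:
  assumes n: "n > 0" and T: "T \<in> Moeb"
  shows "dihedron_isotropy n (map_dihedron T (std_dihedron n)) = conj_by T (Dih n)"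
proof
  show "conj_by T (Dih n) \<subseteq> dihedron_isotropy n (map_dihedron T (std_dihedron n))"
    unfolding conj_by_def dihedron_isotropy_def
    using T sphere_rotation_preserves_std_iff[OF n] by blast
  show "dihedron_isotropy n (map_dihedron T (std_dihedron n)) \<subseteq> conj_by T (Dih n)"
  proof
    fix g assume "g \<in> dihedron_isotropy n (map_dihedron T (std_dihedron n))"
    then obtain T' R where T': "T' \<in> Moeb" "map_dihedron T (std_dihedron n) = map_dihedron T' (std_dihedron n)"
      and R: "R \<in> Dih n" and g: "g = T' \<circ> R \<circ> minv T'"
      unfolding dihedron_isotropy_def using sphere_rotation_preserves_std_iff[OF n] by blast
    define S where "S = minv T \<circ> T'"
    have S: "S \<in> Moeb" unfolding S_def using T T' by (simp add: Moeb_comp Moeb_inv)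
    have "map_dihedron S (std_dihedron n) = std_dihedron n"
      unfolding S_def map_dihedron_comp T'(2)[symmetric]
      using T by (simp flip: map_dihedron_comp)
    then have SD: "S \<in> Dih n" using preserves_std_imp_Dih[OF n S] by blast
    have "T' = T \<circ> S" unfolding S_def using T by (simp add: comp_assoc[symmetric])
    moreover have "minv (T \<circ> S) = minv S \<circ> minv T"
      using T S by (intro o_inv_distrib Moeb_bij)
    ultimately have "g = T \<circ> (S \<circ> R \<circ> minv S) \<circ> minv T" unfolding g by (simp add: comp_assoc)
    moreover have "S \<circ> R \<circ> minv S \<in> Dih n" using SD R n by (intro Dih_comp Dih_minv)
    ultimately show "g \<in> conj_by T (Dih n)" unfolding conj_by_def by blast
  qed
qed

section \<open>Dihedral groups of Moebius maps\<close>

text \<open>Over \<open>\<complex>\<close> the equation \<open>c z\<^sup>2 + (d - a) z - b = 0\<close> for finite fixed points is solvable if \<open>c \<noteq> 0\<close>.\<close>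

lemma Moeb_fixed_point:
  assumes "S \<in> Moeb"
  obtains x where "S x = x"
proof -
  obtain a b c d where S: "S = moebius a b c d" "a * d - b * c = 1" using assms by (rule MoebE)
  show ?thesis
  proof (cases "c = 0")
    case True
    then show ?thesis using that[of None] by (simp add: S(1) moebius_def)
  next
    case False
    define w where "w = csqrt ((d - a)\<^sup>2 + 4 * b * c)"
    have w: "w * w = (d - a) * (d - a) + 4 * b * c"
      using power2_csqrt[of "(d - a)\<^sup>2 + 4 * b * c"] unfolding w_def by (simp add: power2_eq_square)
    define z where "z = (a - d + w) / (2 * c)"
    have "2 * c * z = a - d + w" using False by (simp add: z_def)
    then have ww: "w = 2 * c * z - a + d" by simp
    have "4 * c * (c * z * z + (d - a) * z - b) = 0"
      using w unfolding ww by (simp add: algebra_simps)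
    then have "c * z * z + (d - a) * z - b = 0" using False by (simp only: mult_eq_0_iff) simp
    then have e: "a * z + b = z * (c * z + d)" by (simp add: algebra_simps)
    have ne: "c * z + d \<noteq> 0"
    proof
      assume 0: "c * z + d = 0"
      then have "a * z + b = 0" using e by simp
      moreover have "a * d - b * c = a * (c * z + d) - c * (a * z + b)" by (simp add: algebra_simps)
      ultimately show False using S(2) 0 by simp
    qed
    have "S (Some z) = Some z" unfolding S(1) moebius_def using ne e by simp
    then show ?thesis by (rule that)
  qed
qed

lemma Moeb_sends_infinity_to:
  obtains T where "T \<in> Moeb" "T None = x"
proof (cases x)
  case None
  then show ?thesis using that[OF Moeb_id] by simp
next
  case (Some p)
  show ?thesis
    using that[of "moebius p (-1) 1 0"] moebius_in_Moeb[of p 0 "-1" 1]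
    by (simp add: Some moebius_def)
qed

lemma Moeb_fixing_infinity:
  assumes "S \<in> Moeb" "S None = None"
  obtains a b where "a \<noteq> 0" "S = moebius a b 0 1"
proof -
  obtain a b c d where S: "S = moebius a b c d" "a * d - b * c = 1" using assms(1) by (rule MoebE)
  have c: "c = 0" using assms(2) by (simp add: S(1) moebius_def split: if_splits)
  then have d: "d \<noteq> 0" "a \<noteq> 0" using S(2) by auto
  have "S = moebius (a / d) (b / d) 0 1"
    unfolding S(1) c using moebius_scale[OF d(1), of "a / d" "b / d" 0 1] d by simp
  then show ?thesis using that[of "a / d" "b / d"] d by simp
qed

lemma funpow_conj:
  assumes "g \<circ> T = T \<circ> h"
  shows "(g ^^ k) \<circ> T = T \<circ> (h ^^ k)"
proof -
  have "(g ^^ k) (T x) = T ((h ^^ k) x)" for x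
    using fun_cong[OF assms] by (induction k) auto
  then show ?thesis by auto
qed

lemma dil_funpow: "a \<noteq> 0 \<Longrightarrow> dil a ^^ k = dil (a ^ k)"
  by (induction k) (simp_all add: dil_1 dil_flip_comp)

lemma translation_funpow: "moebius 1 b 0 1 ^^ k = moebius 1 (of_nat k * b) 0 1"
  by (induction k) (simp_all add: moebius_id moebius_comp algebra_simps)

text \<open>A translation has infinite order, so an element of finite order fixing \<open>\<infinity>\<close> is a dilation about
  its other fixed point.\<close>

lemma finite_order_diagonalizable:
  assumes r: "r \<in> Moeb" "r \<noteq> id" "r ^^ n = id" "n > 0"
  obtains T a where "T \<in> Moeb" "a \<noteq> 0" "r \<circ> T = T \<circ> dil a"
proof -
  obtain p where p: "r p = p" using Moeb_fixed_point[OF r(1)] .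
  obtain S where S: "S \<in> Moeb" "S None = p" using Moeb_sends_infinity_to .
  define r' where "r' = minv S \<circ> r \<circ> S"
  have r'M: "r' \<in> Moeb" unfolding r'_def using S r by (simp add: Moeb_comp Moeb_inv)
  have rS: "r \<circ> S = S \<circ> r'"
    unfolding r'_def using S(1) by (simp add: comp_assoc[symmetric])
  have "S (r' None) = S None" using fun_cong[OF rS, of None] S(2) p by simp
  then have "r' None = None" using bij_is_inj[OF Moeb_bij[OF S(1)]] by (simp add: inj_eq)
  then obtain a b where a: "a \<noteq> 0" "r' = moebius a b 0 1" using Moeb_fixing_infinity[OF r'M] by blast
  have "a \<noteq> 1"
  proof
    assume "a = 1"
    then have r': "r' = moebius 1 b 0 1" using a(2) by simp
    have "S \<circ> (r' ^^ n) = S" using funpow_conj[OF rS, of n] r(3) by simp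
    from fun_cong[OF this, of "Some 0"] have "S ((r' ^^ n) (Some 0)) = S (Some 0)" by simp
    then have "(r' ^^ n) (Some 0) = Some 0"
      using bij_is_inj[OF Moeb_bij[OF S(1)]] by (simp add: inj_eq)
    then have "of_nat n * b = 0" unfolding r' translation_funpow by (simp add: moebius_def)
    then have "r' = id" using r(4) r' by (simp add: moebius_id)
    then have "r \<circ> S = S" using rS by simp
    then have "r \<circ> (S \<circ> minv S) = S \<circ> minv S" by (simp add: comp_assoc[symmetric])
    then show False using r(2) S(1) by simp
  qed
  define q where "q = b / (1 - a)"
  have "q * (1 - a) = b" using \<open>a \<noteq> 1\<close> unfolding q_def by simp
  then have q: "a * q + b = q" by (auto simp: algebra_simps)
  define U where "U = moebius 1 q 0 1"
  have UM: "U \<in> Moeb" unfolding U_def by (rule moebius_in_Moeb) simp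
  have rU: "r' \<circ> U = U \<circ> dil a"
    using a(1) q by (simp add: U_def a(2) dil_def moebius_comp)
  have "r \<circ> (S \<circ> U) = (S \<circ> r') \<circ> U" unfolding rS[symmetric] by (rule comp_assoc[symmetric])
  also have "\<dots> = (S \<circ> U) \<circ> dil a" by (simp only: comp_assoc rU)
  finally have "r \<circ> (S \<circ> U) = (S \<circ> U) \<circ> dil a" .
  then show ?thesis using that[of "S \<circ> U" a] a(1) S(1) UM Moeb_comp by blast
qed

text \<open>Only relations between the images of the generators are extracted from the isomorphism: they
  can be evaluated on the sphere.\<close>

lemma dihedral_group_presentation:
  assumes n: "n \<ge> 3" and G: "subgroup G PSL2C" and iso: "PSL2C\<lparr>carrier := G\<rparr> \<cong> dihedral_group n"
  obtains r s where "r \<in> G" "s \<in> G" "r ^^ n = id" "\<And>k. 0 < k \<Longrightarrow> k < n \<Longrightarrow> r ^^ k \<noteq> id"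
    "s \<circ> s = id" "r \<circ> s \<circ> r = s"
    "G = (\<lambda>k. r ^^ k) ` {..<n} \<union> (\<lambda>k. (r ^^ k) \<circ> s) ` {..<n}"
proof -
  let ?G = "PSL2C\<lparr>carrier := G\<rparr>" and ?D = "dihedral_group n"
  have gG: "group ?G" using subgroup.subgroup_is_group[OF G group_PSL2C] .
  obtain \<phi> where "\<phi> \<in> iso ?G ?D" using iso by (auto simp: is_iso_def)
  then have "inv_into (carrier ?G) \<phi> \<in> iso ?D ?G" by (rule group.iso_set_sym[OF gG])
  then obtain \<psi> where \<psi>: "\<psi> \<in> iso ?D ?G" by blast
  have bij: "bij_betw \<psi> ({0..<int n} \<times> UNIV) G"
    using \<psi> by (simp add: iso_def dihedral_group_def)
  have hom: "\<psi> ((if s then i - j else i + j) mod int n, s \<noteq> t) = \<psi> (i, s) \<circ> \<psi> (j, t)"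
    if "0 \<le> i" "i < int n" "0 \<le> j" "j < int n" for i j s t
    using \<psi> that unfolding iso_def hom_def by (auto simp: dihedral_group_def)
  have inG: "\<psi> (i, s) \<in> G" if "0 \<le> i" "i < int n" for i s
    using bij_betw_apply[OF bij, of "(i, s)"] that by simp
  have inj: "i = j \<and> s = t" if "\<psi> (i, s) = \<psi> (j, t)" "0 \<le> i" "i < int n" "0 \<le> j" "j < int n" for i j s t
    using inj_onD[OF bij_betw_imp_inj_on[OF bij] that(1)] that by simp
  have e: "\<psi> (0, False) = id"
  proof -
    have M: "\<psi> (0, False) \<in> Moeb" using inG[of 0 False] n subgroup.subset[OF G] by auto
    have "\<psi> (0, False) \<circ> \<psi> (0, False) = \<psi> (0, False)" using hom[of 0 0 False False] n by simp
    then have "(minv (\<psi> (0, False)) \<circ> \<psi> (0, False)) \<circ> \<psi> (0, False) = minv (\<psi> (0, False)) \<circ> \<psi> (0, False)"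
      by (simp only: comp_assoc)
    then show ?thesis using M by simp
  qed
  define r where "r = \<psi> (1, False)"
  define s where "s = \<psi> (0, True)"
  have pow: "r ^^ k = \<psi> (int k mod int n, False)" for k
  proof (induction k)
    case (Suc k)
    have "r ^^ Suc k = r \<circ> \<psi> (int k mod int n, False)" by (simp add: Suc)
    also have "\<dots> = \<psi> ((1 + int k mod int n) mod int n, False)"
      unfolding r_def using hom[of 1 "int k mod int n" False False] n by simp
    also have "(1 + int k mod int n) mod int n = int (Suc k) mod int n" by (simp add: mod_add_right_eq)
    finally show ?case .
  qed (simp add: e)
  have pows: "(r ^^ k) \<circ> s = \<psi> (int k, True)" if "k < n" for k
    using hom[of "int k" 0 False True] that n by (simp add: pow s_def)
  have "r \<in> G" "s \<in> G" unfolding r_def s_def using inG n by auto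
  moreover have "r ^^ n = id" by (simp add: pow e)
  moreover have "r ^^ k \<noteq> id" if "0 < k" "k < n" for k
  proof
    assume "r ^^ k = id"
    then have "\<psi> (int k, False) = \<psi> (0, False)" using that by (simp add: pow e)
    then show False using inj[of "int k" False 0 False] that by simp
  qed
  moreover have "s \<circ> s = id" using hom[of 0 0 True True] n by (simp add: s_def e)
  moreover have "r \<circ> s \<circ> r = s"
  proof -
    have "r \<circ> s = \<psi> (1, True)" using pows[of 1] n by simp
    then show ?thesis using hom[of 1 1 True False] n by (simp add: r_def s_def)
  qed
  moreover have "G = (\<lambda>k. r ^^ k) ` {..<n} \<union> (\<lambda>k. (r ^^ k) \<circ> s) ` {..<n}"
  proof
    show "(\<lambda>k. r ^^ k) ` {..<n} \<union> (\<lambda>k. (r ^^ k) \<circ> s) ` {..<n} \<subseteq> G"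
      using inG pows pow n by auto
    show "G \<subseteq> (\<lambda>k. r ^^ k) ` {..<n} \<union> (\<lambda>k. (r ^^ k) \<circ> s) ` {..<n}"
    proof
      fix g assume "g \<in> G"
      then have "g \<in> \<psi> ` ({0..<int n} \<times> UNIV)" using bij_betw_imp_surj_on[OF bij] by blast
      then obtain i t where it: "0 \<le> i" "i < int n" "g = \<psi> (i, t)" by auto
      define k where "k = nat i"
      have k: "k < n" "i = int k" using it unfolding k_def by auto
      show "g \<in> (\<lambda>k. r ^^ k) ` {..<n} \<union> (\<lambda>k. (r ^^ k) \<circ> s) ` {..<n}"
      proof (cases t)
        case True
        then have "g = (r ^^ k) \<circ> s" using it k pows by simp
        then show ?thesis using k(1) by blast
      next
        case False
        then have "g = r ^^ k" using it k pow by simp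
        then show ?thesis using k(1) by blast
      qed
    qed
  qed
  ultimately show ?thesis by (rule that)
qed

text \<open>Let \<open>r\<close> generate the rotations and let \<open>s\<close> be a reflection of the abstract group. After a
  conjugation \<open>r\<close> is a dilation \<open>a z\<close> with \<open>a\<close> a primitive root of unity. By \<open>r s r = s\<close> the map \<open>s\<close>
  preserves \<open>{0, \<infinity>}\<close>; it cannot fix both points, since it would then commute with \<open>r\<close> and force
  \<open>a\<^sup>2 = 1\<close>. Hence \<open>s\<close> is \<open>b / z\<close>, and conjugating by the dilation \<open>\<surd>b z\<close> turns it into \<open>1 / z\<close>.\<close>

lemma dihedral_conj_Dih:
  assumes n: "n \<ge> 3" and G: "subgroup G PSL2C" and iso: "PSL2C\<lparr>carrier := G\<rparr> \<cong> dihedral_group n"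
  obtains T where "T \<in> Moeb" "G = conj_by T (Dih n)"
proof -
  obtain r s where rs: "r \<in> G" "s \<in> G" "r ^^ n = id" "\<And>k. 0 < k \<Longrightarrow> k < n \<Longrightarrow> r ^^ k \<noteq> id"
    "s \<circ> s = id" "r \<circ> s \<circ> r = s"
    and Geq: "G = (\<lambda>k. r ^^ k) ` {..<n} \<union> (\<lambda>k. (r ^^ k) \<circ> s) ` {..<n}"
    using dihedral_group_presentation[OF n G iso] by blast
  have rM: "r \<in> Moeb" "s \<in> Moeb" using rs G subgroup.subset by blast+
  have "r \<noteq> id" using rs(4)[of 1] n by simp
  then obtain T a where T: "T \<in> Moeb" "a \<noteq> 0" "r \<circ> T = T \<circ> dil a"
    using finite_order_diagonalizable[OF rM(1) _ rs(3)] n by auto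
  have cancel: "g = h" if "T \<circ> g = T \<circ> h" for g h :: "csphere \<Rightarrow> csphere"
  proof -
    have "minv T \<circ> T \<circ> g = minv T \<circ> T \<circ> h" using that by (simp only: comp_assoc)
    then show ?thesis using T(1) by simp
  qed
  have powT: "(r ^^ k) \<circ> T = T \<circ> dil (a ^ k)" for k
    using funpow_conj[OF T(3)] T(2) by (simp add: dil_funpow)
  have "T \<circ> dil (a ^ n) = T \<circ> dil 1" using powT[of n] rs(3) by (simp add: dil_1)
  then have an: "a ^ n = 1" using cancel dil_inj by blast
  have ak: "a ^ k \<noteq> 1" if "0 < k" "k < n" for k
  proof
    assume "a ^ k = 1"
    then have "(r ^^ k) \<circ> T = T" using powT[of k] by (simp add: dil_1)
    then have "(r ^^ k) \<circ> (T \<circ> minv T) = T \<circ> minv T" by (simp only: comp_assoc[symmetric])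
    then show False using T(1) rs(4)[OF that] by simp
  qed
  have a1: "a \<noteq> 1" and a2: "a * a \<noteq> 1"
    using ak[of 1] ak[of 2] n by (auto simp: power2_eq_square)
  define s' where "s' = minv T \<circ> s \<circ> T"
  have s'M: "s' \<in> Moeb" unfolding s'_def using T rM by (simp add: Moeb_comp Moeb_inv)
  have sT: "s \<circ> T = T \<circ> s'"
    unfolding s'_def using T(1) by (simp add: comp_assoc[symmetric])
  have "T \<circ> (dil a \<circ> s' \<circ> dil a) = (r \<circ> s \<circ> r) \<circ> T"
  proof -
    have "T \<circ> (dil a \<circ> s' \<circ> dil a) = (r \<circ> T) \<circ> s' \<circ> dil a" by (simp only: T(3) comp_assoc)
    also have "\<dots> = r \<circ> (s \<circ> T) \<circ> dil a" by (simp only: sT comp_assoc)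
    also have "\<dots> = (r \<circ> s \<circ> r) \<circ> T" by (simp only: T(3) comp_assoc)
    finally show ?thesis .
  qed
  then have "T \<circ> (dil a \<circ> s' \<circ> dil a) = T \<circ> s'" using rs(6) sT by simp
  then have asa: "dil a \<circ> s' \<circ> dil a = s'" by (rule cancel)
  \<comment> \<open>so \<open>s'\<close> maps the fixed points of the dilation to fixed points\<close>
  have fixd: "x \<in> {Some 0, None}" if "dil a x = x" for x
    using that a1 by (cases x) auto
  have "s' (Some 0) \<in> {Some 0, None}" "s' None \<in> {Some 0, None}"
    using fixd fun_cong[OF asa, of "Some 0"] fun_cong[OF asa, of None] by auto
  moreover have "s' (Some 0) \<noteq> s' None"
    using bij_is_inj[OF Moeb_bij[OF s'M]] by (metis injD option.distinct(1))
  ultimately have im: "s' ` {Some 0, None} = {Some 0, None}" by auto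
  obtain b where b: "b \<noteq> 0" "s' = flip b"
  proof (rule Moeb_preserves_zero_inf[OF s'M im])
    fix b assume b: "b \<noteq> 0" "s' = dil b"
    then have "a * b * a = b" using asa T(2) by (simp add: dil_flip_comp dil_inj)
    then have "b * (a * a) = b * 1" by (simp add: mult_ac)
    then have "b = 0 \<or> a * a = 1" by (simp only: mult_cancel_left)
    then show thesis using b(1) a2 by blast
  qed (rule that)
  define w where "w = csqrt b"
  have w: "w * w = b" "w \<noteq> 0"
    using b(1) power2_csqrt[of b] unfolding w_def by (auto simp: power2_eq_square)
  define U where "U = T \<circ> dil w"
  have UM: "U \<in> Moeb" unfolding U_def using T w by (simp add: Moeb_comp dil_Moeb)
  have rU: "(r ^^ k) \<circ> U = U \<circ> dil (a ^ k)" for k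
  proof -
    have "(r ^^ k) \<circ> U = T \<circ> (dil (a ^ k) \<circ> dil w)" unfolding U_def by (simp only: comp_assoc[symmetric] powT)
    also have "dil (a ^ k) \<circ> dil w = dil w \<circ> dil (a ^ k)" using T(2) w(2) by (simp add: dil_flip_comp mult.commute)
    finally show ?thesis unfolding U_def by (simp only: comp_assoc)
  qed
  have sU: "s \<circ> U = U \<circ> flip 1"
  proof -
    have "b / w = w" using w(2) unfolding w(1)[symmetric] by simp
    then have "flip b \<circ> dil w = dil w \<circ> flip 1" using w(2) by (simp add: dil_flip_comp)
    then have "T \<circ> (s' \<circ> dil w) = T \<circ> (dil w \<circ> flip 1)" unfolding b(2) by simp
    moreover have "s \<circ> (T \<circ> dil w) = T \<circ> (s' \<circ> dil w)" by (simp only: comp_assoc[symmetric] sT)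
    ultimately show ?thesis unfolding U_def by (simp only: comp_assoc)
  qed
  have conjU: "g = U \<circ> h \<circ> minv U" if "g \<circ> U = U \<circ> h" for g h
  proof -
    have "g \<circ> (U \<circ> minv U) = U \<circ> h \<circ> minv U" using that by (simp only: comp_assoc[symmetric])
    then show ?thesis using UM by simp
  qed
  have rk: "r ^^ k = U \<circ> dil (a ^ k) \<circ> minv U" for k using rU by (rule conjU)
  have rks: "(r ^^ k) \<circ> s = U \<circ> flip (a ^ k) \<circ> minv U" for k
  proof (rule conjU)
    have "(r ^^ k) \<circ> s \<circ> U = (r ^^ k) \<circ> U \<circ> flip 1" using sU by (simp only: comp_assoc)
    also have "\<dots> = U \<circ> (dil (a ^ k) \<circ> flip 1)" by (simp only: rU comp_assoc)
    finally show "(r ^^ k) \<circ> s \<circ> U = U \<circ> flip (a ^ k)" by (simp add: dil_flip_comp)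
  qed
  have inj: "inj_on (\<lambda>k. a ^ k) {..<n}"
  proof -
    have "i = j" if "i \<le> j" "j < n" "a ^ i = a ^ j" for i j
    proof (rule ccontr)
      assume "i \<noteq> j"
      then have "0 < j - i" "j - i < n" using that by auto
      moreover have "a ^ i * a ^ (j - i) = a ^ (i + (j - i))" by (simp only: power_add)
      then have "a ^ i * a ^ (j - i) = a ^ i * 1" using that by simp
      then have "a ^ i = 0 \<or> a ^ (j - i) = 1" by (simp only: mult_cancel_left)
      then have "a ^ (j - i) = 1" using T(2) by simp
      ultimately show False using ak by blast
    qed
    then show ?thesis by (intro inj_onI) (metis lessThan_iff nat_le_linear)
  qed
  have roots: "(\<lambda>k. a ^ k) ` {..<n} = {z. z ^ n = 1}"
  proof (rule card_subset_eq)
    show "finite {z::complex. z ^ n = 1}" using finite_roots_unity[of n] n by simp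
    show "(\<lambda>k. a ^ k) ` {..<n} \<subseteq> {z. z ^ n = 1}"
    proof
      fix z assume "z \<in> (\<lambda>k. a ^ k) ` {..<n}"
      then obtain k where "z = a ^ k" by blast
      then have "z ^ n = (a ^ n) ^ k" by (simp only: power_mult[symmetric] mult.commute)
      then show "z \<in> {z. z ^ n = 1}" using an by simp
    qed
    show "card ((\<lambda>k. a ^ k) ` {..<n}) = card {z::complex. z ^ n = 1}"
      using inj card_roots_unity_eq[of n] n by (simp add: card_image)
  qed
  have "conj_by U (Dih n) = (\<lambda>h. U \<circ> h \<circ> minv U) ` Dih n" unfolding conj_by_def by blast
  also have "\<dots> = (\<lambda>k. U \<circ> dil (a ^ k) \<circ> minv U) ` {..<n} \<union> (\<lambda>k. U \<circ> flip (a ^ k) \<circ> minv U) ` {..<n}"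
    unfolding Dih_def roots[symmetric] image_Un image_image ..
  also have "\<dots> = G" unfolding Geq rks[symmetric] unfolding rk[symmetric] ..
  finally have "G = conj_by U (Dih n)" ..
  then show ?thesis using that UM by blast
qed

section \<open>Pullback of rational forms\<close>

abbreviation fnum :: "rational_form \<Rightarrow> complex poly" where "fnum f \<equiv> fst (quot_of_fract f)"
abbreviation fden :: "rational_form \<Rightarrow> complex poly" where "fden f \<equiv> snd (quot_of_fract f)"

text \<open>Identities between rational functions are checked outside a finite set, which hides poles and
  points sent to infinity.\<close>

definition almost_all_eq :: "(complex \<Rightarrow> complex) \<Rightarrow> (complex \<Rightarrow> complex) \<Rightarrow> bool" (infix "\<doteq>" 50) where
  "f \<doteq> g \<longleftrightarrow> finite {z. f z \<noteq> g z}"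

lemma almost_all_eqI: "finite B \<Longrightarrow> (\<And>z. z \<notin> B \<Longrightarrow> f z = g z) \<Longrightarrow> f \<doteq> g"
  unfolding almost_all_eq_def by (rule finite_subset[of _ B]) auto

lemma almost_all_eq_sym: "f \<doteq> g \<Longrightarrow> g \<doteq> f"
  unfolding almost_all_eq_def by (simp add: eq_commute)

lemma almost_all_eq_trans: "f \<doteq> g \<Longrightarrow> g \<doteq> h \<Longrightarrow> f \<doteq> h"
  unfolding almost_all_eq_def
  by (rule finite_subset[of _ "{z. f z \<noteq> g z} \<union> {z. g z \<noteq> h z}"]) auto

lemma fract_eval_Fract:
  assumes "q \<noteq> 0"
  shows "fract_eval (Fract p q) \<doteq> (\<lambda>z. poly p z / poly q z)"
proof (rule almost_all_eqI)
  let ?f = "Fract p q"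
  show "finite ({z. poly q z = 0} \<union> {z. poly (fden ?f) z = 0})"
    using assms by (simp add: poly_roots_finite)
  fix z assume z: "z \<notin> {z. poly q z = 0} \<union> {z. poly (fden ?f) z = 0}"
  have "Fract (fnum ?f) (fden ?f) = Fract p q" by simp
  then have "fnum ?f * q = p * fden ?f" using assms by (simp only: eq_fract snd_quot_of_fract_nonzero not_False_eq_True)
  then have "poly (fnum ?f) z * poly q z = poly p z * poly (fden ?f) z" by (metis poly_mult)
  then show "fract_eval ?f z = poly p z / poly q z"
    using z unfolding fract_eval_def by (simp add: frac_eq_eq)
qed

lemma fract_eval_determines:
  assumes "fract_eval f \<doteq> fract_eval g"
  shows "f = g"
proof -
  let ?d = "fnum f * fden g - fnum g * fden f"
  have "\<not> finite {z. poly ?d z = 0}"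
  proof
    assume fin: "finite {z. poly ?d z = 0}"
    have "UNIV \<subseteq> {z. poly ?d z = 0} \<union> {z. fract_eval f z \<noteq> fract_eval g z} \<union> {z. poly (fden f) z = 0} \<union> {z. poly (fden g) z = 0}"
      by (auto simp: fract_eval_def frac_eq_eq)
    moreover have "finite ({z. poly ?d z = 0} \<union> {z. fract_eval f z \<noteq> fract_eval g z} \<union> {z. poly (fden f) z = 0} \<union> {z. poly (fden g) z = 0})"
      using fin assms unfolding almost_all_eq_def by (simp add: poly_roots_finite)
    ultimately show False using infinite_UNIV_char_0 finite_subset by blast
  qed
  then have "?d = 0" using poly_roots_finite by blast
  then have "Fract (fnum f) (fden f) = Fract (fnum g) (fden g)"
    by (simp only: eq_fract snd_quot_of_fract_nonzero not_False_eq_True) simp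
  then show ?thesis by simp
qed

definition fin_part :: "(csphere \<Rightarrow> csphere) \<Rightarrow> complex \<Rightarrow> complex" where
  "fin_part S z = the (S (Some z))"

text \<open>The relation that the definite description in \<^const>\<open>pullback\<close> singles out.\<close>

definition is_pullback :: "(csphere \<Rightarrow> csphere) \<Rightarrow> rational_form \<Rightarrow> rational_form \<Rightarrow> bool" where
  "is_pullback S \<eta> \<omega> \<longleftrightarrow> fract_eval \<omega> \<doteq> (\<lambda>z. fract_eval \<eta> (fin_part S z) * deriv (fin_part S) z)"

lemma pullback_eqI:
  assumes "is_pullback S \<eta> \<omega>"
  shows "pullback S \<eta> = \<omega>"
proof -
  have "(THE \<omega>. finite {z. fract_eval \<omega> z \<noteq> fract_eval \<eta> (fin_part S z) * deriv (fin_part S) z}) = \<omega>"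
  proof (rule the_equality)
    show "finite {z. fract_eval \<omega> z \<noteq> fract_eval \<eta> (fin_part S z) * deriv (fin_part S) z}"
      using assms by (simp add: is_pullback_def almost_all_eq_def)
    fix \<omega>' assume "finite {z. fract_eval \<omega>' z \<noteq> fract_eval \<eta> (fin_part S z) * deriv (fin_part S) z}"
    then have "fract_eval \<omega>' \<doteq> (\<lambda>z. fract_eval \<eta> (fin_part S z) * deriv (fin_part S) z)"
      by (simp add: almost_all_eq_def)
    then show "\<omega>' = \<omega>"
      using assms almost_all_eq_trans almost_all_eq_sym fract_eval_determines
      unfolding is_pullback_def by blast
  qed
  moreover have "fin_part S = (\<lambda>z. the (S (Some z)))" by (simp add: fin_part_def fun_eq_iff)
  ultimately show ?thesis unfolding pullback_def Let_def by simp
qed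

lemma finite_linear_root:
  fixes c d :: complex
  assumes "c \<noteq> 0 \<or> d \<noteq> 0"
  shows "finite {z. c * z + d = 0}"
proof -
  have "[:d, c:] \<noteq> 0" using assms by auto
  then have "finite {z. poly [:d, c:] z = 0}" by (rule poly_roots_finite)
  then show ?thesis by (simp add: add.commute mult.commute)
qed

lemma fin_part_moebius:
  "c * z + d \<noteq> 0 \<Longrightarrow> fin_part (moebius a b c d) z = (a * z + b) / (c * z + d)"
  by (simp add: fin_part_def moebius_def)

lemma fin_part_moebius_deriv:
  assumes det: "a * d - b * c = 1" and z: "c * z + d \<noteq> 0"
  shows "(fin_part (moebius a b c d) has_field_derivative 1 / (c * z + d)\<^sup>2) (at z)"
proof (rule has_field_derivative_transform_within_open)
  show "open {z. c * z + d \<noteq> 0}"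
    by (intro open_Collect_neq continuous_intros)
  show "((\<lambda>z. (a * z + b) / (c * z + d)) has_field_derivative 1 / (c * z + d)\<^sup>2) (at z)"
  proof -
    have "((\<lambda>z. (a * z + b) / (c * z + d)) has_field_derivative
      (a * (c * z + d) - (a * z + b) * c) / ((c * z + d) * (c * z + d))) (at z)"
      using z by (auto intro!: derivative_eq_intros)
    also have "a * (c * z + d) - (a * z + b) * c = 1" using det by (simp add: algebra_simps)
    finally show ?thesis by (simp only: power2_eq_square)
  qed
qed (use z in \<open>simp_all add: fin_part_moebius\<close>)

lemma fin_part_inj:
  assumes S: "S = moebius a b c d" "a * d - b * c = 1"
  shows "inj_on (fin_part S) {z. c * z + d \<noteq> 0}"
proof (rule inj_onI)
  fix y z assume h: "y \<in> {z. c * z + d \<noteq> 0}" "z \<in> {z. c * z + d \<noteq> 0}" "fin_part S y = fin_part S z"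
  have "S (Some y) = S (Some z)"
    using h unfolding S(1) by (simp add: fin_part_moebius moebius_def)
  moreover have "inj S" unfolding S(1) using S(2) by (intro bij_is_inj Moeb_bij moebius_in_Moeb) simp
  ultimately show "y = z" by (auto dest: injD)
qed

lemma is_pullback_moebius:
  assumes S: "S = moebius a b c d" "a * d - b * c = 1"
  shows "is_pullback S \<eta> \<omega> \<longleftrightarrow>
    fract_eval \<omega> \<doteq> (\<lambda>z. fract_eval \<eta> ((a * z + b) / (c * z + d)) * (1 / (c * z + d)\<^sup>2))"
proof -
  have "c \<noteq> 0 \<or> d \<noteq> 0" using S(2) by auto
  then have "(\<lambda>z. fract_eval \<eta> (fin_part S z) * deriv (fin_part S) z) \<doteq>
     (\<lambda>z. fract_eval \<eta> ((a * z + b) / (c * z + d)) * (1 / (c * z + d)\<^sup>2))"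
    by (intro almost_all_eqI[OF finite_linear_root[of c d]])
      (simp_all add: S(1) fin_part_moebius DERIV_imp_deriv[OF fin_part_moebius_deriv[OF S(2)]])
  then show ?thesis unfolding is_pullback_def
    using almost_all_eq_trans almost_all_eq_sym by blast
qed

text \<open>\<open>C\<^sup>d p(A / C)\<close>, where \<open>d\<close> is the degree of \<open>p\<close>.\<close>

definition homogenize :: "complex poly \<Rightarrow> complex poly \<Rightarrow> complex poly \<Rightarrow> complex poly" where
  "homogenize p A C = (\<Sum>i\<le>degree p. smult (coeff p i) (A ^ i * C ^ (degree p - i)))"

lemma poly_homogenize:
  assumes "poly C z \<noteq> 0"
  shows "poly (homogenize p A C) z = poly C z ^ degree p * poly p (poly A z / poly C z)"
proof -
  have *: "poly C z ^ degree p * (coeff p i * (poly A z / poly C z) ^ i)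
    = coeff p i * (poly A z ^ i * poly C z ^ (degree p - i))" if "i \<le> degree p" for i
  proof -
    have "poly C z ^ degree p = poly C z ^ i * poly C z ^ (degree p - i)"
      using that by (simp flip: power_add)
    then show ?thesis using assms by (simp add: power_divide)
  qed
  show ?thesis unfolding homogenize_def poly_sum poly_altdef[of p] sum_distrib_left
    by (intro sum.cong refl) (simp only: poly_smult poly_mult poly_power atMost_iff *)
qed

text \<open>The numerator and the denominator of the form are homogenized in \<open>a z + b\<close> and \<open>c z + d\<close>; this
  and the derivative \<open>1 / (c z + d)\<^sup>2\<close> leave powers of \<open>c z + d\<close> to be balanced. The new denominator is
  not zero because \<open>S\<close> takes infinitely many values.\<close>

lemma is_pullback_exists:
  assumes "S \<in> Moeb"
  shows "\<exists>\<omega>. is_pullback S \<eta> \<omega>"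
proof -
  obtain a b c d where S: "S = moebius a b c d" "a * d - b * c = 1" using assms by (rule MoebE)
  define A where "A = [:b, a:]"
  define C where "C = [:d, c:]"
  have pA: "poly A z = a * z + b" and pC: "poly C z = c * z + d" for z
    by (simp_all add: A_def C_def mult.commute add.commute)
  have cd: "c \<noteq> 0 \<or> d \<noteq> 0" using S(2) by auto
  have C0: "C \<noteq> 0" using cd by (auto simp: C_def)
  let ?p = "fnum \<eta>" and ?q = "fden \<eta>"
  have hq: "homogenize ?q A C \<noteq> 0"
  proof
    assume 0: "homogenize ?q A C = 0"
    have "fin_part S ` {z. c * z + d \<noteq> 0} \<subseteq> {w. poly ?q w = 0}"
    proof
      fix w assume "w \<in> fin_part S ` {z. c * z + d \<noteq> 0}"
      then obtain z where z: "c * z + d \<noteq> 0" "w = (a * z + b) / (c * z + d)"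
        by (auto simp: S(1) fin_part_moebius)
      then show "w \<in> {w. poly ?q w = 0}"
        using poly_homogenize[of C z ?q A] 0 by (simp add: pA pC)
    qed
    then have "finite (fin_part S ` {z. c * z + d \<noteq> 0})"
      using finite_subset poly_roots_finite[OF snd_quot_of_fract_nonzero] by blast
    then have "finite {z. c * z + d \<noteq> 0}" using fin_part_inj[OF S] by (rule finite_imageD)
    then have "finite ({z. c * z + d \<noteq> 0} \<union> {z. c * z + d = 0})"
      using finite_linear_root[OF cd] by (rule finite_UnI)
    moreover have "{z. c * z + d \<noteq> 0} \<union> {z. c * z + d = 0} = UNIV" by auto
    ultimately have "finite (UNIV :: complex set)" by simp
    then show False using infinite_UNIV_char_0 by blast
  qed
  define P where "P = homogenize ?p A C * C ^ degree ?q"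
  define R where "R = homogenize ?q A C * C ^ degree ?p * C ^ 2"
  have "R \<noteq> 0" using hq C0 by (simp add: R_def)
  then have "fract_eval (Fract P R) \<doteq> (\<lambda>z. poly P z / poly R z)" by (rule fract_eval_Fract)
  moreover have "(\<lambda>z. poly P z / poly R z) \<doteq>
      (\<lambda>z. fract_eval \<eta> ((a * z + b) / (c * z + d)) * (1 / (c * z + d)\<^sup>2))"
  proof (rule almost_all_eqI[OF finite_linear_root[OF cd]])
    fix z assume "z \<notin> {z. c * z + d = 0}"
    then have z: "c * z + d \<noteq> 0" by simp
    then show "poly P z / poly R z = fract_eval \<eta> ((a * z + b) / (c * z + d)) * (1 / (c * z + d)\<^sup>2)"
      using poly_homogenize[of C z ?p A] poly_homogenize[of C z ?q A]
      by (simp add: P_def R_def pA pC fract_eval_def)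
  qed
  ultimately show ?thesis using is_pullback_moebius[OF S] almost_all_eq_trans by blast
qed

lemma pullback_is_pullback: "S \<in> Moeb \<Longrightarrow> is_pullback S \<eta> (pullback S \<eta>)"
  using is_pullback_exists pullback_eqI by blast

lemma pullback_comp:
  assumes "S \<in> Moeb" "T \<in> Moeb"
  shows "pullback (S \<circ> T) \<eta> = pullback T (pullback S \<eta>)"
proof (rule pullback_eqI)
  obtain a b c d where S: "S = moebius a b c d" "a * d - b * c = 1" using assms(1) by (rule MoebE)
  obtain a' b' c' d' where T: "T = moebius a' b' c' d'" "a' * d' - b' * c' = 1" using assms(2) by (rule MoebE)
  let ?p = "a * a' + b * c'" and ?q = "a * b' + b * d'" and ?r = "c * a' + d * c'" and ?s = "c * b' + d * d'"
  let ?\<omega> = "pullback S \<eta>" and ?\<theta> = "pullback T (pullback S \<eta>)"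
  let ?t = "\<lambda>z. (a' * z + b') / (c' * z + d')"
  have ST: "S \<circ> T = moebius ?p ?q ?r ?s"
    unfolding S T using T(2) by (intro moebius_comp) simp
  have det: "?p * ?s - ?q * ?r = 1"
  proof -
    have "?p * ?s - ?q * ?r
      = (a * d - b * c) * (a' * d' - b' * c')" by (simp add: algebra_simps)
    then show ?thesis using S T by simp
  qed
  have cd: "c \<noteq> 0 \<or> d \<noteq> 0" "c' \<noteq> 0 \<or> d' \<noteq> 0" using S(2) T(2) by auto
  define B1 where "B1 = {w. fract_eval ?\<omega> w \<noteq> fract_eval \<eta> ((a * w + b) / (c * w + d)) * (1 / (c * w + d)\<^sup>2)}
     \<union> {w. c * w + d = 0}"
  define B2 where "B2 = {z. fract_eval ?\<theta> z \<noteq> fract_eval ?\<omega> (?t z) * (1 / (c' * z + d')\<^sup>2)} \<union> {z. c' * z + d' = 0}"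
  have B1: "finite B1" unfolding B1_def
    using pullback_is_pullback[OF assms(1), of \<eta>] finite_linear_root[OF cd(1)]
    unfolding is_pullback_moebius[OF S] almost_all_eq_def by simp
  have B2: "finite B2" unfolding B2_def
    using pullback_is_pullback[OF assms(2), of ?\<omega>] finite_linear_root[OF cd(2)]
    unfolding is_pullback_moebius[OF T] almost_all_eq_def by simp
  have B3: "finite {z. c' * z + d' \<noteq> 0 \<and> ?t z \<in> B1}"
  proof (rule finite_imageD)
    show "finite (?t ` {z. c' * z + d' \<noteq> 0 \<and> ?t z \<in> B1})"
      by (rule finite_subset[OF _ B1]) auto
    show "inj_on ?t {z. c' * z + d' \<noteq> 0 \<and> ?t z \<in> B1}"
      using fin_part_inj[OF T] unfolding T(1) inj_on_def by (simp add: fin_part_moebius)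
  qed
  have "fract_eval ?\<theta> \<doteq> (\<lambda>z. fract_eval \<eta> ((?p * z + ?q) / (?r * z + ?s))
     * (1 / (?r * z + ?s)\<^sup>2))"
  proof (rule almost_all_eqI[OF finite_UnI[OF B2 B3]])
    fix z assume "z \<notin> B2 \<union> {z. c' * z + d' \<noteq> 0 \<and> ?t z \<in> B1}"
    then have z: "c' * z + d' \<noteq> 0" "?t z \<notin> B1" "z \<notin> B2" unfolding B2_def by auto
    have n: "c * ?t z + d \<noteq> 0" using z(2) unfolding B1_def by blast
    have e: "?r * z + ?s = (c * ?t z + d) * (c' * z + d')"
      "?p * z + ?q = (a * ?t z + b) * (c' * z + d')"
    proof -
      have lin: "p * (a' * z + b') + q * (c' * z + d') = (p * w + q) * (c' * z + d')"
        if w: "w * (c' * z + d') = a' * z + b'" for p q w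
        unfolding w[symmetric] by (simp only: distrib_right mult.assoc)
      have t: "?t z * (c' * z + d') = a' * z + b'" using z(1) by simp
      have "?r * z + ?s = c * (a' * z + b') + d * (c' * z + d')"
        "?p * z + ?q = a * (a' * z + b') + b * (c' * z + d')"
        by (simp_all add: algebra_simps)
      then show "?r * z + ?s = (c * ?t z + d) * (c' * z + d')"
        "?p * z + ?q = (a * ?t z + b) * (c' * z + d')"
        unfolding lin[OF t] by blast+
    qed
    have "fract_eval ?\<theta> z = fract_eval ?\<omega> (?t z) * (1 / (c' * z + d')\<^sup>2)"
      using z(3) unfolding B2_def by blast
    also have "fract_eval ?\<omega> (?t z) = fract_eval \<eta> ((a * ?t z + b) / (c * ?t z + d)) * (1 / (c * ?t z + d)\<^sup>2)"
      using z(2) unfolding B1_def by blast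
    finally show "fract_eval ?\<theta> z = fract_eval \<eta> ((?p * z + ?q) / (?r * z + ?s))
     * (1 / (?r * z + ?s)\<^sup>2)"
      unfolding e using z(1) n by (simp add: power_mult_distrib)
  qed
  then show "is_pullback (S \<circ> T) \<eta> ?\<theta>" unfolding is_pullback_moebius[OF ST det] .
qed

lemma pullback_id [simp]: "pullback id \<eta> = \<eta>"
proof (rule pullback_eqI)
  have i: "id = moebius 1 0 0 1" by (simp add: moebius_id)
  have "is_pullback (moebius 1 0 0 1) \<eta> \<eta>"
    by (subst is_pullback_moebius[of _ 1 0 0 1]) (simp_all add: almost_all_eq_def)
  then show "is_pullback id \<eta> \<eta>" using i by simp
qed

lemma pullback_inverse:
  assumes "S \<in> Moeb"
  shows "pullback (minv S) (pullback S \<eta>) = \<eta>" "pullback S (pullback (minv S) \<eta>) = \<eta>"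
  using pullback_comp[of S "minv S" \<eta>] pullback_comp[of "minv S" S \<eta>] assms by (simp_all add: Moeb_inv)

lemma pullback_zero: "S \<in> Moeb \<Longrightarrow> pullback S 0 = 0"
  by (rule pullback_eqI) (simp add: is_pullback_def almost_all_eq_def fract_eval_def)

lemma pullback_nonzero: "S \<in> Moeb \<Longrightarrow> \<eta> \<noteq> 0 \<Longrightarrow> pullback S \<eta> \<noteq> 0"
  using pullback_inverse(1) pullback_zero[OF Moeb_inv] by metis

text \<open>Pulling back by \<open>T\<close> reduces every question about a conjugate of \<open>Dih n\<close> to \<open>Dih n\<close> itself.\<close>

lemma form_invariant_conj:
  assumes T: "T \<in> Moeb" and H: "H \<subseteq> Moeb"
  shows "form_invariant (conj_by T H) \<eta> \<longleftrightarrow> form_invariant H (pullback T \<eta>)"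
proof -
  have "pushforward (T \<circ> h \<circ> minv T) \<eta> = \<eta> \<longleftrightarrow> pushforward h (pullback T \<eta>) = pullback T \<eta>" if h: "h \<in> H" for h
  proof -
    have hM: "h \<in> Moeb" using h H by blast
    have "minv (T \<circ> h \<circ> minv T) = T \<circ> minv h \<circ> minv T"
      using T hM by (simp add: o_inv_distrib bij_comp Moeb_bij Moeb_inv inv_inv_eq comp_assoc)
    then have "pushforward (T \<circ> h \<circ> minv T) \<eta> = pullback (minv T) (pullback (minv h) (pullback T \<eta>))"
      unfolding pushforward_def using T hM by (simp add: pullback_comp Moeb_comp Moeb_inv)
    then show ?thesis unfolding pushforward_def using pullback_inverse[OF T] by metis
  qed
  then show ?thesis unfolding form_invariant_def conj_by_def by blast
qed

section \<open>Orders under pullback\<close>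

text \<open>Orders are compared through limits, which treats finite points and infinity alike. Near \<open>x\<close> let \<open>u\<close>
  be the local coordinate \<open>z - w\<close> or \<open>1 / z\<close>, with derivative \<open>u'\<close>. The form \<open>f dz\<close> equals \<open>(f / u') du\<close>, and
  \<open>has_lead f x m c\<close> says that it starts with \<open>c u\<^sup>m du\<close>.\<close>

definition pfilter :: "csphere \<Rightarrow> complex filter" where
  "pfilter x = (case x of None \<Rightarrow> at_infinity | Some w \<Rightarrow> at w)"

definition lcoord :: "csphere \<Rightarrow> complex \<Rightarrow> complex" where
  "lcoord x z = (case x of None \<Rightarrow> 1 / z | Some w \<Rightarrow> z - w)"

definition dcoord :: "csphere \<Rightarrow> complex \<Rightarrow> complex" where
  "dcoord x z = (case x of None \<Rightarrow> - 1 / z\<^sup>2 | Some w \<Rightarrow> 1)"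

definition has_lead :: "(complex \<Rightarrow> complex) \<Rightarrow> csphere \<Rightarrow> int \<Rightarrow> complex \<Rightarrow> bool" where
  "has_lead f x m c \<longleftrightarrow> c \<noteq> 0 \<and>
     ((\<lambda>z. f z / dcoord x z / lcoord x z powi m) \<longlongrightarrow> c) (pfilter x)"

lemma pfilter_nontrivial [simp]: "pfilter x \<noteq> bot"
  by (simp add: pfilter_def trivial_limit_at_infinity split: option.split)

lemma eventually_pfilter_finite:
  assumes "finite B"
  shows "eventually (\<lambda>z. z \<notin> B) (pfilter x)"
proof (cases x)
  case None
  obtain r where "\<forall>z\<in>B. norm z \<le> r" using finite_imp_bounded[OF assms] bounded_iff by blast
  then have "\<forall>z. norm z \<ge> r + 1 \<longrightarrow> z \<notin> B" by force
  then show ?thesis unfolding None pfilter_def option.case eventually_at_infinity by blast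
next
  case (Some w)
  have "open (- (B - {w}))" using assms by (intro open_Compl finite_imp_closed) simp
  then show ?thesis unfolding Some pfilter_def option.case eventually_at_topological
    by (intro exI[of _ "- (B - {w})"]) auto
qed

lemma eventually_pfilter_coord:
  "eventually (\<lambda>z. lcoord x z \<noteq> 0 \<and> dcoord x z \<noteq> 0) (pfilter x)"
proof (cases x)
  case None
  show ?thesis 
    by (rule eventually_mono[OF eventually_pfilter_finite[of "{0}"]]) (simp_all add: None lcoord_def dcoord_def)
next
  case (Some w)
  show ?thesis 
    by (rule eventually_mono[OF eventually_pfilter_finite[of "{w}"]]) (simp_all add: Some lcoord_def dcoord_def)
qed

lemma lcoord_tendsto_0: "(lcoord x \<longlongrightarrow> 0) (pfilter x)"
proof (cases x)
  case None
  have "lcoord x = inverse" by (simp add: None lcoord_def fun_eq_iff inverse_eq_divide)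
  then show ?thesis unfolding None pfilter_def option.case using tendsto_inverse_0 by simp
next
  case (Some w)
  have "((\<lambda>z. z - w) \<longlongrightarrow> w - w) (at w)" by (intro tendsto_intros)
  moreover have "lcoord x = (\<lambda>z. z - w)" by (simp add: Some lcoord_def fun_eq_iff)
  ultimately show ?thesis unfolding Some pfilter_def option.case by simp
qed

lemma filterlim_pfilter:
  assumes l: "((\<lambda>z. lcoord y (g z)) \<longlongrightarrow> 0) F" and n: "eventually (\<lambda>z. lcoord y (g z) \<noteq> 0) F"
  shows "filterlim g (pfilter y) F"
proof (cases y)
  case None
  have "filterlim (\<lambda>z. inverse (g z)) (at 0) F"
    using l n unfolding None lcoord_def option.case filterlim_at by (simp add: inverse_eq_divide)
  then show ?thesis unfolding None pfilter_def option.case filterlim_inverse_at_iff .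
next
  case (Some w)
  have "(g \<longlongrightarrow> w) F" using l unfolding Some lcoord_def option.case by (rule LIM_zero_cancel)
  then show ?thesis using n unfolding Some lcoord_def pfilter_def option.case filterlim_at by simp
qed

lemma has_lead_unique:
  assumes "has_lead f x m c" "has_lead f x m' c'"
  shows "m = m' \<and> c = c'"
proof -
  have lt: False if h: "has_lead f x m c" "has_lead f x m' c'" "m < m'" for m m' c c'
  proof -
    define k where "k = nat (m' - m)"
    have k: "k > 0" "m' = m + int k" using h(3) by (auto simp: k_def)
    have "((\<lambda>z. (f z / dcoord x z / lcoord x z powi m') * lcoord x z ^ k) \<longlongrightarrow> c' * 0 ^ k) (pfilter x)"
      using h(2) unfolding has_lead_def by (intro tendsto_intros lcoord_tendsto_0) auto
    moreover have "eventually (\<lambda>z. (f z / dcoord x z / lcoord x z powi m') * lcoord x z ^ k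
        = f z / dcoord x z / lcoord x z powi m) (pfilter x)"
      using eventually_pfilter_coord
    proof (rule eventually_mono)
      fix z assume z: "lcoord x z \<noteq> 0 \<and> dcoord x z \<noteq> 0"
      have "lcoord x z powi m' = lcoord x z powi m * lcoord x z ^ k"
        unfolding k(2) using z by (simp add: power_int_add)
      then show "(f z / dcoord x z / lcoord x z powi m') * lcoord x z ^ k
        = f z / dcoord x z / lcoord x z powi m" using z by simp
    qed
    ultimately have "((\<lambda>z. f z / dcoord x z / lcoord x z powi m) \<longlongrightarrow> c' * 0 ^ k) (pfilter x)"
      by (rule Lim_transform_eventually)
    then have "c = c' * 0 ^ k"
      using h(1) unfolding has_lead_def by (intro tendsto_unique[OF pfilter_nontrivial]) auto
    then show False using h(1) k(1) by (simp add: has_lead_def)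
  qed
  have "m = m'" using lt[OF assms] lt[OF assms(2,1)] by (cases m m' rule: linorder_cases) auto
  moreover have "c = c'"
    using assms \<open>m = m'\<close> unfolding has_lead_def by (intro tendsto_unique[OF pfilter_nontrivial]) auto
  ultimately show ?thesis by simp
qed

lemma has_lead_cong:
  assumes "f \<doteq> g" "has_lead f x m c"
  shows "has_lead g x m c"
proof -
  have "eventually (\<lambda>z. f z / dcoord x z / lcoord x z powi m = g z / dcoord x z / lcoord x z powi m) (pfilter x)"
    using assms(1) unfolding almost_all_eq_def
    by (rule eventually_mono[OF eventually_pfilter_finite]) auto
  then show ?thesis using assms(2) unfolding has_lead_def by (auto intro: Lim_transform_eventually)
qed

lemma has_lead_scale:
  assumes "k \<noteq> 0" "has_lead f x m c"
  shows "has_lead (\<lambda>z. k * f z) x m (k * c)"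
proof -
  have "((\<lambda>z. k * (f z / dcoord x z / lcoord x z powi m)) \<longlongrightarrow> k * c) (pfilter x)"
    using assms(2) unfolding has_lead_def by (intro tendsto_intros) auto
  then show ?thesis using assms unfolding has_lead_def by simp
qed

lemma has_lead_form_order:
  assumes "\<eta> \<noteq> 0"
  shows "\<exists>c. has_lead (fract_eval \<eta>) x (form_order \<eta> x) c"
proof (cases x)
  case (Some w)
  let ?r = "\<lambda>z. fract_eval \<eta> z / dcoord x z / lcoord x z powi form_order \<eta> x"
  let ?p = "fnum \<eta>" and ?q = "fden \<eta>"
  have p0: "?p \<noteq> 0" and q0: "?q \<noteq> 0" using assms by simp_all
  define i where "i = Polynomial.order w ?p"
  define j where "j = Polynomial.order w ?q"
  obtain u where u: "?p = [:-w, 1:] ^ i * u" "\<not> [:-w, 1:] dvd u" using order_decomp[OF p0] unfolding i_def by blast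
  obtain v where v: "?q = [:-w, 1:] ^ j * v" "\<not> [:-w, 1:] dvd v" using order_decomp[OF q0] unfolding j_def by blast
  have un: "poly u w \<noteq> 0" and vn: "poly v w \<noteq> 0" using u v by (simp_all add: poly_eq_0_iff_dvd)
  have ord: "form_order \<eta> x = int i - int j" by (simp add: Some form_order_def i_def j_def)
  have "((\<lambda>z. poly u z / poly v z) \<longlongrightarrow> poly u w / poly v w) (at w)"
    using vn by (intro tendsto_intros)
  moreover have "eventually (\<lambda>z. poly u z / poly v z = ?r z) (at w)"
  proof -
    have "eventually (\<lambda>z. z \<notin> {w}) (at w)" using eventually_pfilter_finite[of "{w}" "Some w"] by (simp add: pfilter_def)
    then show ?thesis
    proof (rule eventually_mono)
      fix z assume "z \<notin> {w}"
      then have z: "z - w \<noteq> 0" by simp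
      have "fract_eval \<eta> z = ((z - w) ^ i * poly u z) / ((z - w) ^ j * poly v z)"
        unfolding fract_eval_def by (subst u(1), subst v(1)) simp
      moreover have "(z - w) powi form_order \<eta> x = (z - w) ^ i / (z - w) ^ j"
        unfolding ord using z by (simp add: power_int_diff)
      ultimately show "poly u z / poly v z = ?r z"
        using z by (simp add: Some dcoord_def lcoord_def)
    qed
  qed
  ultimately have "((\<lambda>z. ?r z) \<longlongrightarrow> poly u w / poly v w) (at w)"
    by (rule Lim_transform_eventually)
  then show ?thesis unfolding has_lead_def using un vn by (intro exI[of _ "poly u w / poly v w"]) (simp add: Some pfilter_def)
next
  case None
  let ?r = "\<lambda>z. fract_eval \<eta> z / dcoord x z / lcoord x z powi form_order \<eta> x"
  let ?p = "fnum \<eta>" and ?q = "fden \<eta>"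
  have p0: "?p \<noteq> 0" and q0: "?q \<noteq> 0" using assms by simp_all
  let ?g = "\<lambda>z. - ((poly ?p z / z ^ degree ?p) / (poly ?q z / z ^ degree ?q))"
  let ?c = "- (lead_coeff ?p / lead_coeff ?q)"
  have ord: "form_order \<eta> x = int (degree ?q) - int (degree ?p) - 2" by (simp add: None form_order_def)
  have "((\<lambda>z. ?g z) \<longlongrightarrow> ?c) at_infinity"
    using q0 by (intro tendsto_intros poly_divide_tendsto_aux) auto
  moreover have "eventually (\<lambda>z. ?g z
     = ?r z) at_infinity"
  proof -
    have "eventually (\<lambda>z::complex. z \<notin> {0}) at_infinity" using eventually_pfilter_finite[of "{0}" None] by (simp add: pfilter_def)
    then show ?thesis
    proof (rule eventually_mono)
      fix z :: complex assume "z \<notin> {0}"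
      then have z: "z \<noteq> 0" by simp
      have "(1 / z) powi form_order \<eta> x = (1 / z) ^ degree ?q / (1 / z) ^ degree ?p / (1 / z)\<^sup>2"
        unfolding ord using z by (simp add: power_int_diff)
      also have "\<dots> = z ^ degree ?p * z\<^sup>2 / z ^ degree ?q"
        using z by (simp add: power_divide)
      finally have "lcoord x z powi form_order \<eta> x = z ^ degree ?p * z\<^sup>2 / z ^ degree ?q" by (simp add: None lcoord_def)
      then show "?g z
        = ?r z"
        using z by (simp add: None dcoord_def fract_eval_def)
    qed
  qed
  ultimately have "((\<lambda>z. ?r z) \<longlongrightarrow> ?c) at_infinity"
    by (rule Lim_transform_eventually)
  then show ?thesis unfolding has_lead_def using p0 q0 by (intro exI[of _ ?c]) (simp add: None pfilter_def)
qed

text \<open>Chain rule for leading terms: near \<open>x\<close> the coordinate \<open>u\<close> at the image point is \<open>\<mu>\<close> times the one at \<open>x\<close>,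
  and \<open>du\<close> is \<open>\<nu>\<close> times the other differential. At a fixed point \<open>\<mu> = \<nu>\<close>, and the factor
  \<open>\<mu>\<^sup>m\<^sup>+\<^sup>1\<close> by which the leading coefficient changes is what detects invariance.\<close>

lemma has_lead_pullback:
  assumes om: "fract_eval \<omega> \<doteq> (\<lambda>z. fract_eval \<eta> (s z) * s' z)"
    and lead: "has_lead (fract_eval \<eta>) y m c"
    and mu: "((\<lambda>z. lcoord y (s z) / lcoord x z) \<longlongrightarrow> \<mu>) (pfilter x)" "\<mu> \<noteq> 0"
    and nu: "((\<lambda>z. dcoord y (s z) * s' z / dcoord x z) \<longlongrightarrow> \<nu>) (pfilter x)" "\<nu> \<noteq> 0"
  shows "has_lead (fract_eval \<omega>) x m (c * \<nu> * \<mu> powi m)"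
proof -
  let ?l = "\<lambda>z. (fract_eval \<eta> (s z) / dcoord y (s z) / lcoord y (s z) powi m)
       * (dcoord y (s z) * s' z / dcoord x z) * (lcoord y (s z) / lcoord x z) powi m"
    and ?r = "\<lambda>z. fract_eval \<omega> z / dcoord x z / lcoord x z powi m"
  have ev: "eventually (\<lambda>z. lcoord y (s z) / lcoord x z \<noteq> 0) (pfilter x)"
    using tendsto_imp_eventually_ne[OF mu] .
  have evd: "eventually (\<lambda>z. dcoord y (s z) * s' z / dcoord x z \<noteq> 0) (pfilter x)"
    using tendsto_imp_eventually_ne[OF nu] .
  have "((\<lambda>z. lcoord y (s z) / lcoord x z * lcoord x z) \<longlongrightarrow> \<mu> * 0) (pfilter x)"
    by (intro tendsto_intros mu lcoord_tendsto_0)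
  moreover have "eventually (\<lambda>z. lcoord y (s z) / lcoord x z * lcoord x z = lcoord y (s z)) (pfilter x)"
    using eventually_pfilter_coord by (rule eventually_mono) simp
  ultimately have "((\<lambda>z. lcoord y (s z)) \<longlongrightarrow> \<mu> * 0) (pfilter x)" by (rule Lim_transform_eventually)
  then have fl: "filterlim s (pfilter y) (pfilter x)"
    by (intro filterlim_pfilter eventually_mono[OF ev]) auto
  have "((\<lambda>z. fract_eval \<eta> (s z) / dcoord y (s z) / lcoord y (s z) powi m) \<longlongrightarrow> c) (pfilter x)"
    using lead unfolding has_lead_def by (auto intro: filterlim_compose[OF _ fl])
  then have "((\<lambda>z. ?l z) \<longlongrightarrow> c * \<nu> * \<mu> powi m) (pfilter x)"
    by (intro tendsto_intros nu mu)
  moreover have "eventually (\<lambda>z. ?l z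
       = ?r z) (pfilter x)"
    using eventually_conj[OF eventually_conj[OF ev evd]
        eventually_conj[OF eventually_pfilter_coord eventually_pfilter_finite[OF om[unfolded almost_all_eq_def]]]]
  proof (rule eventually_mono)
    fix z assume z: "(lcoord y (s z) / lcoord x z \<noteq> 0 \<and> dcoord y (s z) * s' z / dcoord x z \<noteq> 0) \<and>
      (lcoord x z \<noteq> 0 \<and> dcoord x z \<noteq> 0) \<and> z \<notin> {z. fract_eval \<omega> z \<noteq> fract_eval \<eta> (s z) * s' z}"
    have pw: "lcoord y (s z) powi m \<noteq> 0" using z by simp
    have dn: "dcoord y (s z) \<noteq> 0" using z by auto
    have gen: "F / D / P * (D * X / Y) * (P / R) = F * X / Y / R" if "D \<noteq> 0" "P \<noteq> 0" for F D P X Y R :: complex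
      using that by simp
    have "fract_eval \<omega> z = fract_eval \<eta> (s z) * s' z" using z by blast
    then show "?l z
       = ?r z"
      unfolding power_int_divide_distrib gen[OF dn pw] by simp
  qed
  ultimately have "((\<lambda>z. ?r z) \<longlongrightarrow> c * \<nu> * \<mu> powi m) (pfilter x)"
    by (rule Lim_transform_eventually)
  then show ?thesis unfolding has_lead_def using lead mu(2) nu(2) by (simp add: has_lead_def)
qed

text \<open>A Moebius map is a local biholomorphism of the sphere: in local coordinates its derivative
  vanishes nowhere. The four cases are whether \<open>x\<close> and \<open>S x\<close> are finite.\<close>

lemma moebius_local_coords:
  assumes S: "S \<in> Moeb"
  obtains \<mu> \<nu> where "\<mu> \<noteq> 0" "\<nu> \<noteq> 0"
    "((\<lambda>z. lcoord (S x) (fin_part S z) / lcoord x z) \<longlongrightarrow> \<mu>) (pfilter x)"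
    "((\<lambda>z. dcoord (S x) (fin_part S z) * deriv (fin_part S) z / dcoord x z) \<longlongrightarrow> \<nu>) (pfilter x)"
proof -
  obtain a b c d where S: "S = moebius a b c d" "a * d - b * c = 1" using assms by (rule MoebE)
  have cd: "c \<noteq> 0 \<or> d \<noteq> 0" and ab: "a \<noteq> 0 \<or> b \<noteq> 0" using S(2) by auto
  let ?s = "fin_part S"
  define B where "B = {z. c * z + d = 0} \<union> {z. a * z + b = 0} \<union> {0} \<union> {w. x = Some w}"
  have B: "finite B" unfolding B_def
    using finite_linear_root[OF cd] finite_linear_root[OF ab] by (cases x) auto
  have sz: "?s z = (a * z + b) / (c * z + d)" "deriv ?s z = 1 / (c * z + d)\<^sup>2" if "z \<notin> B" for z
    using that unfolding B_def S(1)
    by (simp_all add: fin_part_moebius DERIV_imp_deriv[OF fin_part_moebius_deriv[OF S(2)]])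
  note res = that
  \<comment> \<open>both limits are computed after replacing the functions by explicit ones off a finite set\<close>
  have concl: thesis if lim: "(f \<longlongrightarrow> \<mu>) (pfilter x)" "(g \<longlongrightarrow> \<nu>) (pfilter x)" "\<mu> \<noteq> 0" "\<nu> \<noteq> 0"
    and f: "\<And>z. z \<notin> B \<Longrightarrow> f z = lcoord (S x) (?s z) / lcoord x z"
    and g: "\<And>z. z \<notin> B \<Longrightarrow> g z = dcoord (S x) (?s z) * deriv ?s z / dcoord x z" for f g \<mu> \<nu>
  proof (rule res[OF lim(3,4)])
    show "((\<lambda>z. lcoord (S x) (?s z) / lcoord x z) \<longlongrightarrow> \<mu>) (pfilter x)"
      using lim(1) by (rule Lim_transform_eventually)
        (rule eventually_mono[OF eventually_pfilter_finite[OF B]], rule f)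
    show "((\<lambda>z. dcoord (S x) (?s z) * deriv ?s z / dcoord x z) \<longlongrightarrow> \<nu>) (pfilter x)"
      using lim(2) by (rule Lim_transform_eventually)
        (rule eventually_mono[OF eventually_pfilter_finite[OF B]], rule g)
  qed
  have inv0: "(inverse \<longlongrightarrow> (0::complex)) at_infinity" by (rule tendsto_inverse_0)
  show thesis
  proof (cases x)
    case (Some w)
    have F: "pfilter x = at w" by (simp add: Some pfilter_def)
    show thesis
    proof (cases "c * w + d = 0")
      case False
      have Sx: "S x = Some ((a * w + b) / (c * w + d))" using False by (simp add: Some S(1) moebius_def)
      show thesis
      proof (rule concl)
        show "((\<lambda>z. 1 / ((c * z + d) * (c * w + d))) \<longlongrightarrow> 1 / ((c * w + d) * (c * w + d))) (pfilter x)"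
          unfolding F using False by (intro tendsto_intros) auto
        show "((\<lambda>z. 1 / (c * z + d)\<^sup>2) \<longlongrightarrow> 1 / (c * w + d)\<^sup>2) (pfilter x)"
          unfolding F using False by (intro tendsto_intros) auto
        fix z assume z: "z \<notin> B"
        then have n: "c * z + d \<noteq> 0" "z - w \<noteq> 0" unfolding B_def using Some by auto
        have "(a * z + b) * (c * w + d) - (a * w + b) * (c * z + d) = (a * d - b * c) * (z - w)"
          by (simp add: algebra_simps)
        then have "?s z - (a * w + b) / (c * w + d) = (z - w) / ((c * z + d) * (c * w + d))"
          unfolding sz[OF z] diff_frac_eq[OF n(1) False] S(2) by simp
        then show "1 / ((c * z + d) * (c * w + d)) = lcoord (S x) (?s z) / lcoord x z"
          unfolding Sx unfolding Some lcoord_def option.case using n(2) by simp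
        show "1 / (c * z + d)\<^sup>2 = dcoord (S x) (?s z) * deriv ?s z / dcoord x z"
          unfolding Sx sz[OF z] unfolding Some dcoord_def by simp
      qed (use False in auto)
    next
      case True
      have Sx: "S x = None" using True by (simp add: Some S(1) moebius_def)
      have c0: "c \<noteq> 0" using True cd by auto
      have aw: "a * w + b \<noteq> 0" using det_image_nonzero[of a d b c w 1] S(2) True by simp
      show thesis
      proof (rule concl)
        show "((\<lambda>z. c / (a * z + b)) \<longlongrightarrow> c / (a * w + b)) (pfilter x)"
          unfolding F using aw by (intro tendsto_intros) auto
        show "((\<lambda>z. - 1 / (a * z + b)\<^sup>2) \<longlongrightarrow> - 1 / (a * w + b)\<^sup>2) (pfilter x)"
          unfolding F using aw by (intro tendsto_intros) auto
        fix z assume z: "z \<notin> B"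
        then have n: "c * z + d \<noteq> 0" "a * z + b \<noteq> 0" "z - w \<noteq> 0" unfolding B_def using Some by auto
        have e: "c * z + d = c * (z - w)" using True by (simp add: algebra_simps)
        show "c / (a * z + b) = lcoord (S x) (?s z) / lcoord x z"
          unfolding Sx sz[OF z] unfolding Some lcoord_def option.case e using n by simp
        show "- 1 / (a * z + b)\<^sup>2 = dcoord (S x) (?s z) * deriv ?s z / dcoord x z"
          unfolding Sx sz[OF z] unfolding Some dcoord_def option.case using n by (simp add: power_divide)
      qed (use aw c0 in auto)
    qed
  next
    case None
    have F: "pfilter x = at_infinity" by (simp add: None pfilter_def)
    show thesis
    proof (cases "c = 0")
      case False
      have Sx: "S x = Some (a / c)" using False by (simp add: None S(1) moebius_def)
      show thesis
      proof (rule concl)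
        have "((\<lambda>z. - 1 / ((c + d * inverse z) * c)) \<longlongrightarrow> - 1 / ((c + d * 0) * c)) (pfilter x)"
          unfolding F using False by (intro tendsto_intros inv0) auto
        then show "((\<lambda>z. - 1 / ((c + d * inverse z) * c)) \<longlongrightarrow> - 1 / (c * c)) (pfilter x)" by simp
        have "((\<lambda>z. - 1 / (c + d * inverse z)\<^sup>2) \<longlongrightarrow> - 1 / (c + d * 0)\<^sup>2) (pfilter x)"
          unfolding F using False by (intro tendsto_intros inv0) auto
        then show "((\<lambda>z. - 1 / (c + d * inverse z)\<^sup>2) \<longlongrightarrow> - 1 / c\<^sup>2) (pfilter x)" by simp
        fix z assume z: "z \<notin> B"
        then have n: "c * z + d \<noteq> 0" "z \<noteq> 0" unfolding B_def by auto
        have e: "c * z + d = (c + d * inverse z) * z" using n(2) by (simp add: distrib_right)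
        then have n': "c + d * inverse z \<noteq> 0" using n by auto
        have "(a * z + b) * c - a * (c * z + d) = - (a * d - b * c)" by (simp add: algebra_simps)
        then have "?s z - a / c = - 1 / ((c * z + d) * c)"
          unfolding sz[OF z] diff_frac_eq[OF n(1) False] S(2) by simp
        also have "\<dots> / (1 / z) = - 1 / ((c + d * inverse z) * c)"
          unfolding e using n(2) n' False by simp
        finally show "- 1 / ((c + d * inverse z) * c) = lcoord (S x) (?s z) / lcoord x z"
          unfolding Sx unfolding None lcoord_def option.case by simp
        show "- 1 / (c + d * inverse z)\<^sup>2 = dcoord (S x) (?s z) * deriv ?s z / dcoord x z"
          unfolding Sx sz[OF z] e unfolding None dcoord_def option.case
          using n(2) n' by (simp add: power_mult_distrib)
      qed (use False in auto)
    next
      case True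
      have Sx: "S x = None" using True by (simp add: None S(1) moebius_def)
      have "a * d = 1" using S(2) True by simp
      then have ad0: "a \<noteq> 0" "d \<noteq> 0" by auto
      show thesis
      proof (rule concl)
        have "((\<lambda>z. d / (a + b * inverse z)) \<longlongrightarrow> d / (a + b * 0)) (pfilter x)"
          unfolding F using ad0 by (intro tendsto_intros inv0) auto
        then show "((\<lambda>z. d / (a + b * inverse z)) \<longlongrightarrow> d / a) (pfilter x)" by simp
        have "((\<lambda>z. 1 / (a + b * inverse z)\<^sup>2) \<longlongrightarrow> 1 / (a + b * 0)\<^sup>2) (pfilter x)"
          unfolding F using ad0 by (intro tendsto_intros inv0) auto
        then show "((\<lambda>z. 1 / (a + b * inverse z)\<^sup>2) \<longlongrightarrow> 1 / a\<^sup>2) (pfilter x)" by simp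
        fix z assume z: "z \<notin> B"
        then have n: "a * z + b \<noteq> 0" "z \<noteq> 0" unfolding B_def by auto
        have e: "a * z + b = (a + b * inverse z) * z" using n(2) by (simp add: distrib_right)
        then have n': "a + b * inverse z \<noteq> 0" using n by auto
        have s: "?s z = (a + b * inverse z) * z / d" "deriv ?s z = 1 / d\<^sup>2"
          unfolding sz[OF z] e[symmetric] by (simp_all add: True)
        show "d / (a + b * inverse z) = lcoord (S x) (?s z) / lcoord x z"
          unfolding Sx s unfolding None lcoord_def option.case using n(2) n' ad0 by simp
        show "1 / (a + b * inverse z)\<^sup>2 = dcoord (S x) (?s z) * deriv ?s z / dcoord x z"
          unfolding Sx s unfolding None dcoord_def option.case
          using n(2) n' ad0 by (simp add: power_mult_distrib power_divide)
      qed (use ad0 in auto)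
    qed
  qed
qed

lemma form_order_pullback:
  assumes S: "S \<in> Moeb" and \<eta>: "\<eta> \<noteq> 0"
  shows "form_order (pullback S \<eta>) x = form_order \<eta> (S x)"
proof -
  obtain c where c: "has_lead (fract_eval \<eta>) (S x) (form_order \<eta> (S x)) c"
    using has_lead_form_order[OF \<eta>] by blast
  obtain \<mu> \<nu> where mn: "\<mu> \<noteq> 0" "\<nu> \<noteq> 0"
    "((\<lambda>z. lcoord (S x) (fin_part S z) / lcoord x z) \<longlongrightarrow> \<mu>) (pfilter x)"
    "((\<lambda>z. dcoord (S x) (fin_part S z) * deriv (fin_part S) z / dcoord x z) \<longlongrightarrow> \<nu>) (pfilter x)"
    by (rule moebius_local_coords[OF S, of x])
  have "has_lead (fract_eval (pullback S \<eta>)) x (form_order \<eta> (S x)) (c * \<nu> * \<mu> powi form_order \<eta> (S x))"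
    by (rule has_lead_pullback[OF pullback_is_pullback[OF S, of \<eta>, unfolded is_pullback_def] c mn(3,1,4,2)])
  moreover obtain c' where "has_lead (fract_eval (pullback S \<eta>)) x (form_order (pullback S \<eta>) x) c'"
    using has_lead_form_order[OF pullback_nonzero[OF S \<eta>]] by blast
  ultimately show ?thesis using has_lead_unique by blast
qed

section \<open>Forms with an invariant divisor\<close>

text \<open>A complex polynomial is the product of its linear factors, up to a constant.\<close>

lemma poly_eq_smult_if_orders_eq:
  fixes p q :: "complex poly"
  assumes "p \<noteq> 0" "q \<noteq> 0" "\<And>z. Polynomial.order z p = Polynomial.order z q"
  obtains k where "k \<noteq> 0" "p = smult k q"
proof -
  have roots: "{z. poly p z = 0} = {z. poly q z = 0}"
    using assms by (simp add: order_root)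
  let ?P = "\<Prod>z|poly q z = 0. [:-z, 1:] ^ Polynomial.order z q"
  have p: "smult (lead_coeff p) ?P = p"
    using complex_poly_decompose[of p] unfolding roots assms(3) .
  have q: "smult (lead_coeff q) ?P = q" by (rule complex_poly_decompose)
  let ?k = "lead_coeff p / lead_coeff q"
  have "smult ?k q = smult ?k (smult (lead_coeff q) ?P)" by (simp only: q)
  also have "\<dots> = smult (lead_coeff p) ?P" using assms(2) by simp
  finally have "p = smult ?k q" using p by simp
  then show ?thesis using that[of ?k] assms by simp
qed

lemma orders_from_form_order:
  assumes "\<eta> \<noteq> 0"
  shows "Polynomial.order z (fnum \<eta>) = nat (form_order \<eta> (Some z))"
    "Polynomial.order z (fden \<eta>) = nat (- form_order \<eta> (Some z))"
proof -
  have nz: "fnum \<eta> \<noteq> 0" "fden \<eta> \<noteq> 0" using assms by simp_all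
  have "Polynomial.order z (fnum \<eta>) = 0 \<or> Polynomial.order z (fden \<eta>) = 0"
  proof (rule ccontr)
    assume "\<not> ?thesis"
    then have "poly (fnum \<eta>) z = 0" "poly (fden \<eta>) z = 0" using nz by (simp_all add: order_root)
    then have "[:-z, 1:] dvd fnum \<eta>" "[:-z, 1:] dvd fden \<eta>" by (simp_all add: poly_eq_0_iff_dvd)
    then have "is_unit [:-z, 1:]" using coprime_quot_of_fract coprime_common_divisor by blast
    then show False by (simp add: is_unit_iff_degree)
  qed
  then show "Polynomial.order z (fnum \<eta>) = nat (form_order \<eta> (Some z))"
    "Polynomial.order z (fden \<eta>) = nat (- form_order \<eta> (Some z))"
    by (auto simp: form_order_def)
qed

text \<open>Since numerator and denominator are coprime, the orders of the form at finite points determine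
  the orders of both polynomials.\<close>

lemma same_divisor_constant_multiple:
  assumes "\<omega> \<noteq> 0" "\<eta> \<noteq> 0" "\<And>x. form_order \<omega> x = form_order \<eta> x"
  obtains k where "k \<noteq> 0" "fract_eval \<omega> \<doteq> (\<lambda>z. k * fract_eval \<eta> z)"
proof -
  have nz: "fnum \<omega> \<noteq> 0" "fden \<omega> \<noteq> 0" "fnum \<eta> \<noteq> 0" "fden \<eta> \<noteq> 0" using assms by simp_all
  obtain k where k: "k \<noteq> 0" "fnum \<omega> = smult k (fnum \<eta>)"
    using poly_eq_smult_if_orders_eq[OF nz(1,3)] orders_from_form_order assms by metis
  obtain l where l: "l \<noteq> 0" "fden \<omega> = smult l (fden \<eta>)"
    using poly_eq_smult_if_orders_eq[OF nz(2,4)] orders_from_form_order assms by metis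
  have "fract_eval \<omega> z = k / l * fract_eval \<eta> z" for z
    unfolding fract_eval_def k(2) l(2) by simp
  then have "fract_eval \<omega> \<doteq> (\<lambda>z. k / l * fract_eval \<eta> z)" by (simp add: almost_all_eq_def)
  then show ?thesis using that[of "k / l"] k l by simp
qed

text \<open>If the pullback is \<open>k\<close> times the form, then the leading coefficient at any fixed point computes \<open>k\<close>
  from the multiplier \<open>\<mu>\<close> and the order of the form there.\<close>

lemma fixed_point_character:
  assumes \<eta>: "\<eta> \<noteq> 0" and S: "S \<in> Moeb"
    and k: "fract_eval (pullback S \<eta>) \<doteq> (\<lambda>z. k * fract_eval \<eta> z)" "k \<noteq> 0"
    and mu: "((\<lambda>z. (fin_part S z - w) / (z - w)) \<longlongrightarrow> \<mu>) (at w)" "\<mu> \<noteq> 0"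
    and nu: "(deriv (fin_part S) \<longlongrightarrow> \<mu>) (at w)"
  shows "k = \<mu> powi (form_order \<eta> (Some w) + 1)"
proof -
  let ?m = "form_order \<eta> (Some w)"
  obtain c where c: "has_lead (fract_eval \<eta>) (Some w) ?m c" using has_lead_form_order[OF \<eta>] by blast
  have "has_lead (fract_eval (pullback S \<eta>)) (Some w) ?m (c * \<mu> * \<mu> powi ?m)"
    by (rule has_lead_pullback[OF pullback_is_pullback[OF S, of \<eta>, unfolded is_pullback_def] c])
      (use mu nu in \<open>simp_all add: lcoord_def dcoord_def pfilter_def\<close>)
  moreover have "has_lead (fract_eval (pullback S \<eta>)) (Some w) ?m (k * c)"
    by (rule has_lead_cong[OF almost_all_eq_sym[OF k(1)] has_lead_scale[OF k(2) c]])
  ultimately have "c * \<mu> * \<mu> powi ?m = k * c" using has_lead_unique by blast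
  then have "c * (\<mu> * \<mu> powi ?m) = c * k" by (simp only: mult.assoc mult.commute[of k])
  then have "c = 0 \<or> \<mu> * \<mu> powi ?m = k" by (simp only: mult_cancel_left)
  moreover have "c \<noteq> 0" using c by (simp add: has_lead_def)
  ultimately show ?thesis using mu(2) by (simp add: power_int_add mult.commute)
qed

lemma dil_character:
  assumes \<eta>: "\<eta> \<noteq> 0" and a: "a \<noteq> 0"
    and k: "fract_eval (pullback (dil a) \<eta>) \<doteq> (\<lambda>z. k * fract_eval \<eta> z)" "k \<noteq> 0"
  shows "k = a powi (form_order \<eta> (Some 0) + 1)"
proof (rule fixed_point_character[OF \<eta> dil_Moeb[OF a] k])
  have f: "fin_part (dil a) = (\<lambda>z. a * z)" by (simp add: fin_part_def fun_eq_iff)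
  have "((\<lambda>z. a) \<longlongrightarrow> a) (at (0::complex))" by (rule tendsto_const)
  moreover have "eventually (\<lambda>z. a = (fin_part (dil a) z - 0) / (z - 0)) (at 0)"
    unfolding f eventually_at_filter by (intro always_eventually) simp
  ultimately show "((\<lambda>z. (fin_part (dil a) z - 0) / (z - 0)) \<longlongrightarrow> a) (at 0)"
    by (rule Lim_transform_eventually)
  have "deriv (\<lambda>z. a * z) z = a" for z
    by (rule DERIV_imp_deriv) (auto intro!: derivative_eq_intros)
  then show "(deriv (fin_part (dil a)) \<longlongrightarrow> a) (at 0)" unfolding f by simp
qed (rule a)

text \<open>A half-turn has multiplier \<open>-1\<close> at its fixed points.\<close>

lemma flip_character:
  assumes \<eta>: "\<eta> \<noteq> 0" and v: "v \<noteq> 0" "v * v = a"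
    and k: "fract_eval (pullback (flip a) \<eta>) \<doteq> (\<lambda>z. k * fract_eval \<eta> z)" "k \<noteq> 0"
  shows "k = (-1) powi (form_order \<eta> (Some v) + 1)"
proof -
  have a: "a \<noteq> 0" using v by auto
  show ?thesis
  proof (rule fixed_point_character[OF \<eta> flip_Moeb[OF a] k])
    have ev: "eventually (\<lambda>z. z \<notin> {0, v}) (at v)"
      using eventually_pfilter_finite[of "{0, v}" "Some v"] by (simp add: pfilter_def)
    have f: "fin_part (flip a) z = a / z" if "z \<noteq> 0" for z using that by (simp add: fin_part_def)
    have "((\<lambda>z. - v / z) \<longlongrightarrow> - v / v) (at v)" using v(1) by (intro tendsto_intros)
    moreover have "eventually (\<lambda>z. - v / z = (fin_part (flip a) z - v) / (z - v)) (at v)"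
      using ev
    proof (rule eventually_mono)
      fix z assume "z \<notin> {0, v}"
      then have z: "z \<noteq> 0" "z - v \<noteq> 0" by auto
      have "a / z - v = (- v * (z - v)) / z" using z(1) v(2) by (simp add: diff_divide_distrib algebra_simps)
      then show "- v / z = (fin_part (flip a) z - v) / (z - v)" using z f by simp
    qed
    ultimately have "((\<lambda>z. (fin_part (flip a) z - v) / (z - v)) \<longlongrightarrow> - v / v) (at v)"
      by (rule Lim_transform_eventually)
    then show "((\<lambda>z. (fin_part (flip a) z - v) / (z - v)) \<longlongrightarrow> - 1) (at v)" using v(1) by simp
    have "((\<lambda>z. - a / (z * z)) \<longlongrightarrow> - a / (v * v)) (at v)" using v(1) by (intro tendsto_intros) auto
    moreover have "eventually (\<lambda>z. - a / (z * z) = deriv (fin_part (flip a)) z) (at v)"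
      using ev
    proof (rule eventually_mono)
      fix z assume "z \<notin> {0, v}"
      then have z: "z \<noteq> 0" by auto
      have "(fin_part (flip a) has_field_derivative - a / (z * z)) (at z)"
      proof (rule has_field_derivative_transform_within_open)
        show "open (- {0::complex})" by (intro open_Compl) simp
        show "((\<lambda>z. a / z) has_field_derivative - a / (z * z)) (at z)"
          using z by (auto intro!: derivative_eq_intros)
      qed (use z f in auto)
      then show "- a / (z * z) = deriv (fin_part (flip a)) z" by (simp add: DERIV_imp_deriv)
    qed
    ultimately have "(deriv (fin_part (flip a)) \<longlongrightarrow> - a / (v * v)) (at v)"
      by (rule Lim_transform_eventually)
    then show "(deriv (fin_part (flip a)) \<longlongrightarrow> - 1) (at v)" using v a by simp
  qed simp
qed

lemma form_invariant_Dih: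
  assumes n: "n > 0"
  shows "form_invariant (Dih n) \<eta> \<longleftrightarrow> (\<forall>h\<in>Dih n. pullback h \<eta> = \<eta>)"
proof -
  have "minv (minv h) = h" if "h \<in> Dih n" for h
    using that Dih_Moeb[OF n] by (auto intro!: inv_inv_eq Moeb_bij)
  then show ?thesis
    unfolding form_invariant_def pushforward_def using Dih_minv[OF n] by metis
qed

text \<open>Only \<open>1\<close> and \<open>-1\<close> have a square equal to \<open>1\<close>, and there are \<open>n \<ge> 3\<close> roots of unity.\<close>

lemma exists_root_order_gt_2:
  assumes "n \<ge> 3"
  obtains a :: complex where "a ^ n = 1" "a \<noteq> 1" "a * a \<noteq> 1"
proof -
  have "\<not> {z::complex. z ^ n = 1} \<subseteq> {1, -1}"
  proof
    assume "{z::complex. z ^ n = 1} \<subseteq> {1, -1}"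
    then have "card {z::complex. z ^ n = 1} \<le> card {1, -1 :: complex}" by (intro card_mono) auto
    also have "card {1, -1 :: complex} \<le> 2" by (simp add: card_insert_if)
    finally show False using card_roots_unity_eq[of n] assms by simp
  qed
  then obtain a :: complex where a: "a ^ n = 1" "a \<noteq> 1" "a \<noteq> -1" by auto
  have "a * a \<noteq> 1"
    using a(2,3) square_eq_1_iff by blast
  then show ?thesis using that a by blast
qed

lemma neg1_powi: "(-1::complex) powi m = 1 \<longleftrightarrow> even m"
  by (auto simp: power_int_def minus_one_power_iff even_nat_iff)

text \<open>For \<open>n \<ge> 2\<close>, the orders at the points fixed by a nontrivial element of \<open>Dih n\<close>: \<open>0\<close> and \<open>\<infinity>\<close> for the rotations, the
  square roots of roots of unity for the half-turns.\<close>

definition dihedral_orders :: "nat \<Rightarrow> rational_form \<Rightarrow> bool" where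
  "dihedral_orders n \<eta> \<longleftrightarrow> form_order \<eta> (Some 0) = -1 \<and> form_order \<eta> None = -1 \<and>
     (\<forall>z. z ^ n = 1 \<or> z ^ n = -1 \<longrightarrow> odd (form_order \<eta> (Some z)))"

text \<open>Invariance forces \<open>a\<^sup>m\<^sup>+\<^sup>1 = 1\<close> for the order \<open>m\<close> at \<open>0\<close> and every root of unity \<open>a\<close>; among \<open>-1, 0, 1\<close> only
  \<open>m = -1\<close> survives a root with \<open>a \<noteq> 1\<close> and \<open>a\<^sup>2 \<noteq> 1\<close>. At the fixed points of half-turns the condition is
  \<open>(-1)\<^sup>m\<^sup>+\<^sup>1 = 1\<close>.\<close>

lemma invariant_imp_orders:
  assumes n: "n \<ge> 3" and \<eta>: "\<eta> \<noteq> 0" and inv: "\<And>h. h \<in> Dih n \<Longrightarrow> pullback h \<eta> = \<eta>"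
    and small: "\<And>x. \<bar>form_order \<eta> x\<bar> \<le> 1"
  shows "\<And>h x. h \<in> Dih n \<Longrightarrow> form_order \<eta> (h x) = form_order \<eta> x"
    and "dihedral_orders n \<eta>"
proof -
  have n0: "n > 0" using n by simp
  show ord: "form_order \<eta> (h x) = form_order \<eta> x" if h: "h \<in> Dih n" for h x
    using form_order_pullback[of h \<eta> x] inv[OF h] Dih_Moeb[OF n0] h \<eta> by auto
  have self: "fract_eval (pullback h \<eta>) \<doteq> (\<lambda>z. 1 * fract_eval \<eta> z)" if "h \<in> Dih n" for h
    unfolding inv[OF that] by (simp add: almost_all_eq_def)
  obtain a :: complex where a: "a ^ n = 1" "a \<noteq> 1" "a * a \<noteq> 1" using exists_root_order_gt_2[OF n] .
  have a0: "a \<noteq> 0" using root_of_unity_nonzero[OF n0 a(1)] .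
  have "1 = a powi (form_order \<eta> (Some 0) + 1)"
    using dil_character[OF \<eta> a0 self[of "dil a"]] a(1) by simp
  moreover have "form_order \<eta> (Some 0) \<in> {-1, 0, 1}" using small[of "Some 0"] by auto
  ultimately have 0: "form_order \<eta> (Some 0) = -1"
    using a(2,3) by (auto simp: power2_eq_square)
  have "form_order \<eta> None = form_order \<eta> (flip 1 None)" using ord[of "flip 1" None] by simp
  then have inf: "form_order \<eta> None = -1" using 0 by simp
  have "odd (form_order \<eta> (Some z))" if z: "z ^ n = 1 \<or> z ^ n = -1" for z
  proof -
    have "z \<noteq> 0" using z n0 by (auto simp: power_0_left)
    moreover have "(z * z) ^ n = 1" using z by (auto simp: power_mult_distrib)
    ultimately have "1 = (-1::complex) powi (form_order \<eta> (Some z) + 1)"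
      using flip_character[OF \<eta> _ refl self[of "flip (z * z)"]] by simp
    then show ?thesis using neg1_powi[of "form_order \<eta> (Some z) + 1"] by simp
  qed
  then show "dihedral_orders n \<eta>" using 0 inf by (simp add: dihedral_orders_def)
qed

text \<open>An invariant divisor makes the pullback a multiple \<open>k\<close> of the form, and a fixed point of \<open>h\<close> shows
  \<open>k = 1\<close>.\<close>

lemma orders_imp_invariant:
  assumes n: "n > 0" and \<eta>: "\<eta> \<noteq> 0"
    and ord: "\<And>h x. h \<in> Dih n \<Longrightarrow> form_order \<eta> (h x) = form_order \<eta> x"
    and fixp: "dihedral_orders n \<eta>" and h: "h \<in> Dih n"
  shows "pullback h \<eta> = \<eta>"
proof -
  have hM: "h \<in> Moeb" using Dih_Moeb[OF n] h by blast
  obtain k where k: "k \<noteq> 0" "fract_eval (pullback h \<eta>) \<doteq> (\<lambda>z. k * fract_eval \<eta> z)"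
    using same_divisor_constant_multiple[OF pullback_nonzero[OF hM \<eta>] \<eta>]
      form_order_pullback[OF hM \<eta>] ord[OF h] by metis
  have "k = 1"
    using h
  proof (rule DihE)
    fix a assume a: "a ^ n = 1" "h = dil a"
    have "k = a powi (form_order \<eta> (Some 0) + 1)"
      by (rule dil_character[OF \<eta> root_of_unity_nonzero[OF n a(1)] k(2)[unfolded a(2)] k(1)])
    then show ?thesis using fixp by (simp add: dihedral_orders_def)
  next
    fix a assume a: "a ^ n = 1" "h = flip a"
    define v where "v = csqrt a"
    have v: "v * v = a" using power2_csqrt[of a] by (simp add: v_def power2_eq_square)
    have v0: "v \<noteq> 0" using root_of_unity_nonzero[OF n a(1)] by (simp add: v_def)
    have "v ^ n * v ^ n = 1" using a(1) v by (simp flip: power_mult_distrib)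
    then have "v ^ n = 1 \<or> v ^ n = -1" using square_eq_1_iff by blast
    then have "odd (form_order \<eta> (Some v))" using fixp unfolding dihedral_orders_def by blast
    moreover have "k = (-1) powi (form_order \<eta> (Some v) + 1)"
      by (rule flip_character[OF \<eta> v0 v k(2)[unfolded a(2)] k(1)])
    ultimately show ?thesis using neg1_powi[of "form_order \<eta> (Some v) + 1"] by simp
  qed
  then show ?thesis using k(2) fract_eval_determines by simp
qed

section \<open>The fundamental region\<close>

lemma cis_eq_1_small:
  assumes "cis x ^ n = 1" "n > 0" "\<bar>x\<bar> < 2 * pi / real n"
  shows "x = 0"
proof -
  have "cis (real n * x) = 1" using assms(1) by (simp add: Complex.DeMoivre)
  then have "cos (real n * x) = 1" by (simp add: complex_eq_iff)
  then obtain k :: int where k: "real n * x = of_int k * 2 * pi" using cos_one_2pi_int by blast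
  have "real n * \<bar>x\<bar> < real n * (2 * pi / real n)" using assms(2,3) by (intro mult_strict_left_mono) auto
  then have "real n * \<bar>x\<bar> < 2 * pi" using assms(2) by simp
  then have "\<bar>real n * x\<bar> < 2 * pi" by (simp add: abs_mult)
  then have "\<bar>of_int k * (2 * pi)\<bar> < 1 * (2 * pi)" using k by (simp add: mult.assoc)
  then have "\<bar>of_int k :: real\<bar> < 1" unfolding abs_mult by simp
  then have "k = 0" by linarith
  then show ?thesis using k assms(2) by simp
qed

text \<open>Meant for \<open>u = a\<close> or \<open>u = b\<close>: the angles of the triangle together with the chosen side.\<close>

definition half_open :: "real \<Rightarrow> real \<Rightarrow> real \<Rightarrow> real set" where
  "half_open a b u = {a<..<b} \<union> {u}"

text \<open>The rotations by multiples of the angle \<open>b - a = 2 \<pi> / n\<close> tile the plane by sectors.\<close>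

lemma sector_exists1:
  fixes a b u :: real and v :: complex
  assumes n: "n > 0" and ab: "b = a + 2 * pi / real n" and u: "u = a \<or> u = b" and v: "v \<noteq> 0"
  shows "\<exists>!\<alpha>. \<alpha> ^ n = 1 \<and> (\<exists>t\<in>half_open a b u. \<alpha> * v = of_real (cmod v) * cis t)"
proof (rule ex_ex1I)
  define w where "w = 2 * pi / real n"
  have w: "w > 0" using n by (simp add: w_def)
  have root: "cis (of_int k * w) ^ n = 1" for k :: int
  proof -
    have "real n * (of_int k * w) = 2 * pi * of_int k" using n by (simp add: w_def)
    then show ?thesis unfolding Complex.DeMoivre by (simp only: cis_multiple_2pi Ints_of_int)
  qed
  have "\<exists>k::int. Arg v + of_int k * w \<in> half_open a b u"
  proof (cases "u = a")
    case True
    define k where "k = \<lceil>(a - Arg v) / w\<rceil>"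
    have "(a - Arg v) / w \<le> of_int k" "of_int k < (a - Arg v) / w + 1" unfolding k_def by linarith+
    then have "a - Arg v \<le> of_int k * w" "of_int k * w < ((a - Arg v) / w + 1) * w"
      using w by (simp_all add: divide_le_eq)
    moreover have "((a - Arg v) / w + 1) * w = a - Arg v + w" using w by (simp add: distrib_right)
    ultimately have "a \<le> Arg v + of_int k * w" "Arg v + of_int k * w < b" using ab by (simp_all add: w_def)
    then show ?thesis unfolding half_open_def True by (intro exI[of _ k]) auto
  next
    case False
    then have ub: "u = b" using u by simp
    define k where "k = \<lfloor>(b - Arg v) / w\<rfloor>"
    have "of_int k \<le> (b - Arg v) / w" "(b - Arg v) / w - 1 < of_int k" unfolding k_def by linarith+
    then have "of_int k * w \<le> b - Arg v" "((b - Arg v) / w - 1) * w < of_int k * w"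
      using w by (simp_all add: le_divide_eq)
    moreover have "((b - Arg v) / w - 1) * w = b - Arg v - w" using w by (simp add: left_diff_distrib)
    ultimately have "a < Arg v + of_int k * w" "Arg v + of_int k * w \<le> b" using ab by (simp_all add: w_def)
    then show ?thesis unfolding half_open_def ub by (intro exI[of _ k]) auto
  qed
  then obtain k :: int where k: "Arg v + of_int k * w \<in> half_open a b u" by blast
  have "cis (of_int k * w) * v = of_real (cmod v) * cis (Arg v + of_int k * w)"
  proof -
    have "v = of_real (cmod v) * cis (Arg v)" using rcis_cmod_Arg[of v] by (simp add: rcis_def)
    then have "cis (of_int k * w) * v = of_real (cmod v) * (cis (Arg v) * cis (of_int k * w))"
      by (metis mult.assoc mult.commute)
    then show ?thesis by (simp only: cis_mult)
  qed
  then show "\<exists>\<alpha>. \<alpha> ^ n = 1 \<and> (\<exists>t\<in>half_open a b u. \<alpha> * v = of_real (cmod v) * cis t)"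
    using root k by blast
next
  fix \<alpha> \<beta> assume A: "\<alpha> ^ n = 1 \<and> (\<exists>t\<in>half_open a b u. \<alpha> * v = of_real (cmod v) * cis t)"
    and B: "\<beta> ^ n = 1 \<and> (\<exists>t\<in>half_open a b u. \<beta> * v = of_real (cmod v) * cis t)"
  obtain s t where s: "s \<in> half_open a b u" "\<alpha> * v = of_real (cmod v) * cis s"
    and t: "t \<in> half_open a b u" "\<beta> * v = of_real (cmod v) * cis t" using A B by blast
  have "2 * pi / real n > 0" using n by simp
  then have st: "\<bar>s - t\<bar> < 2 * pi / real n" using s(1) t(1) u ab unfolding half_open_def by auto
  have b0: "\<beta> \<noteq> 0" by (rule root_of_unity_nonzero[OF n conjunct1[OF B]])
  have "\<alpha> / \<beta> = (\<alpha> * v) / (\<beta> * v)" using v by simp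
  also have "\<dots> = cis s / cis t" unfolding s(2) t(2) using v by simp
  also have "\<dots> = cis (s - t)" by (rule cis_divide)
  finally have q: "\<alpha> / \<beta> = cis (s - t)" .
  have "(\<alpha> / \<beta>) ^ n = 1" unfolding power_divide conjunct1[OF A] conjunct1[OF B] by simp
  then have "s - t = 0" unfolding q using n st by (rule cis_eq_1_small)
  then show "\<alpha> = \<beta>" using q b0 by simp
qed

text \<open>The vertices, edge centers and face centers; for \<open>n \<ge> 2\<close> these are the points with a nontrivial
  stabilizer.\<close>

definition special :: "nat \<Rightarrow> csphere set" where
  "special n = {Some z |z. z ^ n = 1} \<union> {Some z |z. z ^ n = -1} \<union> {Some 0, None}"

text \<open>Off the unit circle the rotations preserve the modulus and the half-turns invert it, so the
  modulus decides which kind of map reaches the chosen face, and the angle then selects one map. On the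
  unit circle both kinds preserve the modulus. The rotations reach the edge from \<open>a\<close> to \<open>b\<close> in one
  point, with angle \<open>t\<close> say, and the half-turns reach it in the mirror image, with angle \<open>a + b - t\<close>; as \<open>t\<close>
  is not the midpoint, exactly one of the two lies in the chosen half \<open>H\<close>.\<close>

lemma region_meets_orbit_once:
  assumes n: "n > 0" and R: "std_fundamental_region n R" and x: "x \<notin> special n"
  shows "\<exists>!h. h \<in> Dih n \<and> h x \<in> R"
proof -
  obtain j a b I c H u w where j: "j < n"
    and a: "a = 2 * pi * real j / real n" and b: "b = 2 * pi * real (j + 1) / real n"
    and Ic: "(I, c) \<in> {({0<..<1}, Some 0), ({1<..}, None)}"
    and H: "H \<in> {{a<..(a + b) / 2}, {(a + b) / 2..<b}}"
    and u: "u \<in> {a, b}" and w: "w \<in> {a, b}"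
    and Req: "R = {Some (rcis r t) |r t. r \<in> I \<and> a < t \<and> t < b} \<union> {Some (cis t) |t. t \<in> H}
       \<union> {Some (rcis r u) |r. r \<in> I} \<union> {Some (cis w), c}"
    using R unfolding std_fundamental_region_def by blast
  obtain z where z: "x = Some z" "z \<noteq> 0" "z ^ n \<noteq> 1" "z ^ n \<noteq> -1"
    using x unfolding special_def by (cases x) auto
  have ab: "b = a + 2 * pi / real n" unfolding a b by (simp add: add_divide_distrib distrib_left)
  have ca: "cis a ^ n = 1" unfolding a using n by (rule cis_power_unit)
  have cb: "cis b ^ n = 1" unfolding b using n by (rule cis_power_unit)
  have cu: "cis u ^ n = 1" "cis w ^ n = 1" using u w ca cb by auto
  have cab: "cis (a + b) ^ n = 1" unfolding cis_mult[symmetric] power_mult_distrib ca cb by simp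
  have mid: "cis ((a + b) / 2) ^ n = -1"
  proof -
    have "(a + b) / 2 = a + pi / real n" unfolding ab by simp
    then have "cis ((a + b) / 2) ^ n = cis a ^ n * cis (pi / real n) ^ n"
      by (simp only: cis_mult[symmetric] power_mult_distrib)
    also have "cis (pi / real n) ^ n = -1" using n by (simp add: Complex.DeMoivre)
    finally show ?thesis using ca by simp
  qed
  let ?J = "half_open a b u"
  have "a < b" unfolding ab using n by simp
  then have mab: "a < (a + b) / 2" "(a + b) / 2 < b" by simp_all
  have HJ: "H \<subseteq> {a<..<b}" using H mab by auto
  have I: "r \<in> I \<Longrightarrow> r > 0 \<and> r \<noteq> 1" "r > 0 \<Longrightarrow> r \<noteq> 1 \<Longrightarrow> r \<in> I \<longleftrightarrow> 1 / r \<notin> I" for r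
    using Ic by auto
  \<comment> \<open>the last two points of \<open>R\<close>, a vertex and a face center, are not met\<close>
  have mem: "Some v \<in> R \<longleftrightarrow> (cmod v \<in> I \<and> (\<exists>t\<in>?J. v = of_real (cmod v) * cis t)) \<or> (\<exists>t\<in>H. v = cis t)"
    if v: "v \<noteq> 0" "v ^ n \<noteq> 1" for v
  proof -
    have "c = Some 0 \<or> c = None" using Ic by auto
    then have "Some v \<noteq> c" "Some v \<noteq> Some (cis w)" using v cu by auto
    moreover have "(\<exists>r t. v = rcis r t \<and> r \<in> I \<and> a < t \<and> t < b) \<longleftrightarrow> cmod v \<in> I \<and> (\<exists>t\<in>{a<..<b}. v = of_real (cmod v) * cis t)"
    proof
      assume "\<exists>r t. v = rcis r t \<and> r \<in> I \<and> a < t \<and> t < b"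
      then obtain r t where rt: "v = rcis r t" "r \<in> I" "a < t" "t < b" by blast
      then have "cmod v = r" using I(1)[of r] by simp
      then show "cmod v \<in> I \<and> (\<exists>t\<in>{a<..<b}. v = of_real (cmod v) * cis t)" using rt by (auto simp: rcis_def)
    next
      assume "cmod v \<in> I \<and> (\<exists>t\<in>{a<..<b}. v = of_real (cmod v) * cis t)"
      then obtain t where "cmod v \<in> I" "a < t" "t < b" "v = rcis (cmod v) t" by (auto simp: rcis_def)
      then show "\<exists>r t. v = rcis r t \<and> r \<in> I \<and> a < t \<and> t < b" by blast
    qed
    moreover have "(\<exists>r. v = rcis r u \<and> r \<in> I) \<longleftrightarrow> cmod v \<in> I \<and> v = of_real (cmod v) * cis u"
    proof
      assume "\<exists>r. v = rcis r u \<and> r \<in> I"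
      then obtain r where rt: "v = rcis r u" "r \<in> I" by blast
      then have "cmod v = r" using I(1)[of r] by simp
      then show "cmod v \<in> I \<and> v = of_real (cmod v) * cis u" using rt by (simp add: rcis_def)
    next
      assume "cmod v \<in> I \<and> v = of_real (cmod v) * cis u"
      then show "\<exists>r. v = rcis r u \<and> r \<in> I" by (intro exI[of _ "cmod v"]) (simp add: rcis_def)
    qed
    ultimately show ?thesis unfolding Req half_open_def by blast
  qed
  let ?in = "\<lambda>\<alpha> v. \<exists>t\<in>?J. \<alpha> * v = of_real (cmod v) * cis t"
  have root0: "\<alpha> \<noteq> 0" if "\<alpha> ^ n = 1" for \<alpha> :: complex using root_of_unity_nonzero[OF n that] .
  have rootn: "cmod \<alpha> = 1" if "\<alpha> ^ n = 1" for \<alpha> :: complex using norm_root_of_unity[OF n that] .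
  have memdil: "dil \<alpha> x \<in> R \<longleftrightarrow> (cmod z \<in> I \<and> (?in \<alpha> z)) \<or> (\<exists>t\<in>H. \<alpha> * z = cis t)"
    if "\<alpha> ^ n = 1" for \<alpha>
  proof -
    have "\<alpha> * z \<noteq> 0" "(\<alpha> * z) ^ n \<noteq> 1" using that root0 z by (auto simp: power_mult_distrib)
    from mem[OF this] show ?thesis using rootn[OF that] by (simp add: z(1) norm_mult)
  qed
  have memflip: "flip \<alpha> x \<in> R \<longleftrightarrow> (1 / cmod z \<in> I \<and> (?in \<alpha> (1 / z))) \<or> (\<exists>t\<in>H. \<alpha> * (1 / z) = cis t)"
    if "\<alpha> ^ n = 1" for \<alpha>
  proof -
    have "\<alpha> / z \<noteq> 0" "(\<alpha> / z) ^ n \<noteq> 1" using that root0 z by (auto simp: power_divide)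
    from mem[OF this] show ?thesis using rootn[OF that] z(2) by (simp add: z(1) norm_divide)
  qed
  note sec = sector_exists1[OF n ab, of u]
  have u': "u = a \<or> u = b" using u by auto
  have onH: "cmod z = 1" if "\<alpha> ^ n = 1" "\<alpha> * z = cis t \<or> \<alpha> * (1 / z) = cis t" for \<alpha> t
  proof -
    have "cmod (\<alpha> * z) = 1 \<or> cmod (\<alpha> * (1 / z)) = 1" using that(2) by auto
    then show ?thesis using rootn[OF that(1)] by (auto simp: norm_mult norm_divide)
  qed
  show ?thesis
  proof (cases "cmod z = 1")
    case False
    have nH: "\<not> (\<exists>t\<in>H. \<alpha> * z = cis t)" "\<not> (\<exists>t\<in>H. \<alpha> * (1 / z) = cis t)" if "\<alpha> ^ n = 1" for \<alpha>
      using onH[OF that] False by blast+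
    have zpos: "cmod z > 0" using z by simp
    show ?thesis
    proof (cases "cmod z \<in> I")
      case True
      then have nI: "1 / cmod z \<notin> I" using I(2)[OF zpos False] by simp
      obtain \<alpha> where \<alpha>: "\<alpha> ^ n = 1" "?in \<alpha> z"
        and un: "\<And>\<beta>. \<beta> ^ n = 1 \<Longrightarrow> ?in \<beta> z \<Longrightarrow> \<beta> = \<alpha>"
        using sec[OF u' z(2)] by (elim ex1E) blast
      show ?thesis
      proof (rule ex1I[of _ "dil \<alpha>"])
        show "dil \<alpha> \<in> Dih n \<and> dil \<alpha> x \<in> R" using \<alpha> memdil True by simp
        fix h assume h: "h \<in> Dih n \<and> h x \<in> R"
        then have "h \<in> Dih n" by blast
        then show "h = dil \<alpha>"
        proof (rule DihE)
          fix \<beta> assume \<beta>: "\<beta> ^ n = 1" "h = dil \<beta>"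
          then have "?in \<beta> z" using h memdil[OF \<beta>(1)] nH[OF \<beta>(1)] by blast
          then show ?thesis using un \<beta> by simp
        next
          fix \<beta> assume \<beta>: "\<beta> ^ n = 1" "h = flip \<beta>"
          then show ?thesis using h memflip[OF \<beta>(1)] nH[OF \<beta>(1)] nI by blast
        qed
      qed
    next
      case nI: False
      then have i1: "1 / cmod z \<in> I" using I(2)[OF zpos False] by simp
      have z1: "1 / z \<noteq> 0" using z by simp
      obtain \<alpha> where \<alpha>: "\<alpha> ^ n = 1" "?in \<alpha> (1 / z)"
        and un: "\<And>\<beta>. \<beta> ^ n = 1 \<Longrightarrow> ?in \<beta> (1 / z) \<Longrightarrow> \<beta> = \<alpha>"
        using sec[OF u' z1] by (elim ex1E) blast
      show ?thesis
      proof (rule ex1I[of _ "flip \<alpha>"])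
        show "flip \<alpha> \<in> Dih n \<and> flip \<alpha> x \<in> R" unfolding memflip[OF \<alpha>(1)] using \<alpha> i1 by simp
        fix h assume h: "h \<in> Dih n \<and> h x \<in> R"
        then have "h \<in> Dih n" by blast
        then show "h = flip \<alpha>"
        proof (rule DihE)
          fix \<beta> assume \<beta>: "\<beta> ^ n = 1" "h = flip \<beta>"
          then have "?in \<beta> (1 / z)" using h memflip[OF \<beta>(1)] nH[OF \<beta>(1)] by blast
          then show ?thesis using un \<beta> by simp
        next
          fix \<beta> assume \<beta>: "\<beta> ^ n = 1" "h = dil \<beta>"
          then show ?thesis using h memdil[OF \<beta>(1)] nH[OF \<beta>(1)] nI by blast
        qed
      qed
    qed
  next
    case True
    have nI: "cmod z \<notin> I" "1 / cmod z \<notin> I" using True I(1) by auto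
    have HH: "t \<in> ?J" if "t \<in> H" for t using that HJ unfolding half_open_def by blast
    obtain \<alpha> t where \<alpha>: "\<alpha> ^ n = 1" "t \<in> ?J" "\<alpha> * z = cis t"
      and un: "\<And>\<beta> s. \<beta> ^ n = 1 \<Longrightarrow> s \<in> ?J \<Longrightarrow> \<beta> * z = cis s \<Longrightarrow> \<beta> = \<alpha>"
      using sec[OF u' z(2)] unfolding True by (elim ex1E) auto
    have un': "\<beta> = \<gamma>" if "\<beta> ^ n = 1" "\<gamma> ^ n = 1" "s \<in> ?J" "s' \<in> ?J" "\<beta> * (1 / z) = cis s" "\<gamma> * (1 / z) = cis s'" for \<beta> \<gamma> s s'
    proof -
      have z1: "1 / z \<noteq> 0" using z by simp
      have "cmod (1 / z) = 1" using True by (simp add: norm_divide)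
      then show ?thesis using sec[OF u' z1] that by (elim ex1E) (metis mult_1 of_real_1)
    qed
    \<comment> \<open>the sum of two such angles would be congruent to \<open>a + b\<close> modulo \<open>2 \<pi> / n\<close>, and on one side of the
      midpoint there is no room for that\<close>
    have excl: False if "\<beta> ^ n = 1" "\<gamma> ^ n = 1" "s \<in> H" "s' \<in> H" "\<beta> * z = cis s" "\<gamma> * (1 / z) = cis s'" for \<beta> \<gamma> s s'
    proof -
      have prod: "\<beta> * \<gamma> = cis (s + s')"
      proof -
        have "\<beta> * \<gamma> = (\<beta> * z) * (\<gamma> * (1 / z))" using z by simp
        then show ?thesis unfolding that(5,6) cis_mult .
      qed
      have "cis (s + s' - (a + b)) = \<beta> * \<gamma> / cis (a + b)" unfolding prod cis_divide ..
      then have r: "cis (s + s' - (a + b)) ^ n = 1"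
        unfolding power_divide power_mult_distrib using that(1,2) cab by (simp add: power_divide power_mult_distrib)
      have sm: "s \<noteq> (a + b) / 2"
      proof
        assume s: "s = (a + b) / 2"
        have "(\<beta> * z) ^ n = -1" unfolding that(5) s by (rule mid)
        then show False using that(1) z(4) by (simp add: power_mult_distrib)
      qed
      have "\<bar>s + s' - (a + b)\<bar> < 2 * pi / real n"
        using H that(3,4) ab sm by auto
      then have "s + s' - (a + b) = 0" using cis_eq_1_small[OF r n] by blast
      then show False using H that(3,4) sm by auto
    qed
    have tu: "t \<noteq> u" "t \<noteq> (a + b) / 2"
    proof -
      have "cis t ^ n = z ^ n" unfolding \<alpha>(3)[symmetric] using \<alpha>(1) by (simp add: power_mult_distrib)
      then show "t \<noteq> u" "t \<noteq> (a + b) / 2" using z(3,4) cu(1) mid by metis+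
    qed
    then have tab: "a < t" "t < b" using \<alpha>(2) unfolding half_open_def by auto
    have uniq: "h = h'" if "h \<in> Dih n" "h x \<in> R" "h' \<in> Dih n" "h' x \<in> R" for h h'
    proof (rule DihE[OF that(1)]; rule DihE[OF that(3)])
      fix \<beta> \<gamma> assume bg: "\<beta> ^ n = 1" "h = dil \<beta>" "\<gamma> ^ n = 1" "h' = dil \<gamma>"
      have "\<exists>s\<in>H. \<beta> * z = cis s" "\<exists>s\<in>H. \<gamma> * z = cis s"
        using that(2,4) memdil[OF bg(1)] memdil[OF bg(3)] nI bg by auto
      then obtain s s' where s: "s \<in> H" "\<beta> * z = cis s" "s' \<in> H" "\<gamma> * z = cis s'" by blast
      show ?thesis using un[OF bg(1) HH[OF s(1)] s(2)] un[OF bg(3) HH[OF s(3)] s(4)] bg by simp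
    next
      fix \<beta> \<gamma> assume bg: "\<beta> ^ n = 1" "h = dil \<beta>" "\<gamma> ^ n = 1" "h' = flip \<gamma>"
      have "\<exists>s\<in>H. \<beta> * z = cis s" "\<exists>s\<in>H. \<gamma> * (1 / z) = cis s"
        using that(2,4) memdil[OF bg(1)] memflip[OF bg(3)] nI bg by auto
      then show ?thesis using excl[OF bg(1,3)] by blast
    next
      fix \<beta> \<gamma> assume bg: "\<beta> ^ n = 1" "h = flip \<beta>" "\<gamma> ^ n = 1" "h' = dil \<gamma>"
      have "\<exists>s\<in>H. \<gamma> * z = cis s" "\<exists>s\<in>H. \<beta> * (1 / z) = cis s"
        using that(2,4) memdil[OF bg(3)] memflip[OF bg(1)] nI bg by auto
      then show ?thesis using excl[OF bg(3,1)] by blast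
    next
      fix \<beta> \<gamma> assume bg: "\<beta> ^ n = 1" "h = flip \<beta>" "\<gamma> ^ n = 1" "h' = flip \<gamma>"
      have "\<exists>s\<in>H. \<beta> * (1 / z) = cis s" "\<exists>s\<in>H. \<gamma> * (1 / z) = cis s"
        using that(2,4) memflip[OF bg(1)] memflip[OF bg(3)] nI bg by auto
      then obtain s s' where s: "s \<in> H" "\<beta> * (1 / z) = cis s" "s' \<in> H" "\<gamma> * (1 / z) = cis s'" by blast
      show ?thesis using un'[OF bg(1,3) HH[OF s(1)] HH[OF s(3)] s(2,4)] bg by simp
    qed
    have "\<exists>h. h \<in> Dih n \<and> h x \<in> R"
    proof (cases "t \<in> H")
      case True
      then have "dil \<alpha> \<in> Dih n \<and> dil \<alpha> x \<in> R" using memdil[OF \<alpha>(1)] \<alpha> by auto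
      then show ?thesis by blast
    next
      case False
      define \<beta> where "\<beta> = cis (a + b) / \<alpha>"
      have \<beta>: "\<beta> ^ n = 1" using cab \<alpha>(1) by (simp add: \<beta>_def power_divide)
      have "\<beta> * (1 / z) = cis (a + b) / (\<alpha> * z)" by (simp add: \<beta>_def)
      also have "\<dots> = cis (a + b - t)" unfolding \<alpha>(3) by (rule cis_divide)
      finally have "\<beta> * (1 / z) = cis (a + b - t)" .
      moreover have "a + b - t \<in> H" using H False tab tu(2) by auto
      ultimately have "flip \<beta> x \<in> R" using memflip[OF \<beta>] by blast
      then show ?thesis using \<beta> by (intro exI[of _ "flip \<beta>"]) simp
    qed
    then show ?thesis using uniq by blast
  qed
qed

lemma special_invariant:
  assumes n: "n > 0" and h: "h \<in> Dih n" and x: "h x \<in> special n"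
  shows "x \<in> special n"
proof -
  have sp: "special n = vertices (std_dihedron n) \<union> edge_centers (std_dihedron n) \<union> face_centers (std_dihedron n)"
    using n by (simp add: special_def)
  have "minv h (h x) \<in> special n"
    using Dih_maps_parts(1-3)[OF n Dih_minv[OF n h]] x unfolding sp by blast
  moreover have "h \<in> Moeb" using Dih_Moeb[OF n] h by blast
  ultimately show ?thesis using Moeb_bij by (simp add: bij_is_inj)
qed

text \<open>The group acts freely outside the special orbits, so an invariant finite set consists there of
  \<open>2 n\<close> copies of its part in the fundamental region.\<close>

lemma card_invariant_set:
  assumes n: "n > 0" and R: "std_fundamental_region n R"
    and S: "finite S" "\<And>h x. h \<in> Dih n \<Longrightarrow> h x \<in> S \<longleftrightarrow> x \<in> S"
  shows "card (S - special n) = 2 * n * card (S \<inter> (R - special n))"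
proof -
  let ?S = "S - special n" and ?Q = "S \<inter> (R - special n)"
  let ?P = "\<lambda>h. {x \<in> ?S. h x \<in> R}"
  have hM: "h \<in> Moeb" if "h \<in> Dih n" for h using Dih_Moeb[OF n] that by blast
  have once: "\<exists>!h. h \<in> Dih n \<and> h x \<in> R" if "x \<in> ?S" for x
    using region_meets_orbit_once[OF n R, of x] that by blast
  have un: "?S = (\<Union>h\<in>Dih n. ?P h)"
  proof
    show "?S \<subseteq> (\<Union>h\<in>Dih n. ?P h)"
    proof
      fix x assume x: "x \<in> ?S"
      obtain h where "h \<in> Dih n" "h x \<in> R" using ex1_implies_ex[OF once[OF x]] by blast
      then show "x \<in> (\<Union>h\<in>Dih n. ?P h)" using x by (intro UN_I[of h]) simp_all
    qed
  qed blast
  have disj: "?P h \<inter> ?P g = {}" if "h \<in> Dih n" "g \<in> Dih n" "h \<noteq> g" for h g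
  proof -
    have "h = g" if x: "x \<in> ?P h \<inter> ?P g" for x
    proof -
      have "x \<in> ?S" "h x \<in> R" "g x \<in> R" using x by blast+
      then show "h = g" using once \<open>h \<in> Dih n\<close> \<open>g \<in> Dih n\<close> by (metis (no_types, lifting))
    qed
    then show ?thesis using \<open>h \<noteq> g\<close> by blast
  qed
  have card1: "card (?P h) = card ?Q" if h: "h \<in> Dih n" for h
  proof (rule bij_betw_same_card[of h])
    have inj: "inj h" using hM[OF h] Moeb_bij bij_is_inj by blast
    show "bij_betw h (?P h) ?Q"
      unfolding bij_betw_def
    proof
      show "inj_on h (?P h)" using inj by (rule inj_on_subset) simp
      show "h ` ?P h = ?Q"
      proof
        show "h ` ?P h \<subseteq> ?Q" using S(2)[OF h] special_invariant[OF n h] by blast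
        show "?Q \<subseteq> h ` ?P h"
        proof
          fix y assume y: "y \<in> ?Q"
          let ?x = "minv h y"
          have hx: "h ?x = y" by (rule surj_f_inv_f[OF bij_is_surj[OF Moeb_bij[OF hM[OF h]]]])
          have "?x \<in> S" using S(2)[OF h, of ?x] hx y by simp
          moreover have "?x \<notin> special n"
            using special_invariant[OF n Dih_minv[OF n h], of y] y by blast
          ultimately show "y \<in> h ` ?P h" using hx y by (intro image_eqI[of _ _ ?x]) auto
        qed
      qed
    qed
  qed
  have "card ?S = card (\<Union>h\<in>Dih n. ?P h)" by (rule arg_cong[OF un])
  also have "\<dots> = (\<Sum>h\<in>Dih n. card (?P h))"
  proof (rule card_UN_disjoint)
    show "finite (Dih n)" by (rule card_Dih(2)[OF n])
    show "\<forall>h\<in>Dih n. finite (?P h)" using S(1) by simp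
    show "\<forall>h\<in>Dih n. \<forall>g\<in>Dih n. h \<noteq> g \<longrightarrow> ?P h \<inter> ?P g = {}" using disj by blast
  qed
  also have "\<dots> = 2 * n * card ?Q" using card1 card_Dih(1)[OF n] by simp
  finally show ?thesis .
qed

section \<open>Counting poles and zeros\<close>

lemma form_isotropy_iff: "T \<in> form_isotropy \<eta> \<longleftrightarrow> T \<in> Moeb \<and> pullback T \<eta> = \<eta>"
proof -
  have "pushforward T \<eta> = \<eta> \<longleftrightarrow> pullback T \<eta> = \<eta>" if T: "T \<in> Moeb"
    unfolding pushforward_def using pullback_inverse[OF T, of \<eta>] by auto
  then show ?thesis by (auto simp: form_isotropy_def)
qed

lemma form_invariant_iff_isotropy:
  "H \<subseteq> Moeb \<Longrightarrow> form_invariant H \<eta> \<longleftrightarrow> H \<subseteq> form_isotropy \<eta>"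
  unfolding form_invariant_def form_isotropy_def by auto

lemma form_isotropy_comp:
  "S \<in> form_isotropy \<eta> \<Longrightarrow> T \<in> form_isotropy \<eta> \<Longrightarrow> S \<circ> T \<in> form_isotropy \<eta>"
  by (simp add: form_isotropy_iff pullback_comp Moeb_comp)

lemma form_isotropy_minv: "T \<in> form_isotropy \<eta> \<Longrightarrow> minv T \<in> form_isotropy \<eta>"
  using pullback_inverse(1)[of T \<eta>] by (simp add: form_isotropy_iff Moeb_inv)

lemma finite_form_zeros_poles:
  assumes "\<eta> \<noteq> 0"
  shows "finite (form_poles \<eta>)" "finite (form_zeros \<eta>)"
proof -
  have nz: "fnum \<eta> \<noteq> 0" "fden \<eta> \<noteq> 0" using assms by simp_all
  have pole: "x \<in> insert None (Some ` {z. poly (fden \<eta>) z = 0})" if "form_order \<eta> x < 0" for x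
    using that nz by (cases x) (auto simp: form_order_def order_root image_iff)
  have zero: "x \<in> insert None (Some ` {z. poly (fnum \<eta>) z = 0})" if "form_order \<eta> x > 0" for x
    using that nz by (cases x) (auto simp: form_order_def order_root image_iff)
  have "form_poles \<eta> \<subseteq> insert None (Some ` {z. poly (fden \<eta>) z = 0})"
    using pole unfolding form_poles_def by blast
  then show "finite (form_poles \<eta>)"
    by (rule finite_subset) (intro finite.insertI finite_imageI poly_roots_finite nz)
  have "form_zeros \<eta> \<subseteq> insert None (Some ` {z. poly (fnum \<eta>) z = 0})"
    using zero unfolding form_zeros_def by blast
  then show "finite (form_zeros \<eta>)"
    by (rule finite_subset) (intro finite.insertI finite_imageI poly_roots_finite nz)
qed

lemma simple_order_bound: "simple_poles_and_zeros \<eta> \<Longrightarrow> \<bar>form_order \<eta> x\<bar> \<le> 1"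
  unfolding simple_poles_and_zeros_def form_poles_def form_zeros_def
  by (cases "form_order \<eta> x" "0 :: int" rule: linorder_cases) auto

lemma card_conj_by:
  assumes "T \<in> Moeb"
  shows "card (conj_by T H) = card H"
proof -
  have "conj_by T H = (\<lambda>h. T \<circ> h \<circ> minv T) ` H" by (auto simp: conj_by_def)
  moreover have "inj_on (\<lambda>h. T \<circ> h \<circ> minv T) H"
    using conj_cancel[OF assms] by (intro inj_onI)
  ultimately show ?thesis by (simp add: card_image)
qed

lemma half_root: "n > 0 \<Longrightarrow> cis (pi / real n) ^ n = -1"
  by (simp add: Complex.DeMoivre)

lemma card_special_parts:
  assumes n: "n > 0"
  shows "card {Some z |z::complex. z ^ n = 1} = n" "card {Some z |z::complex. z ^ n = -1} = n"
    "finite {Some z |z::complex. z ^ n = 1}" "finite {Some z |z::complex. z ^ n = -1}"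
proof -
  let ?e = "cis (pi / real n)"
  have e: "?e ^ n = -1" using half_root[OF n] .
  have V: "{Some z |z::complex. z ^ n = 1} = Some ` {z. z ^ n = 1}" by auto
  have E: "{Some z |z::complex. z ^ n = -1} = (\<lambda>z. Some (?e * z)) ` {z. z ^ n = 1}"
  proof (intro equalityI subsetI)
    fix x assume "x \<in> {Some z |z::complex. z ^ n = -1}"
    then obtain z where z: "x = Some z" "z ^ n = -1" by blast
    have "(z / ?e) ^ n = 1" unfolding power_divide z(2) e by simp
    moreover have "x = Some (?e * (z / ?e))" using z by simp
    ultimately show "x \<in> (\<lambda>z. Some (?e * z)) ` {z. z ^ n = 1}" by blast
  next
    fix x assume "x \<in> (\<lambda>z. Some (?e * z)) ` {z. z ^ n = 1}"
    then obtain z where z: "x = Some (?e * z)" "z ^ n = 1" by blast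
    have "(?e * z) ^ n = -1" unfolding power_mult_distrib z(2) e by simp
    then show "x \<in> {Some z |z::complex. z ^ n = -1}" using z by blast
  qed
  have c: "card {z::complex. z ^ n = 1} = n" "finite {z::complex. z ^ n = 1}"
    using card_roots_unity_eq[of n] finite_roots_unity[of n] n by auto
  show "card {Some z |z::complex. z ^ n = 1} = n" unfolding V using c by (simp add: card_image)
  show "finite {Some z |z::complex. z ^ n = 1}" unfolding V using c by simp
  show "card {Some z |z::complex. z ^ n = -1} = n" unfolding E using c by (simp add: card_image inj_on_def)
  show "finite {Some z |z::complex. z ^ n = -1}" unfolding E using c by simp
qed

lemma invariant_count:
  assumes n: "n > 0" and R: "std_fundamental_region n R"
    and S: "finite S" "\<And>h x. h \<in> Dih n \<Longrightarrow> h x \<in> S \<longleftrightarrow> x \<in> S"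
    and B: "S \<inter> special n = B"
  shows "card S = 2 * n * card (S \<inter> (R - special n)) + card B"
proof -
  have "card S = card (S - special n) + card (S \<inter> special n)"
    using S(1) by (metis card_Int_Diff add.commute)
  moreover have "card (S - special n) = 2 * n * card (S \<inter> (R - special n))"
    by (rule card_invariant_set[OF n R S(1)]) (rule S(2))
  ultimately show ?thesis using B by simp
qed

text \<open>The vertices form one orbit and the edge centers another one, so each of these sets consists of
  poles or of zeros. This gives four combinations; \<open>choice\<close> excludes that the vertices are zeros and
  the edge centers are poles. The number of zeros in the region follows by comparing the counts of
  all poles and of all zeros with \<open>k\<close> and \<open>k - 2\<close>.\<close>

lemma invariant_imp_case:
  assumes n: "n \<ge> 3" and T: "T \<in> Moeb" and \<eta>: "\<eta> \<noteq> 0" and simple: "simple_poles_and_zeros \<eta>"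
    and k: "card (form_poles \<eta>) = k" "int (card (form_zeros \<eta>)) = int k - 2"
    and inv: "form_invariant (conj_by T (Dih n)) \<eta>"
    and A: "A = map_dihedron T (std_dihedron n)"
    and R: "std_fundamental_region n R"
    and Q: "Q = T ` R - (vertices A \<union> edge_centers A \<union> face_centers A)"
    and choice: "vertices A \<subseteq> form_poles \<eta> \<or> edge_centers A \<subseteq> form_zeros \<eta>"
  shows "case_A \<eta> k (conj_by T (Dih n)) A Q \<or> case_B \<eta> k (conj_by T (Dih n)) A Q"
proof -
  have n0: "n > 0" using n by simp
  let ?\<theta> = "pullback T \<eta>"
  let ?V = "{Some z |z::complex. z ^ n = 1}" and ?E = "{Some z |z::complex. z ^ n = -1}"
    and ?F = "{Some 0, None} :: csphere set"
  let ?P = "form_poles ?\<theta>" and ?Z = "form_zeros ?\<theta>"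
  let ?o = "form_order ?\<theta>"
  have ordT: "?o x = form_order \<eta> (T x)" for x using form_order_pullback[OF T \<eta>] .
  have \<theta>: "?\<theta> \<noteq> 0" using pullback_nonzero[OF T \<eta>] .
  have small: "\<bar>?o x\<bar> \<le> 1" for x unfolding ordT using simple_order_bound[OF simple] .
  have injT: "inj T" and surjT: "surj T" using Moeb_bij[OF T] by (auto simp: bij_is_inj bij_is_surj)
  have inv\<theta>: "pullback h ?\<theta> = ?\<theta>" if "h \<in> Dih n" for h
    using inv that unfolding form_invariant_conj[OF T Dih_Moeb[OF n0]] form_invariant_Dih[OF n0] by blast
  have ord: "?o (h x) = ?o x" if "h \<in> Dih n" for h x
    by (rule invariant_imp_orders(1)[OF n \<theta> inv\<theta> small that])
  have axis: "dihedral_orders n ?\<theta>" by (rule invariant_imp_orders(2)[OF n \<theta> inv\<theta> small])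
  have F: "?o x = -1" if "x \<in> ?F" for x
    using axis that unfolding dihedral_orders_def by auto
  define e where "e = cis (pi / real n)"
  have e: "e ^ n = -1" using half_root[OF n0] by (simp add: e_def)
  have e0: "e \<noteq> 0" by (simp add: e_def)
  have pm: "?o x = 1 \<or> ?o x = -1" if "odd (?o x)" for x
    using that small[of x] by (cases "?o x = 0") auto
  have V: "?o x = ?o (Some 1)" if x: "x \<in> ?V" for x
  proof -
    obtain z where z: "x = Some z" "z ^ n = 1" using x by blast
    then show ?thesis using ord[of "dil z" "Some 1"] by simp
  qed
  have E: "?o x = ?o (Some e)" if x: "x \<in> ?E" for x
  proof -
    obtain z where z: "x = Some z" "z ^ n = -1" using x by blast
    have "(z / e) ^ n = 1" unfolding power_divide z(2) e by simp
    then show ?thesis using ord[of "dil (z / e)" "Some e"] z(1) e0 by simp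
  qed
  have v1: "?o (Some 1) = 1 \<or> ?o (Some 1) = -1"
    using axis by (intro pm) (simp add: dihedral_orders_def)
  have e1: "?o (Some e) = 1 \<or> ?o (Some e) = -1"
    using axis e by (intro pm) (simp add: dihedral_orders_def)
  have parts: "vertices A = T ` ?V" "edge_centers A = T ` ?E" "face_centers A = T ` ?F"
    unfolding A using n0 by simp_all
  have TP: "T ` X \<subseteq> form_poles \<eta> \<longleftrightarrow> X \<subseteq> ?P" and TZ: "T ` X \<subseteq> form_zeros \<eta> \<longleftrightarrow> X \<subseteq> ?Z" for X
    unfolding form_poles_def form_zeros_def ordT by auto
  have cardT: "card (T ` X) = card X" for X
    by (rule card_image[OF inj_on_subset[OF injT subset_UNIV]])
  have preim: "{y. p y} = T ` {x. p (T x)}" for p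
  proof (intro equalityI subsetI)
    fix y assume y: "y \<in> {y. p y}"
    obtain x where "y = T x" using surjT by (rule surjE)
    then show "y \<in> T ` {x. p (T x)}" using y by blast
  qed auto
  have imT: "form_poles \<eta> = T ` ?P" "form_zeros \<eta> = T ` ?Z"
    unfolding form_poles_def form_zeros_def ordT by (rule preim)+
  have Q': "Q = T ` (R - special n)"
    unfolding Q parts special_def image_set_diff[OF injT] image_Un ..
  have QP: "card (form_poles \<eta> \<inter> Q) = card (?P \<inter> (R - special n))"
    unfolding imT(1) Q' image_Int[OF injT, symmetric] cardT ..
  have QZ: "card (form_zeros \<eta> \<inter> Q) = card (?Z \<inter> (R - special n))"
    unfolding imT(2) Q' image_Int[OF injT, symmetric] cardT ..
  have cP: "card ?P = k" and cZ: "int (card ?Z) = int k - 2"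
    using k unfolding imT cardT by simp_all
  have cG: "card (conj_by T (Dih n)) = 2 * n"
    using card_conj_by[OF T] card_Dih[OF n0] by simp
  have cV: "card ?V = n" "finite ?V" and cE: "card ?E = n" "finite ?E"
    using card_special_parts[OF n0] by auto
  have cF: "card ?F = 2" by simp
  have disj: "?V \<inter> ?E = {}" "?V \<inter> ?F = {}" "?E \<inter> ?F = {}" "(?V \<union> ?E) \<inter> ?F = {}"
    using n0 by (auto simp: power_0_left)
  have cVF: "card (?V \<union> ?F) = n + 2" and cVE: "card (?V \<union> ?E) = 2 * n"
    and cVEF: "card (?V \<union> ?E \<union> ?F) = 2 * n + 2"
    using disj cV cE cF by (simp_all only: card_Un_disjoint finite_Un finite.emptyI finite.insertI)
  have invP: "h x \<in> ?P \<longleftrightarrow> x \<in> ?P" and invZ: "h x \<in> ?Z \<longleftrightarrow> x \<in> ?Z" if "h \<in> Dih n" for h x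
    unfolding form_poles_def form_zeros_def using ord[OF that] by simp_all
  have countP: "card ?P = 2 * n * card (?P \<inter> (R - special n)) + card B" if "?P \<inter> special n = B" for B
    by (rule invariant_count[OF n0 R finite_form_zeros_poles(1)[OF \<theta>] _ that]) (rule invP)
  have countZ: "card ?Z = 2 * n * card (?Z \<inter> (R - special n)) + card B" if "?Z \<inter> special n = B" for B
    by (rule invariant_count[OF n0 R finite_form_zeros_poles(2)[OF \<theta>] _ that]) (rule invZ)
  have inP: "x \<in> ?P \<longleftrightarrow> ?o x < 0" and inZ: "x \<in> ?Z \<longleftrightarrow> ?o x > 0" for x
    by (simp_all add: form_poles_def form_zeros_def)
  have FP: "?F \<subseteq> ?P" and FZ: "?Z \<inter> ?F = {}" using F by (auto simp: inP inZ)
  have VPI: "?V \<subseteq> ?P" "?Z \<inter> ?V = {}" if "?o (Some 1) = -1"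
    using V that by (auto simp: inP inZ)
  have VZI: "?V \<subseteq> ?Z" "?P \<inter> ?V = {}" if "?o (Some 1) = 1"
    using V that by (auto simp: inP inZ)
  have EPI: "?E \<subseteq> ?P" "?Z \<inter> ?E = {}" if "?o (Some e) = -1"
    using E that by (auto simp: inP inZ)
  have EZI: "?E \<subseteq> ?Z" "?P \<inter> ?E = {}" if "?o (Some e) = 1"
    using E that by (auto simp: inP inZ)
  let ?p = "card (?P \<inter> (R - special n))" and ?z = "card (?Z \<inter> (R - special n))"
  have cancel: "int ?z = int ?p + d" if "int n * int ?z = int n * (int ?p + d)" for d
    using that n0 by simp
  have sp: "S \<inter> special n = (S \<inter> ?V) \<union> (S \<inter> ?E) \<union> (S \<inter> ?F)" for S
    unfolding special_def by blast
  consider "?o (Some 1) = -1" "?o (Some e) = 1"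
    | "?o (Some 1) = -1" "?o (Some e) = -1"
    | "?o (Some 1) = 1" "?o (Some e) = 1"
    | "?o (Some 1) = 1" "?o (Some e) = -1"
    using v1 e1 by blast
  then show ?thesis
  proof cases
    case 1
    note VP = VPI[OF 1(1)] and EZ = EZI[OF 1(2)]
    have "?P \<inter> special n = ?V \<union> ?F"
      unfolding sp Int_absorb1[OF VP(1)] EZ(2) Int_absorb1[OF FP] by (simp only: Un_empty_right)
    then have p: "k = ?p * (2 * n) + n + 2" using countP cVF cP by simp
    have "?Z \<inter> special n = ?E"
      unfolding sp VP(2) Int_absorb1[OF EZ(1)] FZ by (simp only: Un_empty_right Un_empty_left)
    then have "card ?Z = 2 * n * ?z + n" using countZ cE by simp
    then have "int n * int ?z = int n * (int ?p + 0)" using p cZ by simp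
    from cancel[OF this] have z: "?z = ?p" by simp
    have "case_A \<eta> k (conj_by T (Dih n)) A Q"
      unfolding case_A_def parts QP QZ cG cardT cV(1) cE(1) cF
      by (intro conjI disjI1 exI[of _ ?p] Un_least refl z p TP[THEN iffD2] TZ[THEN iffD2] VP(1) EZ(1) FP)
    then show ?thesis ..
  next
    case 2
    note VP = VPI[OF 2(1)] and EP = EPI[OF 2(2)]
    have "?P \<inter> special n = ?V \<union> ?E \<union> ?F"
      unfolding sp Int_absorb1[OF VP(1)] Int_absorb1[OF EP(1)] Int_absorb1[OF FP] ..
    then have p: "k = ?p * (2 * n) + n + 2 + n" using countP cVEF cP by simp
    have "?Z \<inter> special n = {}"
      unfolding sp VP(2) EP(2) FZ by (simp only: Un_empty_right)
    then have "card ?Z = 2 * n * ?z" using countZ by simp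
    then have "int k - 2 = 2 * (int n * int ?z)" using cZ by simp
    moreover have "int k = 2 * (int n * int ?p) + 2 * int n + 2" using p by simp
    ultimately have "int n * int ?z = int n * (int ?p + 1)" by (simp add: distrib_left)
    from cancel[OF this] have z: "?z = ?p + 1" by simp
    have "case_A \<eta> k (conj_by T (Dih n)) A Q"
      unfolding case_A_def parts QP QZ cG cardT cV(1) cE(1) cF
      by (intro conjI disjI2 exI[of _ ?p] Un_least refl z p TP[THEN iffD2] VP(1) EP(1) FP)
    then show ?thesis ..
  next
    case 3
    note VZ = VZI[OF 3(1)] and EZ = EZI[OF 3(2)]
    have "?P \<inter> special n = ?F"
      unfolding sp VZ(2) EZ(2) Int_absorb1[OF FP] by (simp only: Un_empty_left)
    then have p: "k = ?p * (2 * n) + 2" using countP cF cP by simp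
    have "?Z \<inter> special n = ?V \<union> ?E"
      unfolding sp Int_absorb1[OF VZ(1)] Int_absorb1[OF EZ(1)] FZ by (simp only: Un_empty_right)
    then have "card ?Z = 2 * n * ?z + 2 * n" using countZ cVE by simp
    then have "int k - 2 = 2 * (int n * int ?z) + 2 * int n" using cZ by simp
    moreover have "int k = 2 * (int n * int ?p) + 2" using p by simp
    ultimately have "int n * int ?z = int n * (int ?p + (-1))" by (simp add: right_diff_distrib)
    from cancel[OF this] have z: "int ?z = int ?p - 1" by simp
    have "case_B \<eta> k (conj_by T (Dih n)) A Q"
      unfolding case_B_def parts QP QZ cG cardT cV(1) cE(1) cF
      by (intro conjI exI[of _ ?p] Un_least refl z p TP[THEN iffD2] TZ[THEN iffD2] VZ(1) EZ(1) FP)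
    then show ?thesis ..
  next
    case 4
    have "\<not> ?V \<subseteq> ?P"
    proof
      assume sub: "?V \<subseteq> ?P"
      have "Some 1 \<in> ?V" by simp
      then have "Some 1 \<in> ?P" by (rule subsetD[OF sub])
      then show False using 4(1) inP by simp
    qed
    moreover have "\<not> ?E \<subseteq> ?Z"
    proof
      assume sub: "?E \<subseteq> ?Z"
      have "Some e \<in> ?E" using e by simp
      then have "Some e \<in> ?Z" by (rule subsetD[OF sub])
      then show False using 4(2) inZ by simp
    qed
    moreover have "?V \<subseteq> ?P \<or> ?E \<subseteq> ?Z" using choice unfolding parts TP TZ .
    ultimately show ?thesis by (elim disjE notE)
  qed
qed

section \<open>Invariance and maximality\<close>

lemma invariant_imp_set_invariant:
  assumes H: "H \<subseteq> Moeb" and \<eta>: "\<eta> \<noteq> 0" and inv: "form_invariant H \<eta>"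
  shows "set_invariant H (form_poles \<eta>)" "set_invariant H (form_zeros \<eta>)"
proof -
  have im: "g ` {x. p (form_order \<eta> x)} = {x. p (form_order \<eta> x)}" if g: "g \<in> H" for g p
  proof -
    have gM: "g \<in> Moeb" using g H by blast
    have "g \<in> form_isotropy \<eta>" using g inv form_invariant_iff_isotropy[OF H] by blast
    then have ord: "form_order \<eta> (g x) = form_order \<eta> x" for x
      using form_order_pullback[OF gM \<eta>, of x] by (simp add: form_isotropy_iff)
    show ?thesis
    proof (intro equalityI subsetI)
      fix y assume y: "y \<in> {x. p (form_order \<eta> x)}"
      obtain x where x: "y = g x" using bij_is_surj[OF Moeb_bij[OF gM]] by (rule surjE)
      then show "y \<in> g ` {x. p (form_order \<eta> x)}" using y ord by simp
    qed (use ord in auto)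
  qed
  show "set_invariant H (form_poles \<eta>)"
    unfolding set_invariant_def form_poles_def by (intro ballI im)
  show "set_invariant H (form_zeros \<eta>)"
    unfolding set_invariant_def form_zeros_def by (intro ballI im)
qed

text \<open>The rotation by \<open>\<pi> / n\<close> normalizes \<open>Dih n\<close>. It moves the vertices to the edge centers, so the same
  group is the isotropy group of two dihedra with these roles exchanged.\<close>

lemma conj_by_half_step:
  assumes n: "n > 0" and T: "T \<in> Moeb"
  shows "conj_by (T \<circ> dil (cis (pi / real n))) (Dih n) = conj_by T (Dih n)"
proof -
  define e where "e = cis (pi / real n)"
  have e0: "e \<noteq> 0" by (simp add: e_def)
  have e2: "(e * e) ^ n = 1" using half_root[OF n] by (simp add: e_def power_mult_distrib)
  have D: "dil e \<circ> dil a \<circ> dil (1 / e) = dil a" "dil e \<circ> flip a \<circ> dil (1 / e) = flip (a * (e * e))"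
    if "a ^ n = 1" for a
    using e0 root_of_unity_nonzero[OF n that] by (simp_all add: dil_flip_comp mult_ac)
  have "conj_by (dil e) (Dih n) = Dih n"
  proof (intro equalityI subsetI)
    fix g assume "g \<in> conj_by (dil e) (Dih n)"
    then obtain h where h: "h \<in> Dih n" "g = dil e \<circ> h \<circ> dil (1 / e)"
      unfolding conj_by_def minv_dil[OF e0] by blast
    from h(1) show "g \<in> Dih n"
    proof (rule DihE)
      fix a assume "a ^ n = 1" "h = dil a"
      then show ?thesis using h(2) D by simp
    next
      fix a assume a: "a ^ n = 1" "h = flip a"
      then have "g = flip (a * (e * e))" using h(2) D by simp
      moreover have "(a * (e * e)) ^ n = 1" unfolding power_mult_distrib[of a] a(1) e2 by simp
      ultimately show ?thesis by simp
    qed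
  next
    fix g assume "g \<in> Dih n"
    then show "g \<in> conj_by (dil e) (Dih n)"
    proof (rule DihE)
      fix a assume a: "a ^ n = 1" "g = dil a"
      then have "g = dil e \<circ> dil a \<circ> minv (dil e)" unfolding minv_dil[OF e0] using D by simp
      then show ?thesis unfolding conj_by_def using a by auto
    next
      fix a assume a: "a ^ n = 1" "g = flip a"
      have b: "(a / (e * e)) ^ n = 1" unfolding power_divide a(1) e2 by simp
      have "a / (e * e) * (e * e) = a" using e0 by simp
      then have "g = dil e \<circ> flip (a / (e * e)) \<circ> minv (dil e)" unfolding minv_dil[OF e0] D(2)[OF b] a(2) by simp
      then show ?thesis unfolding conj_by_def using b by auto
    qed
  qed
  then show ?thesis unfolding e_def[symmetric] conj_by_comp[OF T dil_Moeb[OF e0]] by simp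
qed

text \<open>If the form is invariant, the orders at the special points put it into one of the cases, provided
  that the dihedron is rotated by half a step when its vertices are zeros and its edge centers are
  poles. The region given by \<open>Q\<close> may use another presentation \<open>T'\<close> of the dihedron than the one at hand;
  since the isotropy groups agree, the counts are made with \<open>T'\<close>. Conversely each case makes the face
  centers poles and gives the vertices and edge centers odd order.\<close>

lemma form_invariant_iff_satisfies:
  assumes n: "n \<ge> 3" and T: "T \<in> Moeb" and \<eta>: "\<eta> \<noteq> 0" and simple: "simple_poles_and_zeros \<eta>"
    and k: "card (form_poles \<eta>) = k" "int (card (form_zeros \<eta>)) = int k - 2"
    and Q: "\<And>A. is_dihedron n A \<Longrightarrow> quasi_fundamental_region n A (Q A)"
  shows "form_invariant (conj_by T (Dih n)) \<eta> \<longleftrightarrow> satisfies_A_or_B Q \<eta> k n (conj_by T (Dih n))"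
proof
  have n0: "n > 0" using n by simp
  let ?H = "conj_by T (Dih n)"
  assume inv: "form_invariant ?H \<eta>"
  have HM: "?H \<subseteq> Moeb" using subgroup_conj_by[OF T subgroup_Dih[OF n0]] by (rule subgroup.subset)
  define e where "e = cis (pi / real n)"
  have e0: "e \<noteq> 0" by (simp add: e_def)
  have e: "e ^ n = -1" using half_root[OF n0] by (simp add: e_def)
  have U: "T \<circ> dil e \<in> Moeb" using T e0 by (simp add: Moeb_comp dil_Moeb)
  have HU: "conj_by (T \<circ> dil e) (Dih n) = ?H" using conj_by_half_step[OF n0 T] by (simp add: e_def)
  obtain S where S: "S \<in> Moeb" "conj_by S (Dih n) = ?H"
    "vertices (map_dihedron S (std_dihedron n)) \<subseteq> form_poles \<eta> \<or>
     edge_centers (map_dihedron S (std_dihedron n)) \<subseteq> form_zeros \<eta>"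
  proof (cases "edge_centers (map_dihedron T (std_dihedron n)) \<subseteq> form_zeros \<eta>")
    case True
    then show ?thesis using that[OF T refl] by blast
  next
    case False
    have ordT: "form_order (pullback T \<eta>) x = form_order \<eta> (T x)" for x using form_order_pullback[OF T \<eta>] .
    have small: "\<bar>form_order \<eta> x\<bar> \<le> 1" for x using simple_order_bound[OF simple] .
    have inv\<theta>: "pullback h (pullback T \<eta>) = pullback T \<eta>" if "h \<in> Dih n" for h
      using inv that unfolding form_invariant_conj[OF T Dih_Moeb[OF n0]] form_invariant_Dih[OF n0] by blast
    have orders: "\<And>h x. h \<in> Dih n \<Longrightarrow> form_order (pullback T \<eta>) (h x) = form_order (pullback T \<eta>) x"
      "dihedral_orders n (pullback T \<eta>)"
      using invariant_imp_orders[OF n pullback_nonzero[OF T \<eta>] inv\<theta>] small unfolding ordT by blast+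
    obtain z where z: "z ^ n = -1" "T (Some z) \<notin> form_zeros \<eta>" using False n0 by auto
    have "odd (form_order \<eta> (T (Some z)))"
      using orders(2) z(1) unfolding dihedral_orders_def ordT by blast
    then have "form_order \<eta> (T (Some z)) = -1"
      using z(2) small[of "T (Some z)"] by (cases "form_order \<eta> (T (Some z)) = 0") (auto simp: form_zeros_def)
    have pole: "T (Some (e * y)) \<in> form_poles \<eta>" if y: "y ^ n = 1" for y
    proof -
      have "(e * y / z) ^ n = 1" unfolding power_divide power_mult_distrib y z(1) e by simp
      moreover have "z \<noteq> 0" using z(1) n0 by (auto simp: power_0_left)
      ultimately have "form_order \<eta> (T (Some (e * y))) = form_order \<eta> (T (Some z))"
        using orders(1)[of "dil (e * y / z)" "Some z"] unfolding ordT by simp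
      then show ?thesis using \<open>form_order \<eta> (T (Some z)) = -1\<close> by (simp add: form_poles_def)
    qed
    have "vertices (map_dihedron (T \<circ> dil e) (std_dihedron n)) \<subseteq> form_poles \<eta>"
      using pole by auto
    then show ?thesis using that[OF U HU] by blast
  qed
  define A where "A = map_dihedron S (std_dihedron n)"
  have dA: "is_dihedron n A" unfolding is_dihedron_def A_def using S(1) by blast
  obtain R where "fundamental_region n A R" and QA: "Q A = R - (vertices A \<union> edge_centers A \<union> face_centers A)"
    using Q[OF dA] unfolding quasi_fundamental_region_def by blast
  then obtain T' R0 where T': "T' \<in> Moeb" "A = map_dihedron T' (std_dihedron n)"
    and R0: "std_fundamental_region n R0" "R = T' ` R0"
    unfolding fundamental_region_def by blast
  have iso: "dihedron_isotropy n A = ?H"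
    unfolding A_def dihedron_isotropy_conj[OF n0 S(1)] by (rule S(2))
  have HT': "conj_by T' (Dih n) = ?H"
    using dihedron_isotropy_conj[OF n0 T'(1)] iso unfolding T'(2)[symmetric] by simp
  have "case_A \<eta> k (conj_by T' (Dih n)) A (Q A) \<or> case_B \<eta> k (conj_by T' (Dih n)) A (Q A)"
  proof (rule invariant_imp_case[OF n T'(1) \<eta> simple k _ T'(2) R0(1)])
    show "form_invariant (conj_by T' (Dih n)) \<eta>" unfolding HT' by (rule inv)
    show "Q A = T' ` R0 - (vertices A \<union> edge_centers A \<union> face_centers A)" unfolding QA R0(2) ..
    show "vertices A \<subseteq> form_poles \<eta> \<or> edge_centers A \<subseteq> form_zeros \<eta>" unfolding A_def by (rule S(3))
  qed
  then show "satisfies_A_or_B Q \<eta> k n ?H"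
    unfolding satisfies_A_or_B_def HT'
    using invariant_imp_set_invariant[OF HM \<eta> inv] dA iso by blast
next
  have n0: "n > 0" using n by simp
  let ?H = "conj_by T (Dih n)"
  assume sat: "satisfies_A_or_B Q \<eta> k n ?H"
  then obtain A where A: "is_dihedron n A" "dihedron_isotropy n A = ?H"
    "case_A \<eta> k ?H A (Q A) \<or> case_B \<eta> k ?H A (Q A)"
    and si: "set_invariant ?H (form_poles \<eta>)" "set_invariant ?H (form_zeros \<eta>)"
    unfolding satisfies_A_or_B_def by blast
  obtain T' where T': "T' \<in> Moeb" "A = map_dihedron T' (std_dihedron n)"
    using A(1) unfolding is_dihedron_def by blast
  have HT': "conj_by T' (Dih n) = ?H"
    using dihedron_isotropy_conj[OF n0 T'(1)] A(2) unfolding T'(2)[symmetric] by simp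
  have parts: "face_centers A \<subseteq> form_poles \<eta>" "vertices A \<subseteq> form_poles \<eta> \<union> form_zeros \<eta>"
    "edge_centers A \<subseteq> form_poles \<eta> \<union> form_zeros \<eta>"
    using A(3) unfolding case_A_def case_B_def by blast+
  let ?\<theta> = "pullback T' \<eta>"
  have ordT: "form_order ?\<theta> x = form_order \<eta> (T' x)" for x using form_order_pullback[OF T'(1) \<eta>] .
  have pole: "form_order \<eta> x = -1" if "x \<in> form_poles \<eta>" for x
    using simple that unfolding simple_poles_and_zeros_def by blast
  have zero: "form_order \<eta> x = 1" if "x \<in> form_zeros \<eta>" for x
    using simple that unfolding simple_poles_and_zeros_def by blast
  have rest: "form_order \<eta> x = 0" if "x \<notin> form_poles \<eta>" "x \<notin> form_zeros \<eta>" for x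
    using that unfolding form_poles_def form_zeros_def by simp
  have "T' (Some 0) \<in> form_poles \<eta>" "T' None \<in> form_poles \<eta>"
    using parts(1) unfolding T'(2) by auto
  moreover have "odd (form_order \<eta> (T' (Some z)))" if "z ^ n = 1 \<or> z ^ n = -1" for z
  proof -
    have "Some z \<in> vertices (std_dihedron n) \<union> edge_centers (std_dihedron n)"
      using that n0 by simp
    then have "T' (Some z) \<in> vertices A \<union> edge_centers A"
      unfolding T'(2) map_dihedron_simps image_Un[symmetric] by (rule imageI)
    then have "T' (Some z) \<in> form_poles \<eta> \<union> form_zeros \<eta>"
      using parts(2,3) by blast
    then show ?thesis using pole zero by auto
  qed
  ultimately have axis: "dihedral_orders n ?\<theta>"
    unfolding dihedral_orders_def ordT using pole by blast
  have ord: "form_order ?\<theta> (h x) = form_order ?\<theta> x" if h: "h \<in> Dih n" for h x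
  proof -
    define g where "g = T' \<circ> h \<circ> minv T'"
    have hM: "h \<in> Moeb" using Dih_Moeb[OF n0] h by blast
    have "g \<in> conj_by T' (Dih n)" unfolding conj_by_def g_def using h by blast
    then have gH: "g \<in> ?H" unfolding HT' .
    have inj: "inj g" unfolding g_def using T'(1) hM by (intro bij_is_inj Moeb_bij Moeb_comp Moeb_inv)
    have im: "g ` form_poles \<eta> = form_poles \<eta>" "g ` form_zeros \<eta> = form_zeros \<eta>"
      using si gH unfolding set_invariant_def by blast+
    have mem: "g y \<in> form_poles \<eta> \<longleftrightarrow> y \<in> form_poles \<eta>" "g y \<in> form_zeros \<eta> \<longleftrightarrow> y \<in> form_zeros \<eta>" for y
      using inj_image_mem_iff[OF inj, of y "form_poles \<eta>"] inj_image_mem_iff[OF inj, of y "form_zeros \<eta>"]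
      unfolding im by simp_all
    have ordg: "form_order \<eta> (g y) = form_order \<eta> y" for y
      by (cases "y \<in> form_poles \<eta>"; cases "y \<in> form_zeros \<eta>") (simp_all add: pole zero rest mem)
    have gT: "g (T' x) = T' (h x)"
      unfolding g_def using Moeb_bij[OF T'(1)] by (simp add: bij_is_inj)
    show ?thesis unfolding ordT gT[symmetric] by (rule ordg)
  qed
  have "form_invariant (Dih n) ?\<theta>"
    unfolding form_invariant_Dih[OF n0]
  proof
    fix h assume h: "h \<in> Dih n"
    show "pullback h ?\<theta> = ?\<theta>"
      by (rule orders_imp_invariant[OF n0 pullback_nonzero[OF T'(1) \<eta>] _ axis h]) (rule ord)
  qed
  then show "form_invariant ?H \<eta>"
    unfolding HT'[symmetric] form_invariant_conj[OF T'(1) Dih_Moeb[OF n0]] .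
qed

text \<open>Conjugation by \<open>S\<close> maps a rotation of order greater than two to a rotation, because half-turns
  have order two. So \<open>S\<close> preserves the set \<open>{0, \<infinity>}\<close> of fixed points and is \<open>b z\<close> or \<open>b / z\<close>. In both
  cases conjugation by \<open>S\<close> turns \<open>1 / z\<close> into \<open>b\<^sup>2 / z\<close>.\<close>

lemma normalizer_Dih:
  assumes n: "n \<ge> 3" and S: "S \<in> Moeb" and norm: "conj_by S (Dih n) \<subseteq> Dih n"
  obtains b where "b ^ (2 * n) = 1" "S = dil b \<or> S = flip b"
proof -
  have n0: "n > 0" using n by simp
  obtain a :: complex where a: "a ^ n = 1" "a \<noteq> 1" "a * a \<noteq> 1" using exists_root_order_gt_2[OF n] .
  have S': "minv S (S x) = x" for x using Moeb_bij[OF S] by (simp add: bij_is_inj)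
  define g where "g = S \<circ> dil a \<circ> minv S"
  have gS: "g (S x) = S (dil a x)" for x by (simp add: g_def S')
  have inN: "S \<circ> h \<circ> minv S \<in> Dih n" if "h \<in> Dih n" for h
    by (rule subsetD[OF norm]) (use that in \<open>unfold conj_by_def, blast\<close>)
  have "g \<in> Dih n" unfolding g_def using a(1) by (intro inN) simp
  then obtain c where c: "c ^ n = 1" "g = dil c" "c \<noteq> 1"
  proof (rule DihE)
    fix c assume c: "c ^ n = 1" "g = dil c"
    have "c \<noteq> 1"
    proof
      assume "c = 1"
      then have "g (S (Some 1)) = S (Some 1)" using c(2) by (simp add: dil_1)
      then have "minv S (S (dil a (Some 1))) = minv S (S (Some 1))" unfolding gS by simp
      then show False unfolding S' using a(2) by simp
    qed
    then show ?thesis using that c by blast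
  next
    fix c assume c: "c ^ n = 1" "g = flip c"
    have "c \<noteq> 0" using root_of_unity_nonzero[OF n0 c(1)] .
    then have "g \<circ> g = id" unfolding c(2) by (simp add: dil_flip_comp dil_1)
    from fun_cong[OF this, of "S (Some 1)"]
    have "S (dil a (dil a (Some 1))) = S (Some 1)" unfolding gS[symmetric] by simp
    then have "minv S (S (dil a (dil a (Some 1)))) = minv S (S (Some 1))" by simp
    then show ?thesis unfolding S' using a(3) by simp
  qed
  have fixc: "x \<in> {Some 0, None}" if "dil c x = x" for x
    using that c(3) by (cases x) auto
  have "g (S (Some 0)) = S (Some 0)" "g (S None) = S None" unfolding gS by simp_all
  then have "S (Some 0) \<in> {Some 0, None}" "S None \<in> {Some 0, None}"
    using fixc unfolding c(2) by blast+
  moreover have "S (Some 0) \<noteq> S None"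
    using bij_is_inj[OF Moeb_bij[OF S]] by (metis injD option.distinct(1))
  ultimately have im: "S ` {Some 0, None} = {Some 0, None}" by auto
  have f1: "S \<circ> flip 1 \<circ> minv S \<in> Dih n" by (intro inN) simp
  have sq: "b ^ (2 * n) = 1" if "S \<circ> flip 1 \<circ> minv S = flip (b * b)" for b
  proof -
    have "(b * b) ^ n = 1" using f1 unfolding that by simp
    then show ?thesis by (simp add: power_mult power2_eq_square)
  qed
  from S im show ?thesis
  proof (rule Moeb_preserves_zero_inf)
    fix b assume b: "b \<noteq> 0" "S = dil b"
    have "S \<circ> flip 1 \<circ> minv S = flip (b * b)"
      unfolding b(2) minv_dil[OF b(1)] using b(1) by (simp add: dil_flip_comp)
    then show ?thesis using that[OF sq] b(2) by blast
  next
    fix b assume b: "b \<noteq> 0" "S = flip b"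
    have "S \<circ> flip 1 \<circ> minv S = flip (b * b)"
      unfolding b(2) minv_flip[OF b(1)] using b(1) by (simp add: dil_flip_comp)
    then show ?thesis using that[OF sq] b(2) by blast
  qed
qed

text \<open>\<open>Dih n\<close> has index two in \<open>Dih (2 n)\<close>, and \<open>S\<close> lies in the other coset.\<close>

lemma Dih_double:
  assumes n: "n > 0" and b: "b ^ n = -1" and S: "S = dil b \<or> S = flip b" and h: "h \<in> Dih (2 * n)"
  shows "h \<in> Dih n \<or> (\<exists>g\<in>Dih n. h = S \<circ> g)"
proof -
  have b0: "b \<noteq> 0" using b n by (auto simp: power_0_left)
  have alt: "a ^ n = 1 \<or> a ^ n = -1" if "a ^ (2 * n) = 1" for a :: complex
  proof -
    have "a ^ n * a ^ n = 1" using that by (simp add: power_add[symmetric] mult_2)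
    then show ?thesis using square_eq_1_iff by blast
  qed
  have root: "(a / b) ^ n = 1" "(b / a) ^ n = 1" if "a ^ n = -1" for a
    using that b by (simp_all add: power_divide)
  have a0: "a \<noteq> 0" if "a ^ n = -1" for a :: complex using that n by (auto simp: power_0_left)
  from h show ?thesis
  proof (rule DihE)
    fix a assume a: "a ^ (2 * n) = 1" "h = dil a"
    show ?thesis
    proof (cases "a ^ n = 1")
      case False
      then have an: "a ^ n = -1" using alt[OF a(1)] by blast
      have eq: "h = dil b \<circ> dil (a / b)" "h = flip b \<circ> flip (b / a)"
        using a(2) a0[OF an] b0 by (simp_all add: dil_flip_comp)
      have mem: "dil (a / b) \<in> Dih n" "flip (b / a) \<in> Dih n" using root[OF an] by simp_all
      from S show ?thesis
      proof
        assume "S = dil b"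
        then show ?thesis using bexI[OF _ mem(1), of "\<lambda>g. h = S \<circ> g"] eq(1) by simp
      next
        assume "S = flip b"
        then show ?thesis using bexI[OF _ mem(2), of "\<lambda>g. h = S \<circ> g"] eq(2) by simp
      qed
    qed (use a in simp)
  next
    fix a assume a: "a ^ (2 * n) = 1" "h = flip a"
    show ?thesis
    proof (cases "a ^ n = 1")
      case False
      then have an: "a ^ n = -1" using alt[OF a(1)] by blast
      have eq: "h = dil b \<circ> flip (a / b)" "h = flip b \<circ> dil (b / a)"
        using a(2) a0[OF an] b0 by (simp_all add: dil_flip_comp)
      have mem: "flip (a / b) \<in> Dih n" "dil (b / a) \<in> Dih n" using root[OF an] by simp_all
      from S show ?thesis
      proof
        assume "S = dil b"
        then show ?thesis using bexI[OF _ mem(1), of "\<lambda>g. h = S \<circ> g"] eq(1) by simp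
      next
        assume "S = flip b"
        then show ?thesis using bexI[OF _ mem(2), of "\<lambda>g. h = S \<circ> g"] eq(2) by simp
      qed
    qed (use a in simp)
  qed
qed

theorem theorem3p29:
  fixes G :: "(csphere \<Rightarrow> csphere) set" and n k :: nat and \<eta> :: rational_form
    and Q :: "dihedron \<Rightarrow> csphere set"
  assumes "n \<ge> 3"
    and "subgroup G PSL2C"
    and "PSL2C\<lparr>carrier := G\<rparr> \<cong> dihedral_group n"
    and "\<eta> \<noteq> 0"
    and "simple_poles_and_zeros \<eta>"
    and "card (form_poles \<eta>) = k"
    and "int (card (form_zeros \<eta>)) = int k - 2"
    and "\<And>m A. m \<ge> 3 \<Longrightarrow> is_dihedron m A \<Longrightarrow> quasi_fundamental_region m A (Q A)"
  shows "(form_invariant G \<eta> \<longleftrightarrow> satisfies_A_or_B Q \<eta> k n G) \<and>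
    ((satisfies_A_or_B Q \<eta> k n G \<and>
      (\<forall>H m. subgroup H PSL2C \<longrightarrow> m \<ge> 3 \<longrightarrow> satisfies_A_or_B Q \<eta> k m H \<longrightarrow> H \<subseteq> G))
     \<longleftrightarrow> form_isotropy \<eta> = G)"
proof -
  let ?K = "form_isotropy \<eta>"
  have n0: "n > 0" using assms(1) by simp
  obtain T where T: "T \<in> Moeb" and G: "G = conj_by T (Dih n)"
    using dihedral_conj_Dih[OF assms(1-3)] by blast
  have HM: "conj_by S (Dih m) \<subseteq> Moeb" "subgroup (conj_by S (Dih m)) PSL2C" if "S \<in> Moeb" "m \<ge> 3" for S m
    using subgroup_conj_by[OF that(1) subgroup_Dih[of m]] subgroup.subset that(2) by auto
  have key: "satisfies_A_or_B Q \<eta> k m (conj_by S (Dih m)) \<longleftrightarrow> conj_by S (Dih m) \<subseteq> ?K"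
    if "S \<in> Moeb" "m \<ge> 3" for S m
    using form_invariant_iff_satisfies[OF that(2,1) assms(4-7) assms(8)[OF that(2)]]
      form_invariant_iff_isotropy[OF HM(1)[OF that]] by simp
  have keyG: "satisfies_A_or_B Q \<eta> k n G \<longleftrightarrow> G \<subseteq> ?K"
    unfolding G by (rule key[OF T assms(1)])
  have first: "form_invariant G \<eta> \<longleftrightarrow> satisfies_A_or_B Q \<eta> k n G"
    unfolding keyG by (rule form_invariant_iff_isotropy) (use HM(1)[OF T assms(1)] G in simp)
  have "satisfies_A_or_B Q \<eta> k n G \<and>
      (\<forall>H m. subgroup H PSL2C \<longrightarrow> m \<ge> 3 \<longrightarrow> satisfies_A_or_B Q \<eta> k m H \<longrightarrow> H \<subseteq> G)" if eq: "?K = G"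
  proof (intro conjI allI impI)
    show "satisfies_A_or_B Q \<eta> k n G" unfolding keyG using eq by simp
    fix H m assume m: "(3::nat) \<le> m" and sat: "satisfies_A_or_B Q \<eta> k m H"
    obtain A where A: "is_dihedron m A" "dihedron_isotropy m A = H"
      using sat unfolding satisfies_A_or_B_def by blast
    obtain S where S: "S \<in> Moeb" "A = map_dihedron S (std_dihedron m)"
      using A(1) unfolding is_dihedron_def by blast
    have H: "H = conj_by S (Dih m)"
      using dihedron_isotropy_conj[of m S] m S A(2) by simp
    show "H \<subseteq> G" using sat key[OF S(1) m] unfolding H eq by blast
  qed
  moreover have "?K = G" if sat: "satisfies_A_or_B Q \<eta> k n G"
    and max: "\<forall>H m. subgroup H PSL2C \<longrightarrow> m \<ge> 3 \<longrightarrow> satisfies_A_or_B Q \<eta> k m H \<longrightarrow> H \<subseteq> G"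
  proof
    show GK: "G \<subseteq> ?K" using sat unfolding keyG .
    have maxD: "conj_by S (Dih m) \<subseteq> G" if "S \<in> Moeb" "m \<ge> 3" "conj_by S (Dih m) \<subseteq> ?K" for S m
      using max HM(2)[OF that(1,2)] that(2) key[OF that(1,2)] that(3) by blast
    show "?K \<subseteq> G"
    proof
      fix t assume t: "t \<in> ?K"
      have tM: "t \<in> Moeb" using t by (simp add: form_isotropy_iff)
      define s where "s = minv T \<circ> t \<circ> T"
      have sM: "s \<in> Moeb" unfolding s_def using T tM by (intro Moeb_comp Moeb_inv)
      have "T \<circ> s \<circ> minv T = (T \<circ> minv T) \<circ> t \<circ> (T \<circ> minv T)" unfolding s_def by (simp only: comp_assoc)
      then have ts: "T \<circ> s \<circ> minv T = t" using T by simp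
      have tT: "t \<circ> T = T \<circ> s"
      proof -
        have "T \<circ> s = (T \<circ> minv T) \<circ> (t \<circ> T)" unfolding s_def by (simp only: comp_assoc)
        then show ?thesis using T by simp
      qed
      \<comment> \<open>the conjugate of \<open>G\<close> by \<open>t\<close> is a dihedral group leaving the form invariant, so \<open>t\<close> normalizes \<open>G\<close>\<close>
      have "conj_by t G \<subseteq> ?K"
      proof
        fix f assume "f \<in> conj_by t G"
        then obtain g where g: "g \<in> G" "f = t \<circ> g \<circ> minv t" unfolding conj_by_def by blast
        show "f \<in> ?K" unfolding g(2)
          by (intro form_isotropy_comp form_isotropy_minv t subsetD[OF GK g(1)])
      qed
      then have "conj_by (t \<circ> T) (Dih n) \<subseteq> G"
        unfolding G conj_by_comp[OF tM T, symmetric]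
        by (intro maxD[unfolded G] Moeb_comp tM T assms(1))
      then have sub: "conj_by T (conj_by s (Dih n)) \<subseteq> conj_by T (Dih n)"
        unfolding tT conj_by_comp[OF T sM] G .
      have norm: "conj_by s (Dih n) \<subseteq> Dih n"
      proof
        fix h assume "h \<in> conj_by s (Dih n)"
        then have "T \<circ> h \<circ> minv T \<in> conj_by T (Dih n)" using sub unfolding conj_by_def by blast
        then obtain h' where "h' \<in> Dih n" "T \<circ> h \<circ> minv T = T \<circ> h' \<circ> minv T" unfolding conj_by_def by blast
        then show "h \<in> Dih n" using conj_cancel[OF T] by blast
      qed
      obtain b where b: "b ^ (2 * n) = 1" "s = dil b \<or> s = flip b"
        by (rule normalizer_Dih[OF assms(1) sM norm])
      have "b ^ n * b ^ n = 1" using b(1) by (simp add: power_add[symmetric] mult_2)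
      then consider "b ^ n = 1" | "b ^ n = -1" using square_eq_1_iff by blast
      then show "t \<in> G"
      proof cases
        case 1
        then have "s \<in> Dih n" using b(2) by auto
        then show ?thesis unfolding G conj_by_def using ts by blast
      next
        case 2
        \<comment> \<open>\<open>G\<close> and \<open>t\<close> generate a dihedral group twice as large, which maximality puts back into \<open>G\<close>\<close>
        have "conj_by T (Dih (2 * n)) \<subseteq> ?K"
        proof
          fix f assume "f \<in> conj_by T (Dih (2 * n))"
          then obtain h where h: "h \<in> Dih (2 * n)" "f = T \<circ> h \<circ> minv T" unfolding conj_by_def by blast
          have inK: "T \<circ> g \<circ> minv T \<in> ?K" if "g \<in> Dih n" for g
            using that GK unfolding G conj_by_def by blast
          show "f \<in> ?K"
            using Dih_double[OF n0 2 b(2) h(1)]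
          proof
            assume "h \<in> Dih n"
            then show ?thesis using inK h(2) by simp
          next
            assume "\<exists>g\<in>Dih n. h = s \<circ> g"
            then obtain g where g: "g \<in> Dih n" "h = s \<circ> g" by blast
            have "f = (T \<circ> s) \<circ> g \<circ> minv T" unfolding h(2) g(2) by (simp only: comp_assoc)
            also have "\<dots> = t \<circ> (T \<circ> g \<circ> minv T)" unfolding tT[symmetric] by (simp only: comp_assoc)
            finally show ?thesis using form_isotropy_comp[OF t inK[OF g(1)]] by simp
          qed
        qed
        then have "conj_by T (Dih (2 * n)) \<subseteq> G" using maxD[OF T, of "2 * n"] assms(1) by simp
        moreover have "s \<in> Dih (2 * n)" using b by auto
        then have "t \<in> conj_by T (Dih (2 * n))" unfolding conj_by_def using ts by blast
        ultimately show ?thesis by blast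
      qed
    qed
  qed
  ultimately show ?thesis using first by blast
qed

end
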